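(* Let $\sigma,\mu,\nu$ be complex constants with $\sigma\neq 0$, and let $f(z)$ be an entire solution of $$f''+(\mathrm{e}^{2z}-\nu^2)f=\sigma\,\mathrm{e}^{(\mu+1)z}.$$ (a) The general solution is $f(z)=AJ_\nu(\mathrm{e}^z)+BY_\nu(\mathrm{e}^z)+\sigma S_{\mu,\nu}(\mathrm{e}^z)$, where $A,B$ are constants. (b) The function $f$ in (a) is subnormal if and only if $A=B=0$, and either $\mu+\nu=2p+1$ or $\mu-\nu=2p+1$ for some non-negative integer $p$, and $$S_{\mu,\nu}(\zeta)=\zeta^{\mu-1}\sum_{k=0}^{p}\frac{(-1)^k c_k}{\zeta^{2k}},\qquad c_0=1,\ c_k=\prod_{m=1}^{k}\big[(\mu-2m+1)^2-\nu^2\big].$$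
   Context: $J_\nu,Y_\nu$ are the Bessel functions of the first and second kinds, $H^{(1)}_\nu=J_\nu+iY_\nu$, $H^{(2)}_\nu=J_\nu-iY_\nu$; $\psi=\Gamma'/\Gamma$; $(a)_k=a(a+1)\cdots(a+k-1)$; powers and logarithms are taken on the principal branch $-\pi<\arg\zeta<\pi$. The Lommel function $S_{\mu,\nu}(\zeta)$ is the following (multivalued) particular solution of $\zeta^2y''+\zeta y'+(\zeta^2-\nu^2)y=\zeta^{\mu+1}$. (i) If neither $\mu+\nu$ nor $\mu-\nu$ is an odd negative integer: $s_{\mu,\nu}(\zeta)=\sum_{m\ge0}(-1)^m\zeta^{\mu+1+2m}/\prod_{k=0}^{m}[(\mu+2k+1)^2-\nu^2]$ and $S_{\mu,\nu}(\zeta)=s_{\mu,\nu}(\zeta)+K\big[J_\nu(\zeta)\sin\frac{(\mu-\nu)\pi}{2}-Y_\nu(\zeta)\cos\frac{(\mu-\nu)\pi}{2}\big]$ with $K=2^{\mu-1}\Gamma(\frac{\mu-\nu+1}{2})\Gamma(\frac{\mu+\nu+1}{2})$. (ii) If $\mu=\nu-2p-1$ with $p$ a non-negative integer and $\nu\notin\{1,\dots,p\}$: $S_{\nu-2p-1,\nu}(\zeta)=\sum_{m=0}^{p-1}\frac{(-1)^m\zeta^{\nu-2p+2m}}{2^{2m+2}(-p)_{m+1}(\nu-p)_{m+1}}+\frac{(-1)^pS_{\nu-1,\nu}(\zeta)}{2^{2p}p!(1-\nu)_p}$, where: if $-\nu\notin\{0,1,2,\dots\}$, $S_{\nu-1,\nu}(\zeta)=\Gamma(\nu)\big[2^{\nu-1}J_\nu(\zeta)\log\zeta-2^{\nu-2}\pi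 Y_\nu(\zeta)-\frac{\zeta^\nu}{4}\sum_{m\ge0}\frac{(-1)^m(\zeta/2)^{2m}A(m)}{m!\Gamma(\nu+m+1)}\big]$ with $A(m)=2\log2+\psi(\nu+m+1)+\psi(m+1)$; if $\nu=0$, $S_{-1,0}(\zeta)=\frac12\sum_{m\ge0}\frac{(-1)^m(\zeta/2)^{2m}}{(m!)^2}\{[\log\frac{\zeta}{2}-\psi(m+1)]^2-\frac12\psi'(m+1)+\frac{\pi^2}{4}\}$; if $\nu=-n$, $n$ a positive integer, $S_{-n-1,-n}(\zeta)=\frac{(-1)^n\zeta^n}{n!}\frac{d^n}{d(\zeta^2)^n}S_{-1,0}(\zeta)$. (iii) If $\mu+\nu$ is an odd negative integer and (ii) does not apply, $S_{\mu,\nu}:=S_{\mu,-\nu}$. For a function $g$ among $J_\nu,Y_\nu,S_{\mu,\nu}$, $g(\mathrm{e}^z)$ denotes the entire function of $z$ obtained by analytic continuation of a branch of $g$ along $\zeta=\mathrm{e}^z$. An entire function $f$ is subnormal if $\limsup_{r\to\infty}\frac{\log\log M(r,f)}{r}=0$, where $M(r,f)=\max_{|z|\le r}|f(z)|$. *)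

theory Defs
  imports "HOL-Complex_Analysis.Complex_Analysis" "HOL-Library.Liminf_Limsup"
begin

(* Convention: for g among J_nu, Y_nu, S_{mu,nu}, the entire function g(e^z) is the
   analytic continuation (in z) of the principal branch g(zeta), zeta = e^z, |Im z| < pi.
   Along this continuation zeta^a = exp(a*z) and log zeta = z.  All the functions
   below are these continuations, written as functions of z. *)

definition ln2c :: complex where "ln2c = of_real (ln 2)"

definition besselJ_e :: "complex \<Rightarrow> complex \<Rightarrow> complex" where
  "besselJ_e \<nu> z = (\<Sum>m. (-1)^m * exp ((\<nu> + 2 * of_nat m) * (z - ln2c))
                        * rGamma (\<nu> + of_nat m + 1) / fact m)"

definition besselY_gen :: "complex \<Rightarrow> complex \<Rightarrow> complex" where
  "besselY_gen \<nu> z = (besselJ_e \<nu> z * cos (\<nu> * pi) - besselJ_e (-\<nu>) z) / sin (\<nu> * pi)"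

definition besselY_e :: "complex \<Rightarrow> complex \<Rightarrow> complex" where
  "besselY_e \<nu> z = (if \<nu> \<notin> \<int> then besselY_gen \<nu> z
                      else Lim (at \<nu>) (\<lambda>\<mu>. besselY_gen \<mu> z))"

definition lommel_small_s :: "complex \<Rightarrow> complex \<Rightarrow> complex \<Rightarrow> complex" where
  "lommel_small_s \<mu> \<nu> z = (\<Sum>m. (-1)^m * exp ((\<mu> + 1 + 2 * of_nat m) * z)
       / (\<Prod>k=0..m. ((\<mu> + 2 * of_nat k + 1)^2 - \<nu>^2)))"

definition lommel_gen :: "complex \<Rightarrow> complex \<Rightarrow> complex \<Rightarrow> complex" where
  "lommel_gen \<mu> \<nu> z = lommel_small_s \<mu> \<nu> z
     + exp ((\<mu> - 1) * ln2c) * Gamma ((\<mu> - \<nu> + 1) / 2) * Gamma ((\<mu> + \<nu> + 1) / 2)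
       * (besselJ_e \<nu> z * sin ((\<mu> - \<nu>) * pi / 2) - besselY_e \<nu> z * cos ((\<mu> - \<nu>) * pi / 2))"

definition lommel_S0 :: "complex \<Rightarrow> complex" where
  "lommel_S0 z = 1/2 * (\<Sum>m. (-1)^m * exp (2 * of_nat m * (z - ln2c)) / (fact m)^2
       * ((z - ln2c - Digamma (of_nat m + 1))^2 - Polygamma 1 (of_nat m + 1) / 2 + of_real pi ^ 2 / 4))"

(* d/d(zeta^2) expressed in the variable z, zeta = e^z: d/d(zeta^2) = e^(-2z)/2 d/dz *)
definition dzeta2 :: "(complex \<Rightarrow> complex) \<Rightarrow> complex \<Rightarrow> complex" where
  "dzeta2 h z = exp (-2 * z) / 2 * deriv h z"

definition lommel_base :: "complex \<Rightarrow> complex \<Rightarrow> complex" where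
  "lommel_base \<nu> z =
    (if \<nu> = 0 then lommel_S0 z
     else if (\<exists>n::nat. n > 0 \<and> \<nu> = - of_nat n) then
       (let n = nat (- \<lfloor>Re \<nu>\<rfloor>) in
          (-1)^n * exp (of_nat n * z) / fact n * (dzeta2 ^^ n) lommel_S0 z)
     else Gamma \<nu> * (exp ((\<nu> - 1) * ln2c) * besselJ_e \<nu> z * z
                     - exp ((\<nu> - 2) * ln2c) * of_real pi * besselY_e \<nu> z
                     - exp (\<nu> * z) / 4 * (\<Sum>m. (-1)^m * exp (2 * of_nat m * (z - ln2c))
                          * (2 * ln2c + Digamma (\<nu> + of_nat m + 1) + Digamma (of_nat m + 1))
                          / (fact m * Gamma (\<nu> + of_nat m + 1)))))"

definition lommel_ii :: "complex \<Rightarrow> nat \<Rightarrow> complex \<Rightarrow> complex" where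
  "lommel_ii \<nu> p z =
     (\<Sum>m<p. (-1)^m * exp ((\<nu> - 2 * of_nat p + 2 * of_nat m) * z)
        / (2^(2*m+2) * pochhammer (- of_nat p) (m+1) * pochhammer (\<nu> - of_nat p) (m+1)))
     + (-1)^p * lommel_base \<nu> z / (2^(2*p) * fact p * pochhammer (1 - \<nu>) p)"

definition odd_neg_int :: "complex \<Rightarrow> bool" where
  "odd_neg_int w \<longleftrightarrow> (\<exists>k::nat. w = - (2 * of_nat k + 1))"

definition case_ii :: "complex \<Rightarrow> complex \<Rightarrow> bool" where
  "case_ii \<mu> \<nu> \<longleftrightarrow> (\<exists>p::nat. \<mu> = \<nu> - 2 * of_nat p - 1 \<and> \<nu> \<notin> of_nat ` {1..p})"

definition lommelS_e :: "complex \<Rightarrow> complex \<Rightarrow> complex \<Rightarrow> complex" where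
  "lommelS_e \<mu> \<nu> z =
     (if \<not> odd_neg_int (\<mu> + \<nu>) \<and> \<not> odd_neg_int (\<mu> - \<nu>) then lommel_gen \<mu> \<nu> z
      else if case_ii \<mu> \<nu> then lommel_ii \<nu> (THE p::nat. \<mu> = \<nu> - 2 * of_nat p - 1) z
      else lommel_ii (-\<nu>) (THE p::nat. \<mu> = - \<nu> - 2 * of_nat p - 1) z)"

definition lommel_c :: "complex \<Rightarrow> complex \<Rightarrow> nat \<Rightarrow> complex" where
  "lommel_c \<mu> \<nu> k = (\<Prod>m=1..k. ((\<mu> - 2 * of_nat m + 1)^2 - \<nu>^2))"

definition max_modulus :: "(complex \<Rightarrow> complex) \<Rightarrow> real \<Rightarrow> real" where
  "max_modulus f r = Sup ((\<lambda>z. cmod (f z)) ` cball 0 r)"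

definition subnormal :: "(complex \<Rightarrow> complex) \<Rightarrow> bool" where
  "subnormal f \<longleftrightarrow>
     Limsup at_top (\<lambda>r::real. ereal (ln (ln (max_modulus f r)) / r)) = 0"

end

theory Submission
  imports Defs "HOL-Real_Asymp.Real_Asymp"
begin

text \<open>
  Put \<open>L f = f'' + (e\<^sup>2\<^sup>z - \<nu>\<^sup>2) f\<close> and \<open>(T f)(z) = f (z + i \<pi>)\<close>. Since \<open>e\<^sup>2\<^sup>z\<close> has period \<open>i \<pi>\<close>, \<open>T\<close> acts on
  the solutions of \<open>L f = 0\<close>, and in the basis \<open>J\<^sub>\<nu>, Y\<^sub>\<nu>\<close> it is triangular.

  If a solution of \<open>L f = c e\<^sup>\<beta>\<^sup>z\<close> satisfies \<open>T f = e\<^sup>i\<^sup>\<pi>\<^sup>\<beta> f\<close>, a Gronwall estimate as \<open>Re z\<close> tends to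
  \<open>-\<infinity>\<close> shows that, up to a factor \<open>e\<^sup>\<alpha>\<^sup>z\<close>, it is a power series in \<open>e\<^sup>2\<^sup>z\<close> with infinite radius of convergence.
  The two-term recurrence for its coefficients contradicts the Cauchy estimates for functions of small growth
  unless the series is finite; this yields the terminating Lommel solutions, and \<open>f = 0\<close> if \<open>c = 0\<close>.
  By triangularity of \<open>T\<close>, no nonzero solution of \<open>L f = 0\<close> has small growth. Hence any solution of
  small growth of the inhomogeneous equation has \<open>T f = e\<^sup>i\<^sup>\<pi>\<^sup>\<beta> f\<close>, because \<open>T f - e\<^sup>i\<^sup>\<pi>\<^sup>\<beta> f\<close> solves
  \<open>L f = 0\<close> and has small growth.
\<close>

section \<open>Series in exponentials\<close>

text \<open>Subnormality of \<open>f\<close> says nothing at first about its summand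
  \<open>\<sigma> * lommelS_e \<mu> \<nu>\<close>. Therefore (b) proceeds in three stages:
  \<open>f\<close> yields the condition on \<open>\<mu>\<close> and \<open>\<nu>\<close>; under it
  the definitions show that the Lommel function is a finite exponential sum; only then does
  \<open>f - \<sigma> * lommelS_e \<mu> \<nu>\<close> have small growth, which forces
  \<open>A = B = 0\<close>. The closed form is not computed from the definitions: it results from
  applying the growth argument to the Lommel function itself. Periodicity alone would give a Laurent
  series in \<open>w = exp (2 * z)\<close> on the punctured plane. The Gronwall estimate makes
  \<open>w = 0\<close> at most a pole, and the choice of \<open>\<alpha>\<close> removes it. Growth
  then becomes order in \<open>w\<close>: a bound \<open>exp (C * exp (r * cmod z))\<close> gives
  order at most \<open>r / 2\<close>, while the recurrence forces order at least
  \<open>1 / 2\<close> on an infinite series. In this way no asymptotic expansion of Bessel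
  functions enters. In the variable \<open>z\<close> the powers of \<open>\<zeta>\<close> are entire
  exponentials and \<open>log \<zeta>\<close> is a factor \<open>z\<close>.\<close>

definition exp_series :: "complex \<Rightarrow> complex fps \<Rightarrow> complex \<Rightarrow> complex" where
  "exp_series \<alpha> F z = exp (\<alpha> * z) * eval_fps F (exp (2 * z))"

text \<open>Acts on coefficients as \<open>d/dz\<close> acts on
  \<open>exp_series \<alpha> F\<close>.\<close>

definition exp_euler :: "complex \<Rightarrow> complex fps \<Rightarrow> complex fps" where
  "exp_euler \<alpha> F = Abs_fps (\<lambda>m. (\<alpha> + 2 * of_nat m) * fps_nth F m)"

text \<open>The operator \<open>L\<close> on coefficients. Equated to 0 it is the Frobenius
  recurrence, which has two terms because the factor \<open>exp (2 * z)\<close> shifts the index by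
  one.\<close>

definition bessel_fps :: "complex \<Rightarrow> complex \<Rightarrow> complex fps \<Rightarrow> complex fps" where
  "bessel_fps \<alpha> \<nu> F = Abs_fps (\<lambda>m. ((\<alpha> + 2 * of_nat m)^2 - \<nu>^2) * fps_nth F m
      + (if m = 0 then 0 else fps_nth F (m - 1)))"

text \<open>The derivatives are witnesses instead of \<open>deriv\<close> terms, so that explicit
  candidates can be supplied and checked by derivative rules; since they exist at every point,
  \<open>f\<close> is entire.\<close>

definition solves :: "complex \<Rightarrow> (complex \<Rightarrow> complex) \<Rightarrow> (complex \<Rightarrow> complex) \<Rightarrow> bool" where
  "solves \<nu> f g \<longleftrightarrow> (\<exists>f' f''. (\<forall>z. (f has_field_derivative f' z) (at z)) \<and>
      (\<forall>z. (f' has_field_derivative f'' z) (at z)) \<and>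
      (\<forall>z. f'' z + (exp (2 * z) - \<nu>^2) * f z = g z))"

lemma solvesI:
  assumes "\<And>z. (f has_field_derivative f' z) (at z)"
    and "\<And>z. (f' has_field_derivative f'' z) (at z)"
    and "\<And>z. f'' z + (exp (2 * z) - \<nu>^2) * f z = g z"
  shows "solves \<nu> f g"
  using assms unfolding solves_def by blast

lemma solvesE:
  assumes "solves \<nu> f g"
  obtains f' f'' where "\<And>z. (f has_field_derivative f' z) (at z)"
    and "\<And>z. (f' has_field_derivative f'' z) (at z)"
    and "\<And>z. f'' z = g z - (exp (2 * z) - \<nu>^2) * f z"
  using assms unfolding solves_def by (metis add_diff_cancel_right')

lemma solves_cong: "solves \<nu> f g \<Longrightarrow> (\<And>z. f z = f2 z) \<Longrightarrow> (\<And>z. g z = g2 z) \<Longrightarrow> solves \<nu> f2 g2"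
proof -
  assume *: "solves \<nu> f g" "\<And>z. f z = f2 z" "\<And>z. g z = g2 z"
  then have "f = f2" "g = g2" by auto
  with *(1) show ?thesis by simp
qed

lemma solves_iff_deriv:
  "solves \<nu> f g \<longleftrightarrow> f holomorphic_on UNIV \<and>
     (\<forall>z. deriv (deriv f) z + (exp (2 * z) - \<nu>^2) * f z = g z)"
proof
  assume "solves \<nu> f g"
  then obtain f' f'' where f: "\<And>z. (f has_field_derivative f' z) (at z)"
    and f': "\<And>z. (f' has_field_derivative f'' z) (at z)"
    and eq: "\<And>z. f'' z = g z - (exp (2 * z) - \<nu>^2) * f z"
    by (rule solvesE) blast
  have "deriv f = f'" using f by (auto intro!: ext DERIV_imp_deriv)
  moreover have "deriv f' = f''" using f' by (auto intro!: ext DERIV_imp_deriv)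
  ultimately show "f holomorphic_on UNIV \<and> (\<forall>z. deriv (deriv f) z + (exp (2 * z) - \<nu>^2) * f z = g z)"
    using f eq by (auto simp: holomorphic_on_open)
next
  assume *: "f holomorphic_on UNIV \<and> (\<forall>z. deriv (deriv f) z + (exp (2 * z) - \<nu>^2) * f z = g z)"
  show "solves \<nu> f g"
    by (rule solvesI[of f "deriv f" "deriv (deriv f)"])
       (use * in \<open>auto intro!: holomorphic_derivI[of _ UNIV] holomorphic_intros\<close>)
qed

lemma solves_holomorphic: "solves \<nu> f g \<Longrightarrow> f holomorphic_on UNIV"
  by (simp add: solves_iff_deriv)

lemma solves_cmult: "solves \<nu> f g \<Longrightarrow> solves \<nu> (\<lambda>z. c * f z) (\<lambda>z. c * g z)"
proof (elim solvesE)
  fix f' f'' assume *: "\<And>z. (f has_field_derivative f' z) (at z)"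
    "\<And>z. (f' has_field_derivative f'' z) (at z)"
    "\<And>z. f'' z = g z - (exp (2 * z) - \<nu>^2) * f z"
  show ?thesis
    by (rule solvesI[where f' = "\<lambda>z. c * f' z" and f'' = "\<lambda>z. c * f'' z"])
       (auto intro!: derivative_eq_intros *(1,2) simp: *(3) algebra_simps)
qed

lemma solves_add:
  assumes "solves \<nu> f g" "solves \<nu> h k"
  shows "solves \<nu> (\<lambda>z. f z + h z) (\<lambda>z. g z + k z)"
proof -
  obtain f' f'' where *: "\<And>z. (f has_field_derivative f' z) (at z)"
    "\<And>z. (f' has_field_derivative f'' z) (at z)"
    "\<And>z. f'' z = g z - (exp (2 * z) - \<nu>^2) * f z"
    using assms(1) by (rule solvesE) blast
  obtain h' h'' where **: "\<And>z. (h has_field_derivative h' z) (at z)"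
    "\<And>z. (h' has_field_derivative h'' z) (at z)"
    "\<And>z. h'' z = k z - (exp (2 * z) - \<nu>^2) * h z"
    using assms(2) by (rule solvesE) blast
  show ?thesis
    by (rule solvesI[where f' = "\<lambda>z. f' z + h' z" and f'' = "\<lambda>z. f'' z + h'' z"])
       (auto intro!: derivative_eq_intros *(1,2) **(1,2) simp: *(3) **(3) algebra_simps)
qed

lemma solves_minus: "solves \<nu> f g \<Longrightarrow> solves \<nu> (\<lambda>z. - f z) (\<lambda>z. - g z)"
  using solves_cmult[of \<nu> f g "-1"] by simp

lemma solves_diff:
  "solves \<nu> f g \<Longrightarrow> solves \<nu> h k \<Longrightarrow> solves \<nu> (\<lambda>z. f z - h z) (\<lambda>z. g z - k z)"
  using solves_add[of \<nu> f g "\<lambda>z. - h z" "\<lambda>z. - k z"] solves_minus[of \<nu> h k] by simp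

lemma solves_minus_order: "solves (-\<nu>) f g \<longleftrightarrow> solves \<nu> f g"
  by (simp add: solves_def)

lemma solves_sum:
  assumes "finite A" "\<And>i. i \<in> A \<Longrightarrow> solves \<nu> (f i) (g i)"
  shows "solves \<nu> (\<lambda>z. \<Sum>i\<in>A. f i z) (\<lambda>z. \<Sum>i\<in>A. g i z)"
  using assms
proof (induction A rule: finite_induct)
  case empty
  show ?case by (rule solvesI[where f' = "\<lambda>_. 0" and f'' = "\<lambda>_. 0"]) auto
next
  case (insert x F)
  then show ?case using solves_add[of \<nu> "f x" "g x"] by simp
qed

lemma solves_exp:
  "solves \<nu> (\<lambda>z. exp (a * z)) (\<lambda>z. (a^2 - \<nu>^2) * exp (a * z) + exp ((a + 2) * z))"
  by (rule solvesI[where f' = "\<lambda>z. a * exp (a * z)" and f'' = "\<lambda>z. a^2 * exp (a * z)"])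
     (auto intro!: derivative_eq_intros simp: power2_eq_square algebra_simps exp_add[symmetric])

text \<open>The only variable coefficient \<open>exp (2 * z)\<close> is invariant under translation
  by \<open>c\<close>. The case of interest is \<open>c = \<i> * pi\<close>.\<close>

lemma solves_translate:
  assumes "solves \<nu> f g" "exp (2 * c) = 1"
  shows "solves \<nu> (\<lambda>z. f (z + c)) (\<lambda>z. g (z + c))"
proof -
  obtain f' f'' where *: "\<And>z. (f has_field_derivative f' z) (at z)"
    "\<And>z. (f' has_field_derivative f'' z) (at z)"
    "\<And>z. f'' z = g z - (exp (2 * z) - \<nu>^2) * f z"
    using assms(1) by (rule solvesE) blast
  show ?thesis
    by (rule solvesI[where f' = "\<lambda>z. f' (z + c)" and f'' = "\<lambda>z. f'' (z + c)"])
       (auto intro!: DERIV_chain2[OF *(1), THEN DERIV_cong] DERIV_chain2[OF *(2), THEN DERIV_cong] derivative_eq_intros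
             simp: *(3) distrib_left exp_add assms(2))
qed

lemma has_field_derivative_exp_series:
  assumes "fps_conv_radius F = \<infinity>"
  shows "fps_conv_radius (exp_euler \<alpha> F) = \<infinity>"
    and "(exp_series \<alpha> F has_field_derivative exp_series \<alpha> (exp_euler \<alpha> F) z) (at z)"
proof -
  \<comment> \<open>In this form radius and value follow from the rules for sums, products and
    \<open>fps_deriv\<close>.\<close>
  have eq: "exp_euler \<alpha> F = fps_const \<alpha> * F + fps_const 2 * (fps_X * fps_deriv F)"
  proof (rule fps_ext)
    fix n show "fps_nth (exp_euler \<alpha> F) n = fps_nth (fps_const \<alpha> * F + fps_const 2 * (fps_X * fps_deriv F)) n"
      by (cases n) (auto simp: exp_euler_def algebra_simps)
  qed
  have d: "fps_conv_radius (fps_deriv F) = \<infinity>"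
    using fps_conv_radius_deriv[of F] assms by simp
  have xd: "fps_conv_radius (fps_X * fps_deriv F) = \<infinity>"
    using fps_conv_radius_mult[of fps_X "fps_deriv F"] d by simp
  have c2: "fps_conv_radius (fps_const 2 * (fps_X * fps_deriv F)) = \<infinity>"
    using fps_conv_radius_mult[of "fps_const 2" "fps_X * fps_deriv F"] xd by simp
  have ca: "fps_conv_radius (fps_const \<alpha> * F) = \<infinity>"
    using fps_conv_radius_mult[of "fps_const \<alpha>" F] assms by simp
  show "fps_conv_radius (exp_euler \<alpha> F) = \<infinity>"
    unfolding eq using fps_conv_radius_add[of "fps_const \<alpha> * F"] c2 ca by (metis ereal_infty_less_eq(1) min.idem)
  have ev: "eval_fps (exp_euler \<alpha> F) w = \<alpha> * eval_fps F w + 2 * (w * eval_fps (fps_deriv F) w)" for w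
    unfolding eq by (subst eval_fps_add eval_fps_mult, simp_all add: assms d xd c2 ca)+
  show "(exp_series \<alpha> F has_field_derivative exp_series \<alpha> (exp_euler \<alpha> F) z) (at z)"
    unfolding exp_series_def
    by (rule derivative_eq_intros has_field_derivative_eval_fps' refl | simp add: assms)+
       (simp add: ev algebra_simps)
qed

lemma fps_conv_radius_bessel_fps:
  assumes "fps_conv_radius F = \<infinity>"
  shows "fps_conv_radius (bessel_fps \<alpha> \<nu> F) = \<infinity>"
    and "eval_fps (bessel_fps \<alpha> \<nu> F) w
      = eval_fps (exp_euler \<alpha> (exp_euler \<alpha> F)) w + (w - \<nu>^2) * eval_fps F w"
proof -
  let ?E = "exp_euler \<alpha> (exp_euler \<alpha> F)"
  have eq: "bessel_fps \<alpha> \<nu> F = ?E + (fps_X + fps_const (-(\<nu>^2))) * F"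
    unfolding bessel_fps_def exp_euler_def
    by (rule fps_ext) (auto simp: algebra_simps power2_eq_square)
  have E: "fps_conv_radius ?E = \<infinity>"
    using assms by (simp add: has_field_derivative_exp_series(1))
  have X: "fps_conv_radius (fps_X + fps_const (-(\<nu>^2))) = \<infinity>"
    using fps_conv_radius_add[of fps_X "fps_const (-(\<nu>^2))"] by simp
  have XF: "fps_conv_radius ((fps_X + fps_const (-(\<nu>^2))) * F) = \<infinity>"
    using fps_conv_radius_mult[of "fps_X + fps_const (-(\<nu>^2))" F] X assms by simp
  show "fps_conv_radius (bessel_fps \<alpha> \<nu> F) = \<infinity>"
    unfolding eq using fps_conv_radius_add[of ?E] E XF by (metis ereal_infty_less_eq(1) min.idem)
  show "eval_fps (bessel_fps \<alpha> \<nu> F) w = eval_fps ?E w + (w - \<nu>^2) * eval_fps F w"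
    unfolding eq
    by (simp add: eval_fps_add eval_fps_mult E XF X assms del: fps_const_neg)
qed

lemma solves_exp_series:
  assumes "fps_conv_radius F = \<infinity>"
  shows "solves \<nu> (exp_series \<alpha> F) (exp_series \<alpha> (bessel_fps \<alpha> \<nu> F))"
proof (rule solvesI)
  show "(exp_series \<alpha> F has_field_derivative exp_series \<alpha> (exp_euler \<alpha> F) z) (at z)" for z
    by (rule has_field_derivative_exp_series(2)[OF assms])
  show "(exp_series \<alpha> (exp_euler \<alpha> F) has_field_derivative
      exp_series \<alpha> (exp_euler \<alpha> (exp_euler \<alpha> F)) z) (at z)" for z
    by (intro has_field_derivative_exp_series assms)
  show "exp_series \<alpha> (exp_euler \<alpha> (exp_euler \<alpha> F)) z + (exp (2 * z) - \<nu>^2) * exp_series \<alpha> F z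
      = exp_series \<alpha> (bessel_fps \<alpha> \<nu> F) z" for z
    by (simp add: exp_series_def fps_conv_radius_bessel_fps(2)[OF assms] algebra_simps)
qed

text \<open>A factor \<open>log \<zeta>\<close> is a factor \<open>z\<close> here, so this rule
  handles the logarithms of the Bessel and Lommel functions.\<close>

lemma solves_mult_id:
  assumes "solves \<nu> f g" "\<And>z. (f has_field_derivative f' z) (at z)"
  shows "solves \<nu> (\<lambda>z. z * f z) (\<lambda>z. 2 * f' z + z * g z)"
proof -
  obtain f1 f'' where *: "\<And>z. (f has_field_derivative f1 z) (at z)"
    "\<And>z. (f1 has_field_derivative f'' z) (at z)"
    "\<And>z. f'' z = g z - (exp (2 * z) - \<nu>^2) * f z"
    using assms(1) by (rule solvesE) blast
  have "f1 = f'" using *(1) assms(2) by (auto intro!: ext DERIV_unique)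
  note * = *[unfolded this]
  show ?thesis
    by (rule solvesI[where f' = "\<lambda>z. f z + z * f' z" and f'' = "\<lambda>z. 2 * f' z + z * f'' z"])
       (auto intro!: derivative_eq_intros *(1,2) simp: *(3) algebra_simps)
qed

lemma exp_series_sums:
  assumes "fps_conv_radius F = \<infinity>"
  shows "(\<lambda>m. fps_nth F m * exp ((\<alpha> + 2 * of_nat m) * z)) sums exp_series \<alpha> F z"
proof -
  have "(\<lambda>m. exp (\<alpha> * z) * (fps_nth F m * exp (2 * z) ^ m)) sums exp_series \<alpha> F z"
    unfolding exp_series_def by (intro sums_mult sums_eval_fps) (simp add: assms)
  moreover have "exp (\<alpha> * z) * (fps_nth F m * exp (2 * z) ^ m)
      = fps_nth F m * exp ((\<alpha> + 2 * of_nat m) * z)" for m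
    by (simp add: exp_of_nat_mult[symmetric] exp_add[symmetric] algebra_simps)
  ultimately show ?thesis by simp
qed

lemma suminf_exp_series:
  assumes "fps_conv_radius F = \<infinity>"
    and "\<And>m. h m = fps_nth F m * exp ((\<alpha> + 2 * of_nat m) * z)"
  shows "suminf h = exp_series \<alpha> F z"
proof -
  have "h = (\<lambda>m. fps_nth F m * exp ((\<alpha> + 2 * of_nat m) * z))" using assms(2) by auto
  then show ?thesis using exp_series_sums[OF assms(1), of \<alpha> z] by (simp add: sums_iff)
qed

lemma exp_series_0: "exp_series \<alpha> 0 = (\<lambda>_. 0)"
  by (simp add: exp_series_def fun_eq_iff)

text \<open>\<open>exp (2 * z)\<close> takes every nonzero value; the missing point 0 is filled in
  by continuity.\<close>

lemma exp_series_eqD: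
  assumes "fps_conv_radius F = \<infinity>" "fps_conv_radius G = \<infinity>"
    and "\<And>z. exp_series \<alpha> F z = exp_series \<alpha> G z"
  shows "F = G"
proof -
  have nz: "eval_fps F w = eval_fps G w" if "w \<noteq> 0" for w
  proof -
    have "w = exp (2 * (Ln w / 2))" using that by simp
    then show ?thesis using assms(3)[of "Ln w / 2"] by (simp add: exp_series_def)
  qed
  have lim: "(eval_fps F \<longlongrightarrow> eval_fps F 0) (at 0)" "(eval_fps G \<longlongrightarrow> eval_fps G 0) (at 0)"
    using assms continuous_eval_fps[of "0::complex" _ UNIV] by (auto simp: continuous_within zero_ereal_def[symmetric])
  have "eventually (\<lambda>w. eval_fps F w = eval_fps G w) (at 0)"
    using nz by (auto simp: eventually_at_filter)
  then have "eval_fps F 0 = eval_fps G 0"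
    using Lim_transform_eventually[OF lim(1)] lim(2) tendsto_unique[OF trivial_limit_at] by blast
  then have "eval_fps F w = eval_fps G w" for w using nz by (cases "w = 0") auto
  then show ?thesis by (intro eval_fps_eqD) (auto simp: assms)
qed

lemma fps_conv_radius_fact_bound:
  assumes "\<And>m. cmod (a m) \<le> C * K ^ m / fact m"
  shows "fps_conv_radius (Abs_fps a) = \<infinity>"
proof -
  have "summable (\<lambda>n. a n * z ^ n)" for z
  proof (rule summable_comparison_test'[where N = 0])
    have "summable (\<lambda>n. (K * cmod z) ^ n / fact n)"
      using summable_exp_generic[of "K * cmod z"] by (simp add: field_simps)
    then show "summable (\<lambda>n. C * ((K * cmod z) ^ n / fact n))" by (rule summable_mult)
    fix n show "norm (a n * z ^ n) \<le> C * ((K * cmod z) ^ n / fact n)"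
      using mult_right_mono[OF assms[of n], of "cmod z ^ n"]
      by (simp add: norm_mult norm_power power_mult_distrib)
  qed
  then show ?thesis unfolding fps_conv_radius_def by (auto intro!: conv_radius_inftyI'' simp: fps_nth_Abs_fps)
qed

section \<open>Bessel functions\<close>

definition besselJ_coeff :: "complex \<Rightarrow> nat \<Rightarrow> complex" where
  "besselJ_coeff \<nu> m = (-1)^m * exp (-(\<nu> + 2 * of_nat m) * ln2c) * rGamma (\<nu> + of_nat m + 1) / fact m"

definition besselJ_fps :: "complex \<Rightarrow> complex fps" where
  "besselJ_fps \<nu> = Abs_fps (besselJ_coeff \<nu>)"

definition besselJ_order_fps :: "complex \<Rightarrow> complex fps" where
  "besselJ_order_fps \<nu> = Abs_fps (\<lambda>m. deriv (\<lambda>\<nu>. besselJ_coeff \<nu> m) \<nu>)"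

text \<open>The derivative of \<open>besselJ_e\<close> with respect to its order: the factor
  \<open>z\<close> comes from differentiating \<open>exp (\<nu> * z)\<close>, the series from
  differentiating the coefficients. It supplies \<open>besselY_e\<close> at integer orders.\<close>

definition besselJ_order_deriv :: "complex \<Rightarrow> complex \<Rightarrow> complex" where
  "besselJ_order_deriv \<nu> z = z * besselJ_e \<nu> z + exp_series \<nu> (besselJ_order_fps \<nu>) z"

lemma fps_nth_besselJ: "fps_nth (besselJ_fps \<nu>) m = besselJ_coeff \<nu> m"
  by (simp add: besselJ_fps_def)

lemma norm_exp_ln2c: "cmod (exp (w * ln2c)) = exp (Re w * ln 2)"
  by (simp add: ln2c_def)

lemma exp_ln2c: "exp ln2c = 2"
  by (simp add: ln2c_def exp_of_real)

text \<open>By \<open>rGamma w = w * rGamma (w + 1)\<close> the modulus does not increase from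
  \<open>m\<close> to \<open>m + 1\<close> once \<open>\<mu> + m + 1\<close> has real part at least
  1; compactness handles the finitely many earlier \<open>m\<close>. Uniformity over a disc of
  orders serves the later differentiation in the order.\<close>

lemma rGamma_bounded:
  "\<exists>B. \<forall>\<mu>\<in>cball \<nu> 1. \<forall>m. cmod (rGamma (\<mu> + of_nat m + 1)) \<le> B"
proof -
  define N where "N = nat \<lceil>cmod \<nu> + 2\<rceil>"
  have "\<exists>b. \<forall>\<mu>\<in>cball \<nu> 1. cmod (rGamma (\<mu> + of_nat m + 1)) \<le> b" for m
  proof -
    have "compact ((\<lambda>\<mu>. rGamma (\<mu> + of_nat m + 1)) ` cball \<nu> 1)"
      by (intro compact_continuous_image holomorphic_on_imp_continuous_on holomorphic_intros) auto
    then have "bounded ((\<lambda>\<mu>. rGamma (\<mu> + of_nat m + 1)) ` cball \<nu> 1)" by (rule compact_imp_bounded)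
    then show ?thesis unfolding bounded_iff by blast
  qed
  then have "\<forall>m. \<exists>b. \<forall>\<mu>\<in>cball \<nu> 1. cmod (rGamma (\<mu> + of_nat m + 1)) \<le> b" by blast
  from choice[OF this] obtain b
    where b: "\<And>m \<mu>. \<mu> \<in> cball \<nu> 1 \<Longrightarrow> cmod (rGamma (\<mu> + of_nat m + 1)) \<le> b m" by blast
  define B where "B = Max (b ` {..N})"
  have bB: "b m \<le> B" if "m \<le> N" for m
    unfolding B_def using that by (intro Max_ge) auto
  have "cmod (rGamma (\<mu> + of_nat m + 1)) \<le> B" if \<mu>: "\<mu> \<in> cball \<nu> 1" for \<mu> m
  proof (induction m)
    case 0 then show ?case using b[OF \<mu>, of 0] bB[of 0] by simp
  next
    case (Suc m)
    show ?case
    proof (cases "Suc m \<le> N")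
      case True then show ?thesis using b[OF \<mu>, of "Suc m"] bB[of "Suc m"] by simp
    next
      case False
      have "cmod \<mu> \<le> cmod \<nu> + 1"
        using \<mu> norm_triangle_ineq2[of \<mu> \<nu>] by (simp add: dist_norm norm_minus_commute)
      then have "Re \<mu> \<ge> - (cmod \<nu> + 1)" using abs_Re_le_cmod[of \<mu>] by linarith
      moreover have "real m \<ge> cmod \<nu> + 1" using False unfolding N_def by linarith
      ultimately have "Re (\<mu> + of_nat m + 1) \<ge> 1" by simp
      then have ge: "cmod (\<mu> + of_nat m + 1) \<ge> 1" using complex_Re_le_cmod[of "\<mu> + of_nat m + 1"] by linarith
      have "rGamma (\<mu> + of_nat m + 1) = (\<mu> + of_nat m + 1) * rGamma (\<mu> + of_nat (Suc m) + 1)"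
        using rGamma_plus1[of "\<mu> + of_nat m + 1"] by (simp add: algebra_simps)
      then have "cmod (rGamma (\<mu> + of_nat m + 1)) \<ge> cmod (rGamma (\<mu> + of_nat (Suc m) + 1))"
        using ge mult_right_mono[OF ge, of "cmod (rGamma (\<mu> + of_nat (Suc m) + 1))"] by (simp add: norm_mult)
      then show ?thesis using Suc by linarith
    qed
  qed
  then show ?thesis by blast
qed

lemma besselJ_coeff_bounded:
  "\<exists>B\<ge>0. \<forall>\<mu>\<in>cball \<nu> 1. \<forall>m. cmod (besselJ_coeff \<mu> m) \<le> B / fact m"
proof -
  obtain B where B: "\<And>\<mu> m. \<mu> \<in> cball \<nu> 1 \<Longrightarrow> cmod (rGamma (\<mu> + of_nat m + 1)) \<le> B"
    using rGamma_bounded[of \<nu>] by blast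
  have B0: "B \<ge> 0" by (rule order_trans[OF norm_ge_zero B[of \<nu> 0]]) simp
  have "cmod (besselJ_coeff \<mu> m) \<le> (exp ((cmod \<nu> + 1) * ln 2) * B) / fact m" if \<mu>: "\<mu> \<in> cball \<nu> 1" for \<mu> m
  proof -
    have "cmod \<mu> \<le> cmod \<nu> + 1"
      using \<mu> norm_triangle_ineq2[of \<mu> \<nu>] by (simp add: dist_norm norm_minus_commute)
    then have "- Re \<mu> - 2 * m \<le> cmod \<nu> + 1" using abs_Re_le_cmod[of \<mu>] by linarith
    then have "(- Re \<mu> - 2 * m) * ln 2 \<le> (cmod \<nu> + 1) * ln 2" by (intro mult_right_mono) auto
    then have "cmod (exp (-(\<mu> + 2 * of_nat m) * ln2c)) \<le> exp ((cmod \<nu> + 1) * ln 2)"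
      unfolding norm_exp_ln2c by simp
    then show ?thesis
      unfolding besselJ_coeff_def norm_mult norm_divide norm_power
      using mult_mono[OF _ B[OF \<mu>, of m], of "cmod (exp (-(\<mu> + 2 * of_nat m) * ln2c))" "exp ((cmod \<nu> + 1) * ln 2)"] B0
      by (simp add: divide_right_mono)
  qed
  then show ?thesis using B0 by (intro exI[of _ "exp ((cmod \<nu> + 1) * ln 2) * B"]) auto
qed

lemma besselJ_coeff_holomorphic: "(\<lambda>\<nu>. besselJ_coeff \<nu> m) holomorphic_on A"
  unfolding besselJ_coeff_def by (intro holomorphic_intros) auto

lemma fps_conv_radius_besselJ [simp]:
  "fps_conv_radius (besselJ_fps \<nu>) = \<infinity>" "fps_conv_radius (besselJ_order_fps \<nu>) = \<infinity>"
proof -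
  obtain B where B: "\<And>\<mu> m. \<mu> \<in> cball \<nu> 1 \<Longrightarrow> cmod (besselJ_coeff \<mu> m) \<le> B / fact m"
    using besselJ_coeff_bounded[of \<nu>] by blast
  show "fps_conv_radius (besselJ_fps \<nu>) = \<infinity>" unfolding besselJ_fps_def
    using B[of \<nu>] by (intro fps_conv_radius_fact_bound[of _ B 1]) auto
  \<comment> \<open>Cauchy's estimate on the unit circle around \<open>\<nu>\<close> carries the
    uniform bound over to the derivative in the order.\<close>
  have "cmod ((deriv ^^ 1) (\<lambda>\<mu>. besselJ_coeff \<mu> m) \<nu>) \<le> fact 1 * (B / fact m) / 1 ^ 1" for m
  proof (rule Cauchy_inequality)
    show "cmod (besselJ_coeff x m) \<le> B / fact m" if "cmod (\<nu> - x) = 1" for x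
      using B[of x m] that by (simp add: dist_norm)
  qed (simp_all add: besselJ_coeff_holomorphic holomorphic_on_imp_continuous_on)
  then show "fps_conv_radius (besselJ_order_fps \<nu>) = \<infinity>" unfolding besselJ_order_fps_def
    by (intro fps_conv_radius_fact_bound[of _ B 1]) auto
qed

lemma besselJ_term:
  "(-1)^m * exp ((\<nu> + 2 * of_nat m) * (z - ln2c)) * rGamma (\<nu> + of_nat m + 1) / fact m
     = besselJ_coeff \<nu> m * exp ((\<nu> + 2 * of_nat m) * z)"
proof -
  have "(\<nu> + 2 * of_nat m) * (z - ln2c) = -(\<nu> + 2 * of_nat m) * ln2c + (\<nu> + 2 * of_nat m) * z"
    by (simp add: algebra_simps)
  then have "exp ((\<nu> + 2 * of_nat m) * (z - ln2c)) = exp (-(\<nu> + 2 * of_nat m) * ln2c) * exp ((\<nu> + 2 * of_nat m) * z)"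
    by (simp only: exp_add)
  then show ?thesis unfolding besselJ_coeff_def by simp
qed

lemma besselJ_e_eq: "besselJ_e \<nu> = exp_series \<nu> (besselJ_fps \<nu>)"
  unfolding besselJ_e_def fun_eq_iff besselJ_term
  by (intro allI suminf_exp_series fps_conv_radius_besselJ) (simp add: fps_nth_besselJ)

text \<open>From \<open>m - 1\<close> to \<open>m\<close> the exponential loses a factor 4, and
  \<open>rGamma\<close> changes by its functional equation, which has no exceptional points. So
  negative integer orders are included.\<close>

lemma besselJ_coeff_rec:
  assumes "m > 0"
  shows "4 * of_nat m * (of_nat m + \<nu>) * besselJ_coeff \<nu> m + besselJ_coeff \<nu> (m - 1) = 0"
proof -
  obtain k where m: "m = Suc k" using assms by (cases m) auto
  define E where "E = exp (-(\<nu> + 2 * of_nat m) * ln2c)"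
  define R where "R = rGamma (\<nu> + of_nat m + 1)"
  have e: "exp (-(\<nu> + 2 * of_nat k) * ln2c) = 4 * E"
  proof -
    have "exp (-(\<nu> + 2 * of_nat k) * ln2c) = exp (ln2c + ln2c + (-(\<nu> + 2 * of_nat m) * ln2c))"
      by (simp add: m algebra_simps)
    also have "\<dots> = 4 * E" unfolding E_def by (simp only: exp_add exp_ln2c) simp
    finally show ?thesis .
  qed
  have r: "rGamma (\<nu> + of_nat k + 1) = (\<nu> + of_nat m) * R"
    using rGamma_plus1[of "\<nu> + of_nat k + 1"] by (simp add: m R_def algebra_simps)
  have "besselJ_coeff \<nu> k = (-1)^k * (4 * E) * ((\<nu> + of_nat m) * R) / fact k"
    unfolding besselJ_coeff_def e r ..
  moreover have "of_nat m * besselJ_coeff \<nu> m = - ((-1)^k) * E * R / fact k"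
    unfolding besselJ_coeff_def E_def[symmetric] R_def[symmetric] by (simp add: m del: of_nat_Suc)
  then have "4 * of_nat m * (of_nat m + \<nu>) * besselJ_coeff \<nu> m
      = 4 * (of_nat m + \<nu>) * (- ((-1)^k) * E * R / fact k)"
    by (metis (no_types, lifting) mult.assoc mult.commute)
  ultimately show ?thesis by (simp add: m algebra_simps add_divide_distrib del: of_nat_Suc)
qed

lemma bessel_fps_besselJ [simp]: "bessel_fps \<nu> \<nu> (besselJ_fps \<nu>) = 0"
proof (rule fps_ext)
  fix m show "fps_nth (bessel_fps \<nu> \<nu> (besselJ_fps \<nu>)) m = fps_nth 0 m"
    using besselJ_coeff_rec[of m \<nu>]
    by (cases "m = 0") (simp_all add: bessel_fps_def besselJ_fps_def power2_eq_square algebra_simps)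
qed

lemma solves_besselJ: "solves \<nu> (besselJ_e \<nu>) (\<lambda>_. 0)"
  using solves_exp_series[of "besselJ_fps \<nu>" \<nu> \<nu>] by (simp add: besselJ_e_eq exp_series_0)

lemma besselJ_e_has_field_derivative:
  "(besselJ_e \<nu> has_field_derivative exp_series \<nu> (exp_euler \<nu> (besselJ_fps \<nu>)) z) (at z)"
  unfolding besselJ_e_eq by (rule has_field_derivative_exp_series) simp

lemma besselJ_coeff_has_derivative:
  "((\<lambda>\<nu>. besselJ_coeff \<nu> m) has_field_derivative fps_nth (besselJ_order_fps \<nu>) m) (at \<nu>)"
  using holomorphic_derivI[OF besselJ_coeff_holomorphic[of m UNIV] open_UNIV UNIV_I, of \<nu>]
  by (simp add: besselJ_order_fps_def)

text \<open>The derivative in \<open>\<nu>\<close> of the identity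
  \<open>besselJ_coeff_rec\<close>.\<close>

lemma besselJ_order_coeff_rec:
  assumes "m > 0"
  shows "4 * of_nat m * (of_nat m + \<nu>) * fps_nth (besselJ_order_fps \<nu>) m
     + fps_nth (besselJ_order_fps \<nu>) (m - 1) = - 4 * of_nat m * besselJ_coeff \<nu> m"
proof -
  have "((\<lambda>\<nu>. 4 * of_nat m * (of_nat m + \<nu>) * besselJ_coeff \<nu> m + besselJ_coeff \<nu> (m - 1)) has_field_derivative
     (4 * of_nat m * (of_nat m + \<nu>) * fps_nth (besselJ_order_fps \<nu>) m + 4 * of_nat m * besselJ_coeff \<nu> m
     + fps_nth (besselJ_order_fps \<nu>) (m - 1))) (at \<nu>)"
    by (auto intro!: derivative_eq_intros besselJ_coeff_has_derivative)
  moreover have "(\<lambda>\<nu>. 4 * of_nat m * (of_nat m + \<nu>) * besselJ_coeff \<nu> m + besselJ_coeff \<nu> (m - 1)) = (\<lambda>_. 0)"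
    using besselJ_coeff_rec[OF assms] by auto
  ultimately have "4 * of_nat m * (of_nat m + \<nu>) * fps_nth (besselJ_order_fps \<nu>) m + 4 * of_nat m * besselJ_coeff \<nu> m
     + fps_nth (besselJ_order_fps \<nu>) (m - 1) = 0"
    using DERIV_unique DERIV_const by metis
  then show ?thesis by (simp add: algebra_simps eq_neg_iff_add_eq_0)
qed

text \<open>Formally the derivative in \<open>\<nu>\<close> of \<open>L J = 0\<close>, where the
  coefficient \<open>- \<nu>^2\<close> produces the right-hand side. Comparing coefficients avoids
  interchanging derivatives in \<open>\<nu>\<close> and in \<open>z\<close>.\<close>

lemma solves_besselJ_order_deriv:
  "solves \<nu> (besselJ_order_deriv \<nu>) (\<lambda>z. 2 * \<nu> * besselJ_e \<nu> z)"
proof -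
  let ?G = "bessel_fps \<nu> \<nu> (besselJ_order_fps \<nu>)"
  let ?E = "exp_euler \<nu> (besselJ_fps \<nu>)"
  have "solves \<nu> (besselJ_order_deriv \<nu>) (\<lambda>z. (2 * exp_series \<nu> ?E z + z * 0) + exp_series \<nu> ?G z)"
    unfolding besselJ_order_deriv_def
    by (intro solves_add solves_mult_id[OF solves_besselJ] besselJ_e_has_field_derivative solves_exp_series) simp
  moreover have "2 * exp_series \<nu> ?E z + exp_series \<nu> ?G z = 2 * \<nu> * besselJ_e \<nu> z" for z
  proof -
    have r: "fps_conv_radius ?E = \<infinity>" "fps_conv_radius ?G = \<infinity>"
      by (simp_all add: has_field_derivative_exp_series(1) fps_conv_radius_bessel_fps(1))
    have "(\<lambda>m. 2 * (fps_nth ?E m * exp ((\<nu> + 2 * of_nat m) * z)) + fps_nth ?G m * exp ((\<nu> + 2 * of_nat m) * z))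
        sums (2 * exp_series \<nu> ?E z + exp_series \<nu> ?G z)"
      by (intro sums_add sums_mult exp_series_sums r)
    moreover have "2 * fps_nth ?E m + fps_nth ?G m = 2 * \<nu> * fps_nth (besselJ_fps \<nu>) m" for m
      using besselJ_order_coeff_rec[of m \<nu>]
      by (cases "m = 0") (auto simp: bessel_fps_def exp_euler_def besselJ_fps_def power2_eq_square algebra_simps)
    then have "2 * (fps_nth ?E m * exp ((\<nu> + 2 * of_nat m) * z)) + fps_nth ?G m * exp ((\<nu> + 2 * of_nat m) * z)
       = 2 * \<nu> * (fps_nth (besselJ_fps \<nu>) m * exp ((\<nu> + 2 * of_nat m) * z))" for m
      by (metis (no_types, lifting) distrib_right mult.assoc)
    moreover have "(\<lambda>m. 2 * \<nu> * (fps_nth (besselJ_fps \<nu>) m * exp ((\<nu> + 2 * of_nat m) * z)))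
       sums (2 * \<nu> * besselJ_e \<nu> z)"
      unfolding besselJ_e_eq by (intro sums_mult exp_series_sums) simp
    ultimately show ?thesis by (simp add: sums_unique2)
  qed
  ultimately show ?thesis by simp
qed

text \<open>Termwise differentiation in the order; on a unit disc of orders the series is dominated
  by an exponential series.\<close>

lemma besselJ_has_order_derivative:
  "((\<lambda>\<mu>. besselJ_e \<mu> z) has_field_derivative besselJ_order_deriv \<nu> z) (at \<nu>)"
proof -
  define t where "t = (\<lambda>m \<mu>. besselJ_coeff \<mu> m * exp ((\<mu> + 2 * of_nat m) * z))"
  define t' where "t' = (\<lambda>m \<mu>. z * (fps_nth (besselJ_fps \<mu>) m * exp ((\<mu> + 2 * of_nat m) * z))
      + fps_nth (besselJ_order_fps \<mu>) m * exp ((\<mu> + 2 * of_nat m) * z))"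
  have der: "(t m has_field_derivative t' m \<mu>) (at \<mu>)" for m \<mu>
  proof -
    have "((\<lambda>\<mu>. exp ((\<mu> + 2 * of_nat m) * z)) has_field_derivative z * exp ((\<mu> + 2 * of_nat m) * z)) (at \<mu>)"
      by (auto intro!: derivative_eq_intros)
    from DERIV_mult[OF besselJ_coeff_has_derivative[of m] this] show ?thesis
      unfolding t_def t'_def fps_nth_besselJ by (rule DERIV_cong) (simp add: algebra_simps)
  qed
  have "\<exists>d h. 0 < d \<and> summable h \<and> (\<forall>\<^sub>F m in sequentially. \<forall>y\<in>ball \<mu> d \<inter> UNIV. cmod (t m y) \<le> h m)" for \<mu>
  proof -
    obtain B where B0: "B \<ge> 0" and B: "\<And>y m. y \<in> cball \<mu> 1 \<Longrightarrow> cmod (besselJ_coeff y m) \<le> B / fact m"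
      using besselJ_coeff_bounded[of \<mu>] by blast
    define K where "K = cmod (exp (2 * z))"
    define h where "h = (\<lambda>m. B * exp ((cmod \<mu> + 1) * cmod z) * (K ^ m / fact m))"
    have "cmod (t m y) \<le> h m" if "y \<in> ball \<mu> 1" for m y
    proof -
      have y: "cmod y \<le> cmod \<mu> + 1"
        using that norm_triangle_ineq2[of y \<mu>] by (simp add: dist_norm norm_minus_commute)
      have "cmod (exp (y * z)) \<le> exp (cmod (y * z))" by (rule norm_exp)
      also have "\<dots> \<le> exp ((cmod \<mu> + 1) * cmod z)"
        using y by (simp add: norm_mult mult_right_mono)
      finally have e: "cmod (exp (y * z)) \<le> exp ((cmod \<mu> + 1) * cmod z)" .
      have "exp ((y + 2 * of_nat m) * z) = exp (y * z) * exp (2 * z) ^ m"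
        by (simp add: exp_of_nat_mult[symmetric] exp_add[symmetric] algebra_simps)
      then have "cmod (t m y) = cmod (besselJ_coeff y m) * (cmod (exp (y * z)) * K ^ m)"
        by (simp add: t_def K_def norm_mult norm_power)
      also have "\<dots> \<le> (B / fact m) * (exp ((cmod \<mu> + 1) * cmod z) * K ^ m)"
        using that B0 by (intro mult_mono B e) (auto simp: K_def)
      finally show ?thesis by (simp add: h_def)
    qed
    moreover have "summable h" unfolding h_def
      using summable_exp_generic[of K] by (intro summable_mult) (simp add: field_simps)
    ultimately show ?thesis by (intro exI[of _ 1] exI[of _ h]) (auto intro: always_eventually)
  qed
  then obtain g g' where g: "\<And>\<mu>. (\<lambda>m. t m \<mu>) sums g \<mu>" "\<And>\<mu>. (\<lambda>m. t' m \<mu>) sums g' \<mu>"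
      "\<And>\<mu>. (g has_field_derivative g' \<mu>) (at \<mu>)"
    using series_and_derivative_comparison_local[of UNIV t t'] der by simp blast
  have "(\<lambda>m. t m \<mu>) sums besselJ_e \<mu> z" for \<mu>
    unfolding t_def besselJ_e_eq using exp_series_sums[of "besselJ_fps \<mu>" \<mu> z]
    by (simp add: fps_nth_besselJ)
  then have 1: "g = (\<lambda>\<mu>. besselJ_e \<mu> z)" by (intro ext sums_unique2[OF g(1)])
  have "(\<lambda>m. t' m \<nu>) sums besselJ_order_deriv \<nu> z"
    unfolding t'_def besselJ_order_deriv_def besselJ_e_eq
    by (intro sums_add sums_mult exp_series_sums) auto
  then have 2: "g' \<nu> = besselJ_order_deriv \<nu> z" by (rule sums_unique2[OF g(2)])
  show ?thesis using g(3)[of \<nu>] by (simp add: 1 2)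
qed

section \<open>Integer orders and Bessel functions of the second kind\<close>

lemma besselJ_coeff_neg_nat:
  "besselJ_coeff (- of_nat n) (m + n) = (-1)^n * besselJ_coeff (of_nat n) m"
proof -
  have *: "- of_nat n + of_nat (m + n) + 1 = of_nat m + (1::complex)"
    "of_nat n + of_nat m + 1 = of_nat (n + m) + (1::complex)"
    "- of_nat n + 2 * of_nat (m + n) = of_nat n + 2 * complex_of_nat m" by simp_all
  have **: "rGamma (of_nat k + 1) = (1 / fact k :: complex)" for k
    using Gamma_fact[of k, where 'a = complex] by (simp add: rGamma_inverse_Gamma inverse_eq_divide add.commute)
  show ?thesis unfolding besselJ_coeff_def * ** power_add add.commute[of n m] by (simp add: mult_ac)
qed

lemma besselJ_e_neg_nat:
  "besselJ_e (- of_nat n) z = (-1)^n * besselJ_e (of_nat n) z"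
proof -
  have "(\<lambda>m. fps_nth (besselJ_fps (of_nat n)) m * exp ((of_nat n + 2 * of_nat m) * z)) sums besselJ_e (of_nat n) z"
    unfolding besselJ_e_eq by (intro exp_series_sums) simp
  then have "(\<lambda>m. (-1)^n * (fps_nth (besselJ_fps (of_nat n)) m * exp ((of_nat n + 2 * of_nat m) * z)))
      sums ((-1)^n * besselJ_e (of_nat n) z)" by (rule sums_mult)
  moreover define t where "t = (\<lambda>m. besselJ_coeff (- of_nat n) m * exp ((- of_nat n + 2 * of_nat m) * z))"
  have "t (m + n) = (-1)^n * (fps_nth (besselJ_fps (of_nat n)) m * exp ((of_nat n + 2 * of_nat m) * z))" for m
  proof -
    have *: "- of_nat n + 2 * of_nat (m + n) = of_nat n + 2 * complex_of_nat m" by simp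
    show ?thesis unfolding t_def fps_nth_besselJ besselJ_coeff_neg_nat * by (simp only: mult.assoc)
  qed
  \<comment> \<open>The reciprocal gamma function vanishes at \<open>i - n + 1 \<le> 0\<close>, so
    the series of order \<open>- n\<close> effectively starts at index \<open>n\<close>.\<close>
  moreover have "(\<Sum>i<n. t i) = 0"
  proof (intro sum.neutral ballI)
    fix i assume "i \<in> {..<n}"
    then have "- of_nat n + of_nat i + 1 = - complex_of_nat (n - i - 1)" by (simp add: of_nat_diff)
    then show "t i = 0" unfolding t_def besselJ_coeff_def by (simp only: rGamma_nonpos_Int) simp
  qed
  ultimately have "t sums ((-1)^n * besselJ_e (of_nat n) z)"
    using sums_iff_shift[of t n] by simp
  moreover have "t sums besselJ_e (- of_nat n) z"
    unfolding t_def besselJ_e_eq using exp_series_sums[of "besselJ_fps (- of_nat n)" "- of_nat n" z]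
    by (simp add: fps_nth_besselJ)
  ultimately show ?thesis using sums_unique2 by blast
qed

lemma cos_nat_pi: "cos (of_nat n * complex_of_real pi) = (-1)^n"
  using cos_of_real[of "real n * pi", where ?'a = complex] by simp

lemma sin_complex_pi_eq_0_iff: "sin (\<nu> * complex_of_real pi) = 0 \<longleftrightarrow> \<nu> \<in> \<int>"
proof
  assume "sin (\<nu> * complex_of_real pi) = 0"
  then obtain n :: int where "\<nu> * complex_of_real pi = of_real (of_int n * pi)"
    unfolding Complex_Transcendental.sin_eq_0 by auto
  then have "\<nu> * complex_of_real pi = of_int n * complex_of_real pi" by simp
  then have "\<nu> = of_int n" by (simp del: of_real_mult)
  then show "\<nu> \<in> \<int>" by simp
next
  assume "\<nu> \<in> \<int>"
  then obtain n :: int where "\<nu> = of_int n" by (auto elim: Ints_cases)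
  then show "sin (\<nu> * complex_of_real pi) = 0"
    unfolding Complex_Transcendental.sin_eq_0 by (auto intro!: exI[of _ n])
qed

lemma int_cases_neg_nat:
  assumes "(\<nu>::complex) \<in> \<int>"
  obtains n where "\<nu> = of_nat n" | n where "\<nu> = - of_nat n"
proof -
  obtain k :: int where k: "\<nu> = of_int k" using assms by (auto elim: Ints_cases)
  show ?thesis
  proof (cases "k \<ge> 0")
    case True then show ?thesis using that(1)[of "nat k"] k by simp
  next
    case False then show ?thesis using that(2)[of "nat (-k)"] k by simp
  qed
qed

lemma cos_sq_int: "\<nu> \<in> \<int> \<Longrightarrow> cos (\<nu> * complex_of_real pi) * cos (\<nu> * complex_of_real pi) = 1"
  using sin_cos_squared_add[of "\<nu> * complex_of_real pi"] sin_complex_pi_eq_0_iff[of \<nu>]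
  by (simp add: power2_eq_square)

lemma besselJ_e_neg_int:
  assumes "\<nu> \<in> \<int>"
  shows "besselJ_e (-\<nu>) z = cos (\<nu> * complex_of_real pi) * besselJ_e \<nu> z"
  using assms
proof (cases rule: int_cases_neg_nat)
  case (1 n) then show ?thesis by (simp add: besselJ_e_neg_nat cos_nat_pi)
next
  case (2 n) then show ?thesis
    by (simp add: besselJ_e_neg_nat[of n] cos_nat_pi power_mult_distrib[symmetric] mult.assoc[symmetric])
qed

text \<open>Numerator and denominator of \<open>besselY_gen\<close> both vanish at an integer order,
  so l'Hopital's rule in the order applies. The derivative of the cosine drops out because the sine
  is 0, and \<open>cos^2 = 1\<close> moves the cosine from the denominator to the numerator.\<close>

lemma besselY_e_int:
  assumes "\<nu> \<in> \<int>"
  shows "besselY_e \<nu> z = (besselJ_order_deriv \<nu> z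
      + cos (\<nu> * complex_of_real pi) * besselJ_order_deriv (-\<nu>) z) / complex_of_real pi"
proof -
  let ?s = "\<lambda>\<mu>. sin (\<mu> * complex_of_real pi)" and ?c = "\<lambda>\<mu>. cos (\<mu> * complex_of_real pi)"
  have s: "?s \<nu> = 0" using assms by (simp add: sin_complex_pi_eq_0_iff)
  have c: "?c \<nu> * ?c \<nu> = 1" by (rule cos_sq_int[OF assms])
  then have c0: "?c \<nu> \<noteq> 0" by force
  have m: "((\<lambda>\<mu>. besselJ_e (-\<mu>) z) has_field_derivative - besselJ_order_deriv (-\<nu>) z) (at \<nu>)"
    using DERIV_chain2[where g = uminus and x = \<nu> and s = UNIV and Db = "-1", OF besselJ_has_order_derivative[of z "-\<nu>"]]
    by (simp add: DERIV_minus[OF DERIV_ident, simplified])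
  have "(\<lambda>\<mu>. besselY_gen \<mu> z) \<midarrow>\<nu>\<rightarrow> (besselJ_order_deriv \<nu> z
      + ?c \<nu> * besselJ_order_deriv (-\<nu>) z) / complex_of_real pi"
    unfolding besselY_gen_def
  proof (rule lhopital_complex_simple)
    show "((\<lambda>\<mu>. besselJ_e \<mu> z * ?c \<mu> - besselJ_e (-\<mu>) z) has_field_derivative
       (besselJ_order_deriv \<nu> z * ?c \<nu> + besselJ_order_deriv (-\<nu>) z)) (at \<nu>)"
    proof -
      have "(?c has_field_derivative 0) (at \<nu>)" by (auto intro!: derivative_eq_intros simp: s)
      from DERIV_diff[OF DERIV_mult[OF besselJ_has_order_derivative[of z \<nu>] this] m]
      show ?thesis by (rule DERIV_cong) simp
    qed
    show "(?s has_field_derivative ?c \<nu> * pi) (at \<nu>)"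
      by (auto intro!: derivative_eq_intros)
    show "besselJ_e \<nu> z * ?c \<nu> - besselJ_e (-\<nu>) z = 0"
      by (simp add: besselJ_e_neg_int[OF assms])
    show "(besselJ_order_deriv \<nu> z * ?c \<nu> + besselJ_order_deriv (-\<nu>) z) / (?c \<nu> * pi) =
        (besselJ_order_deriv \<nu> z + ?c \<nu> * besselJ_order_deriv (-\<nu>) z) / complex_of_real pi"
      using c c0 by (simp add: divide_simps) (simp add: algebra_simps)
  qed (use s c0 in auto)
  then have "Lim (at \<nu>) (\<lambda>\<mu>. besselY_gen \<mu> z) = (besselJ_order_deriv \<nu> z
      + ?c \<nu> * besselJ_order_deriv (-\<nu>) z) / complex_of_real pi"
    by (intro tendsto_Lim) auto
  then show ?thesis using assms by (simp add: besselY_e_def)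
qed

lemma solves_besselJ_neg: "solves \<nu> (besselJ_e (-\<nu>)) (\<lambda>_. 0)"
  using solves_besselJ[of "-\<nu>"] by (simp add: solves_minus_order)

lemma solves_besselY: "solves \<nu> (besselY_e \<nu>) (\<lambda>_. 0)"
proof (cases "\<nu> \<in> \<int>")
  case False
  let ?c = "cos (\<nu> * complex_of_real pi)" and ?s = "sin (\<nu> * complex_of_real pi)"
  have "solves \<nu> (\<lambda>z. ?c / ?s * besselJ_e \<nu> z - 1 / ?s * besselJ_e (-\<nu>) z) (\<lambda>z. ?c / ?s * 0 - 1 / ?s * 0)"
    by (intro solves_diff solves_cmult solves_besselJ solves_besselJ_neg)
  then show ?thesis
    by (rule solves_cong) (use False in \<open>simp_all add: besselY_e_def besselY_gen_def diff_divide_distrib mult.commute\<close>)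
next
  case True
  let ?c = "cos (\<nu> * complex_of_real pi)"
  have "solves \<nu> (\<lambda>z. 1 / pi * besselJ_order_deriv \<nu> z + ?c / pi * besselJ_order_deriv (-\<nu>) z)
     (\<lambda>z. 1 / pi * (2 * \<nu> * besselJ_e \<nu> z) + ?c / pi * (2 * (-\<nu>) * besselJ_e (-\<nu>) z))"
    using solves_besselJ_order_deriv[of "-\<nu>"]
    by (intro solves_add solves_cmult solves_besselJ_order_deriv) (simp add: solves_minus_order)
  then show ?thesis
  proof (rule solves_cong)
    \<comment> \<open>By \<open>besselJ_e_neg_int\<close> and \<open>cos^2 = 1\<close> the
      inhomogeneities of the two order derivatives cancel.\<close>
    show "1 / pi * (2 * \<nu> * besselJ_e \<nu> z) + ?c / pi * (2 * (-\<nu>) * besselJ_e (-\<nu>) z) = 0" for z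
    proof -
      have "?c * (?c * w) = w" for w using cos_sq_int[OF True] by (simp add: mult.assoc[symmetric])
      then show ?thesis unfolding besselJ_e_neg_int[OF True] by simp
    qed
  qed (simp add: besselY_e_int[OF True] add_divide_distrib)
qed

section \<open>Translation by i pi\<close>

lemma exp_series_shift:
  "exp_series \<alpha> F (z + \<i> * pi) = exp (\<alpha> * (\<i> * pi)) * exp_series \<alpha> F z"
proof -
  have "exp (2 * (z + \<i> * pi)) = exp (2 * z)"
    using exp_plus_2pin[of "2 * z" 1] by (simp add: algebra_simps)
  then show ?thesis by (simp add: exp_series_def distrib_left exp_add)
qed

lemma besselJ_e_shift: "besselJ_e \<nu> (z + \<i> * pi) = exp (\<nu> * (\<i> * pi)) * besselJ_e \<nu> z"
  unfolding besselJ_e_eq by (rule exp_series_shift)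

lemma besselJ_order_deriv_shift:
  "besselJ_order_deriv \<nu> (z + \<i> * pi)
     = exp (\<nu> * (\<i> * pi)) * (besselJ_order_deriv \<nu> z + \<i> * pi * besselJ_e \<nu> z)"
  unfolding besselJ_order_deriv_def besselJ_e_shift exp_series_shift by (simp add: algebra_simps)

lemma exp_i_pi: "exp (\<nu> * (\<i> * pi)) = cos (\<nu> * complex_of_real pi) + \<i> * sin (\<nu> * complex_of_real pi)"
    "exp (-\<nu> * (\<i> * pi)) = cos (\<nu> * complex_of_real pi) - \<i> * sin (\<nu> * complex_of_real pi)"
  using exp_Euler[of "\<nu> * complex_of_real pi"] exp_Euler[of "-\<nu> * complex_of_real pi"]
  by (simp_all add: mult_ac)

text \<open>Together with \<open>besselJ_e_shift\<close> this is the triangular matrix of the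
  translation. At integer order its two eigenvalues coincide while the off-diagonal entry is
  nonzero: a Jordan block.\<close>

lemma besselY_e_shift:
  "besselY_e \<nu> (z + \<i> * pi) = exp (-\<nu> * (\<i> * pi)) * besselY_e \<nu> z
     + 2 * \<i> * cos (\<nu> * complex_of_real pi) * besselJ_e \<nu> z"
proof (cases "\<nu> \<in> \<int>")
  case False
  then have "sin (\<nu> * complex_of_real pi) \<noteq> 0" by (simp add: sin_complex_pi_eq_0_iff)
  then show ?thesis
    using False unfolding besselY_e_def besselY_gen_def besselJ_e_shift exp_i_pi
    by (simp add: field_simps)
next
  case True
  let ?c = "cos (\<nu> * complex_of_real pi)"
  have s: "sin (\<nu> * complex_of_real pi) = 0" using True by (simp add: sin_complex_pi_eq_0_iff)
  have c: "?c * ?c = 1" by (rule cos_sq_int[OF True])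
  have c': "?c * (?c * w) = w" for w using c by (simp add: mult.assoc[symmetric])
  show ?thesis
    unfolding besselY_e_int[OF True] besselJ_order_deriv_shift exp_i_pi besselJ_e_neg_int[OF True] s
    by (simp add: field_simps c' s)
qed

lemma besselJ_e_nonzero: "\<exists>z. besselJ_e \<nu> z \<noteq> 0"
proof (rule ccontr)
  assume "\<not> ?thesis"
  then have "besselJ_fps \<nu> = 0"
    by (intro exp_series_eqD[of _ _ \<nu>]) (auto simp: besselJ_e_eq[symmetric] exp_series_0)
  then have z: "besselJ_coeff \<nu> m = 0" for m using fps_nth_besselJ[of \<nu> m] by simp
  \<comment> \<open>Far enough out the argument of \<open>rGamma\<close> has positive real part, and
    \<open>rGamma\<close> vanishes only at nonpositive integers.\<close>
  obtain m :: nat where m: "cmod \<nu> < m" using reals_Archimedean2 by blast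
  have "Re (\<nu> + of_nat m + 1) > 0" using m abs_Re_le_cmod[of \<nu>] by simp
  moreover have "Re w \<le> 0" if "w \<in> \<int>\<^sub>\<le>\<^sub>0" for w :: complex
    using that by (auto elim!: nonpos_Ints_cases)
  ultimately have "\<nu> + of_nat m + 1 \<notin> \<int>\<^sub>\<le>\<^sub>0" by force
  then show False using z[of m] by (simp add: besselJ_coeff_def rGamma_eq_zero_iff)
qed

section \<open>Wronskians and the space of homogeneous solutions\<close>

definition wronskian :: "(complex \<Rightarrow> complex) \<Rightarrow> (complex \<Rightarrow> complex) \<Rightarrow> complex \<Rightarrow> complex" where
  "wronskian f g z = f z * deriv g z - deriv f z * g z"

text \<open>The equation in \<open>z\<close> has no first-derivative term, so the derivative of the
  Wronskian cancels completely.\<close>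

lemma wronskian_constant:
  assumes "solves \<nu> f (\<lambda>_. 0)" "solves \<nu> g (\<lambda>_. 0)"
  shows "wronskian f g z = wronskian f g 0"
proof -
  note hol = solves_holomorphic[OF assms(1)] solves_holomorphic[OF assms(2)]
  have d: "(h has_field_derivative deriv h z) (at z)" "(deriv h has_field_derivative deriv (deriv h) z) (at z)"
    if "h holomorphic_on UNIV" for h z
    using that holomorphic_derivI[of _ UNIV] holomorphic_deriv[of h UNIV] by auto
  have e: "deriv (deriv f) z = - (exp (2 * z) - \<nu>^2) * f z" "deriv (deriv g) z = - (exp (2 * z) - \<nu>^2) * g z" for z
    using assms unfolding solves_iff_deriv mult_minus_left eq_neg_iff_add_eq_0 by auto
  have "(wronskian f g has_field_derivative 0) (at z)" for z
    unfolding wronskian_def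
    by (rule DERIV_cong[OF DERIV_diff[OF DERIV_mult[OF d(1)[OF hol(1)] d(2)[OF hol(2)]] DERIV_mult[OF d(2)[OF hol(1)] d(1)[OF hol(2)]]]])
       (simp add: e algebra_simps)
  then have "\<exists>c. \<forall>z\<in>UNIV. wronskian f g z = c"
    by (intro has_field_derivative_zero_constant) auto
  then show ?thesis by auto
qed

text \<open>On a disc without zeros of \<open>f\<close> the quotient \<open>g / f\<close> has
  derivative 0; the identity theorem extends the relation to the plane.\<close>

lemma wronskian_zero_imp_proportional:
  assumes f: "f holomorphic_on UNIV" and g: "g holomorphic_on UNIV"
    and w: "\<And>z. wronskian f g z = 0" and f0: "f a \<noteq> 0"
  shows "\<exists>c. \<forall>z. g z = c * f z"
proof -
  have "open (f -` (- {0}))"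
    using f by (intro open_vimage holomorphic_on_imp_continuous_on) auto
  then obtain r where r: "r > 0" "ball a r \<subseteq> f -` (- {0})" using f0 by (metis Compl_iff open_contains_ball singletonD vimageI)
  have "\<exists>c. \<forall>z\<in>ball a r. g z / f z = c"
  proof (rule has_field_derivative_zero_constant)
    fix z assume "z \<in> ball a r"
    then have nz: "f z \<noteq> 0" using r by auto
    have "((\<lambda>z. g z / f z) has_field_derivative 0) (at z)"
      using DERIV_divide[OF holomorphic_derivI[OF g open_UNIV UNIV_I, of z] holomorphic_derivI[OF f open_UNIV UNIV_I, of z] nz]
      by (rule DERIV_cong) (use w[of z] in \<open>simp add: wronskian_def algebra_simps\<close>)
    then show "((\<lambda>z. g z / f z) has_field_derivative 0) (at z within ball a r)"
      by (rule has_field_derivative_at_within)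
  qed auto
  then obtain c where c: "\<And>z. z \<in> ball a r \<Longrightarrow> g z / f z = c" by blast
  have "g z = c * f z" for z
  proof (rule analytic_continuation_open[of "ball a r" UNIV g "\<lambda>z. c * f z"])
    show "(\<lambda>z. c * f z) holomorphic_on UNIV" by (intro holomorphic_intros f)
    show "g z = c * f z" if "z \<in> ball a r" for z 
    proof -
      have "f z \<noteq> 0" using r(2) that by auto
      then show ?thesis using c[OF that] by (simp add: field_simps)
    qed
  qed (use g r in auto)
  then show ?thesis by blast
qed

text \<open>Otherwise \<open>besselY_e\<close> would be a multiple \<open>c\<close> of
  \<open>besselJ_e\<close>. Comparing the two under translation gives
  \<open>c * sin (\<nu> * pi) = cos (\<nu> * pi)\<close>. This is impossible at integer order, and
  at any other order it forces \<open>besselJ_e (-\<nu>)\<close> to vanish identically.\<close>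

lemma wronskian_bessel_nonzero: "wronskian (besselJ_e \<nu>) (besselY_e \<nu>) z \<noteq> 0"
proof
  assume "wronskian (besselJ_e \<nu>) (besselY_e \<nu>) z = 0"
  then have w: "wronskian (besselJ_e \<nu>) (besselY_e \<nu>) z = 0" for z
    using wronskian_constant[OF solves_besselJ solves_besselY] by metis
  obtain a where a: "besselJ_e \<nu> a \<noteq> 0" using besselJ_e_nonzero by blast
  obtain c where c: "\<And>z. besselY_e \<nu> z = c * besselJ_e \<nu> z"
    using wronskian_zero_imp_proportional[OF solves_holomorphic[OF solves_besselJ] solves_holomorphic[OF solves_besselY] w a]
    by blast
  let ?c = "cos (\<nu> * complex_of_real pi)" and ?s = "sin (\<nu> * complex_of_real pi)"
  have "(c * (2 * \<i> * ?s)) * besselJ_e \<nu> a = (2 * \<i> * ?c) * besselJ_e \<nu> a"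
    using besselY_e_shift[of \<nu> a] unfolding c besselJ_e_shift exp_i_pi by (simp add: algebra_simps)
  then have cs: "c * ?s = ?c" using a by simp
  show False
  proof (cases "\<nu> \<in> \<int>")
    case True
    then have "?s = 0" by (simp add: sin_complex_pi_eq_0_iff)
    then show False using cs cos_sq_int[OF True] by simp
  next
    case False
    then have s: "?s \<noteq> 0" by (simp add: sin_complex_pi_eq_0_iff)
    have "besselJ_e (-\<nu>) z = 0" for z
    proof -
      have "besselJ_e \<nu> z * ?c = besselJ_e (-\<nu>) z + besselJ_e \<nu> z * (c * ?s)"
        using c[of z] False s by (simp add: besselY_e_def besselY_gen_def field_simps)
      then show ?thesis by (simp add: cs)
    qed
    then show False using besselJ_e_nonzero by blast
  qed
qed

lemma homogeneous_solution:
  assumes "solves \<nu> f (\<lambda>_. 0)"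
  shows "\<exists>A B. \<forall>z. f z = A * besselJ_e \<nu> z + B * besselY_e \<nu> z"
proof -
  let ?J = "besselJ_e \<nu>" and ?Y = "besselY_e \<nu>"
  define w where "w = wronskian ?J ?Y 0"
  have w0: "w \<noteq> 0" unfolding w_def by (rule wronskian_bessel_nonzero)
  have "f z = (wronskian f ?Y 0 / w) * ?J z + (- wronskian f ?J 0 / w) * ?Y z" for z
  proof -
    \<comment> \<open>Cramer's rule for the coefficients; all three Wronskians are constant.\<close>
    have "f z * wronskian ?J ?Y z = wronskian f ?Y z * ?J z - wronskian f ?J z * ?Y z"
      by (simp add: wronskian_def algebra_simps)
    then have "f z * w = wronskian f ?Y 0 * ?J z - wronskian f ?J 0 * ?Y z"
      using wronskian_constant[OF solves_besselJ solves_besselY, of \<nu> z]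
        wronskian_constant[OF assms solves_besselY, of z] wronskian_constant[OF assms solves_besselJ, of z]
      by (simp add: w_def)
    then show ?thesis using w0 by (simp add: field_simps)
  qed
  then show ?thesis by blast
qed

lemma bessel_independent:
  assumes "\<And>z. A * besselJ_e \<nu> z + B * besselY_e \<nu> z = 0"
  shows "A = 0" "B = 0"
proof -
  let ?J = "besselJ_e \<nu>" and ?Y = "besselY_e \<nu>"
  have d: "(h has_field_derivative deriv h z) (at z)" if "solves \<nu> h (\<lambda>_. 0)" for h z
    using holomorphic_derivI[OF solves_holomorphic[OF that] open_UNIV UNIV_I] .
  have "((\<lambda>z. A * ?J z + B * ?Y z) has_field_derivative (A * deriv ?J 0 + B * deriv ?Y 0)) (at 0)"
    by (intro DERIV_add DERIV_cmult d solves_besselJ solves_besselY)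
  then have e: "A * deriv ?J 0 + B * deriv ?Y 0 = 0"
    using assms by (simp add: DERIV_unique[OF _ DERIV_const[of 0]])
  have "A * wronskian ?J ?Y 0 = (A * ?J 0 + B * ?Y 0) * deriv ?Y 0 - (A * deriv ?J 0 + B * deriv ?Y 0) * ?Y 0"
    "B * wronskian ?J ?Y 0 = (A * deriv ?J 0 + B * deriv ?Y 0) * ?J 0 - (A * ?J 0 + B * ?Y 0) * deriv ?J 0"
    by (simp_all add: wronskian_def algebra_simps)
  then show "A = 0" "B = 0" unfolding assms e using wronskian_bessel_nonzero[of \<nu> 0] by simp_all
qed

section \<open>Lommel functions as particular solutions\<close>

lemma eventually_decreasing_bounded:
  fixes b :: "nat \<Rightarrow> real"
  assumes "\<And>m. m \<ge> N \<Longrightarrow> b (Suc m) \<le> b m"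
  shows "\<exists>B. \<forall>m. b m \<le> B"
proof -
  define B where "B = Max (b ` {..N})"
  have "b m \<le> B" if "m \<le> N" for m
    unfolding B_def using that by (intro Max_ge) auto
  moreover have "b m \<le> B" if "m \<ge> N" for m
    using that
  proof (induction m rule: nat_induct_at_least)
    case base then show ?case using calculation by simp
  next
    case (Suc m) then show ?case using assms[of m] by linarith
  qed
  ultimately show ?thesis by (meson nat_le_linear)
qed

text \<open>The bound is crude on purpose: it only has to survive multiplication by Bessel
  coefficients, which are of size at most \<open>B / fact m\<close>.\<close>

lemma linear_growth_exp_bound:
  fixes x :: "nat \<Rightarrow> real"
  assumes "\<And>m. m \<ge> N \<Longrightarrow> x (Suc m) \<le> x m + 1"
  shows "\<exists>C\<ge>0. \<forall>m. x m \<le> C * 2 ^ m"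
proof -
  have "x (Suc m) - real (Suc m) \<le> x m - real m" if "m \<ge> N" for m
    using assms[OF that] by simp
  then have "\<exists>B. \<forall>m. x m - real m \<le> B"
    by (rule eventually_decreasing_bounded)
  then obtain B where B: "\<And>m. x m - real m \<le> B" by blast
  have "x m \<le> (\<bar>B\<bar> + 1) * 2 ^ m" for m
  proof -
    have "x m \<le> \<bar>B\<bar> * 1 + real m" using B[of m] by linarith
    also have "\<dots> \<le> \<bar>B\<bar> * 2 ^ m + 2 ^ m"
      using of_nat_less_two_power[of m, where 'a = real] by (intro add_mono mult_left_mono) (auto intro: less_imp_le)
    finally show ?thesis by (simp add: algebra_simps)
  qed
  then show ?thesis by (intro exI[of _ "\<bar>B\<bar> + 1"]) auto
qed

text \<open>In \<open>Digamma (w + 1) = Digamma w + 1 / w\<close> the increment has modulus at most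
  1 as soon as \<open>m\<close> reaches \<open>cmod \<nu>\<close>.\<close>

lemma Digamma_exp_bound:
  assumes "\<And>m. \<nu> + of_nat m + 1 \<noteq> (0::complex)"
  shows "\<exists>C\<ge>0. \<forall>m. cmod (Digamma (\<nu> + of_nat m + 1)) \<le> C * 2 ^ m"
proof (rule linear_growth_exp_bound[of "nat \<lceil>cmod \<nu>\<rceil>"])
  fix m assume "nat \<lceil>cmod \<nu>\<rceil> \<le> m"
  then have "cmod \<nu> \<le> m" by linarith
  then have "cmod (\<nu> + of_nat m + 1) \<ge> 1"
    using norm_triangle_ineq2[of "complex_of_nat (Suc m)" "-\<nu>"] by (simp add: algebra_simps del: of_nat_Suc) (simp add: algebra_simps)
  then have "cmod (1 / (\<nu> + of_nat m + 1)) \<le> 1" by (simp add: norm_divide divide_simps)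
  moreover have "Digamma (\<nu> + of_nat (Suc m) + 1) = Digamma (\<nu> + of_nat m + 1) + 1 / (\<nu> + of_nat m + 1)"
    using Digamma_plus1[OF assms[of m]] by (simp add: algebra_simps)
  ultimately show "cmod (Digamma (\<nu> + of_nat (Suc m) + 1)) \<le> cmod (Digamma (\<nu> + of_nat m + 1)) + 1"
    using norm_triangle_ineq[of "Digamma (\<nu> + of_nat m + 1)" "1 / (\<nu> + of_nat m + 1)"] by simp
qed

lemma of_nat_plus_one_neq_0: "complex_of_nat m + 1 \<noteq> 0"
  using of_nat_neq_0[of m, where 'a = complex] by (simp add: add.commute)

lemma trigamma_exp_bound:
  "\<exists>C\<ge>0. \<forall>m. cmod (Polygamma 1 (complex_of_nat m + 1)) \<le> C * 2 ^ m"
proof (rule linear_growth_exp_bound[of 0])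
  fix m :: nat
  have "Polygamma 1 (complex_of_nat (Suc m) + 1) = Polygamma 1 (complex_of_nat m + 1) - 1 / (complex_of_nat m + 1)^2"
    using Polygamma_plus1[OF of_nat_plus_one_neq_0[of m], of 1] by (simp add: numeral_2_eq_2 add.commute)
  moreover have "cmod (complex_of_nat m + 1) \<ge> 1"
    using norm_of_nat[of "Suc m", where 'a = complex] by (simp add: add.commute)
  then have "cmod (1 / (complex_of_nat m + 1)^2) \<le> 1"
    by (simp add: norm_divide norm_power divide_simps)
  ultimately show "cmod (Polygamma 1 (complex_of_nat (Suc m) + 1)) \<le> cmod (Polygamma 1 (complex_of_nat m + 1)) + 1"
    using norm_triangle_ineq4[of "Polygamma 1 (complex_of_nat m + 1)" "1 / (complex_of_nat m + 1)^2"] by simp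
qed

lemma fps_conv_radius_besselJ_mult:
  assumes "\<And>m. cmod (d m) \<le> C * K ^ m" "C \<ge> 0" "K \<ge> 0"
  shows "fps_conv_radius (Abs_fps (\<lambda>m. besselJ_coeff \<nu> m * d m)) = \<infinity>"
proof -
  obtain B where B: "B \<ge> 0" "\<And>\<mu> m. \<mu> \<in> cball \<nu> 1 \<Longrightarrow> cmod (besselJ_coeff \<mu> m) \<le> B / fact m"
    using besselJ_coeff_bounded[of \<nu>] by blast
  show ?thesis
  proof (rule fps_conv_radius_fact_bound)
    fix m show "cmod (besselJ_coeff \<nu> m * d m) \<le> (B * C) * K ^ m / fact m"
      using mult_mono[OF B(2)[of \<nu> m] assms(1)[of m]] B(1) by (simp add: norm_mult mult_ac)
  qed
qed

definition lommel_small_fps :: "complex \<Rightarrow> complex \<Rightarrow> complex fps" where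
  "lommel_small_fps \<mu> \<nu> = Abs_fps (\<lambda>m. (-1)^m / (\<Prod>k=0..m. ((\<mu> + 2 * of_nat k + 1)^2 - \<nu>^2)))"

lemma odd_neg_int_factor:
  assumes "\<not> odd_neg_int (\<mu> + \<nu>)" "\<not> odd_neg_int (\<mu> - \<nu>)"
  shows "(\<mu> + 2 * of_nat k + 1)^2 - \<nu>^2 \<noteq> 0"
proof
  assume "(\<mu> + 2 * of_nat k + 1)^2 - \<nu>^2 = 0"
  then have "(\<mu> + \<nu> + (2 * of_nat k + 1)) * (\<mu> - \<nu> + (2 * of_nat k + 1)) = 0"
    by (simp add: power2_eq_square algebra_simps)
  then show False using assms unfolding odd_neg_int_def eq_neg_iff_add_eq_0 by auto
qed

text \<open>The denominators are built to solve the recurrence with right-hand side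
  \<open>1, 0, 0, ...\<close>; the hypotheses say that none of their factors is 0.\<close>

lemma lommel_small:
  assumes "\<not> odd_neg_int (\<mu> + \<nu>)" "\<not> odd_neg_int (\<mu> - \<nu>)"
  shows "fps_conv_radius (lommel_small_fps \<mu> \<nu>) = \<infinity>"
    and "lommel_small_s \<mu> \<nu> = exp_series (\<mu> + 1) (lommel_small_fps \<mu> \<nu>)"
    and "bessel_fps (\<mu> + 1) \<nu> (lommel_small_fps \<mu> \<nu>) = 1"
proof -
  define q where "q = (\<lambda>k::nat. (\<mu> + 2 * of_nat k + 1)^2 - \<nu>^2)"
  have q: "q k \<noteq> 0" for k unfolding q_def by (rule odd_neg_int_factor[OF assms])
  define a where "a m = (-1)^m / prod q {0..m}" for m
  have aS: "a (Suc m) = - a m / q (Suc m)" for m by (simp add: a_def prod.atLeast0_atMost_Suc)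
  have F: "lommel_small_fps \<mu> \<nu> = Abs_fps a" by (rule fps_ext) (simp add: lommel_small_fps_def a_def q_def)
  have "\<exists>B. \<forall>m. cmod (a m) * fact m \<le> B"
  \<comment> \<open>Beyond this index both linear factors of \<open>q (Suc m)\<close> have modulus
    at least \<open>Suc m\<close>, which is what makes \<open>cmod (a m) * fact m\<close>
    nonincreasing.\<close>
  proof (rule eventually_decreasing_bounded[of "nat \<lceil>cmod \<mu> + cmod \<nu>\<rceil>"])
    fix m assume "nat \<lceil>cmod \<mu> + cmod \<nu>\<rceil> \<le> m"
    then have m: "cmod \<mu> + cmod \<nu> \<le> m" by linarith
    have ge: "cmod (\<mu> + 2 * of_nat (Suc m) + 1 + s) \<ge> real (Suc m)" if "cmod s = cmod \<nu>" for s
    proof -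
      have "cmod (complex_of_nat (2 * Suc m + 1)) \<le> cmod (\<mu> + 2 * of_nat (Suc m) + 1 + s) + cmod (\<mu> + s)"
        using norm_triangle_ineq4[of "\<mu> + 2 * of_nat (Suc m) + 1 + s" "\<mu> + s"] by (simp add: algebra_simps)
      then have "real (2 * Suc m + 1) \<le> cmod (\<mu> + 2 * of_nat (Suc m) + 1 + s) + cmod (\<mu> + s)" by (simp only: norm_of_nat)
      then show ?thesis using norm_triangle_ineq[of \<mu> s] m that by simp
    qed
    have "q (Suc m) = (\<mu> + 2 * of_nat (Suc m) + 1 + \<nu>) * (\<mu> + 2 * of_nat (Suc m) + 1 + (-\<nu>))"
      by (simp add: q_def power2_eq_square algebra_simps)
    then have "cmod (q (Suc m)) \<ge> real (Suc m) * real (Suc m)"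
      using mult_mono[OF ge[of \<nu>] ge[of "-\<nu>"]] by (simp add: norm_mult)
    moreover have "real (Suc m) * real (Suc m) \<ge> real (Suc m)" by simp
    ultimately have "cmod (q (Suc m)) \<ge> real (Suc m)" by linarith
    then have "cmod (a m) * fact (Suc m) \<le> cmod (a m) * fact m * cmod (q (Suc m))"
      using mult_left_mono[of "real (Suc m)" "cmod (q (Suc m))" "cmod (a m) * fact m"] by (simp add: mult_ac)
    then show "cmod (a (Suc m)) * fact (Suc m) \<le> cmod (a m) * fact m"
      using q[of "Suc m"] by (simp add: aS norm_divide divide_simps)
  qed
  then obtain B where B: "\<And>m. cmod (a m) * fact m \<le> B" by blast
  show conv: "fps_conv_radius (lommel_small_fps \<mu> \<nu>) = \<infinity>" unfolding F
    by (rule fps_conv_radius_fact_bound[of _ B 1]) (use B in \<open>simp add: field_simps\<close>)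
  show "lommel_small_s \<mu> \<nu> = exp_series (\<mu> + 1) (lommel_small_fps \<mu> \<nu>)"
    unfolding lommel_small_s_def fun_eq_iff
    by (intro allI suminf_exp_series conv) (simp add: lommel_small_fps_def)
  show "bessel_fps (\<mu> + 1) \<nu> (lommel_small_fps \<mu> \<nu>) = 1"
  proof (rule fps_ext)
    fix m
    have qq: "(\<mu> + 1 + 2 * of_nat m)^2 - \<nu>^2 = q m" for m by (simp add: q_def add_ac)
    show "fps_nth (bessel_fps (\<mu> + 1) \<nu> (lommel_small_fps \<mu> \<nu>)) m = fps_nth 1 m"
      unfolding bessel_fps_def F fps_nth_Abs_fps qq
      using q by (cases m) (simp_all add: aS a_def)
  qed
qed

lemma exp_series_1: "exp_series \<alpha> 1 z = exp (\<alpha> * z)"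
  by (simp add: exp_series_def)

lemma solves_lommel_gen:
  assumes "\<not> odd_neg_int (\<mu> + \<nu>)" "\<not> odd_neg_int (\<mu> - \<nu>)"
  shows "solves \<nu> (lommel_gen \<mu> \<nu>) (\<lambda>z. exp ((\<mu> + 1) * z))"
proof -
  let ?K = "exp ((\<mu> - 1) * ln2c) * Gamma ((\<mu> - \<nu> + 1) / 2) * Gamma ((\<mu> + \<nu> + 1) / 2)"
  have "solves \<nu> (\<lambda>z. exp_series (\<mu> + 1) (lommel_small_fps \<mu> \<nu>) z
      + ?K * (sin ((\<mu> - \<nu>) * pi / 2) * besselJ_e \<nu> z - cos ((\<mu> - \<nu>) * pi / 2) * besselY_e \<nu> z))
    (\<lambda>z. exp_series (\<mu> + 1) (bessel_fps (\<mu> + 1) \<nu> (lommel_small_fps \<mu> \<nu>)) z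
      + ?K * (sin ((\<mu> - \<nu>) * pi / 2) * 0 - cos ((\<mu> - \<nu>) * pi / 2) * 0))"
    by (intro solves_add solves_cmult solves_diff solves_exp_series solves_besselJ solves_besselY lommel_small[OF assms])
  then show ?thesis
    by (rule solves_cong)
       (simp_all add: lommel_gen_def lommel_small[OF assms] exp_series_1 mult.commute)
qed

section \<open>The base functions of case (ii) at generic, zero and negative integer order\<close>

definition lommel_base_coeff :: "complex \<Rightarrow> nat \<Rightarrow> complex" where
  "lommel_base_coeff \<nu> m = 2 * ln2c + Digamma (\<nu> + of_nat m + 1) + Digamma (of_nat m + 1)"

definition lommel_base_fps :: "complex \<Rightarrow> complex fps" where
  "lommel_base_fps \<nu> = Abs_fps (\<lambda>m. besselJ_coeff \<nu> m * lommel_base_coeff \<nu> m)"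

lemma nonpos_int_add_neq_0:
  assumes "\<And>n::nat. \<nu> \<noteq> - of_nat n"
  shows "\<nu> + of_nat m + 1 \<noteq> (0::complex)"
proof
  assume "\<nu> + of_nat m + 1 = 0"
  then have "\<nu> = - of_nat (Suc m)" unfolding eq_neg_iff_add_eq_0 by (simp add: add_ac)
  with assms show False by blast
qed

text \<open>From \<open>m - 1\<close> to \<open>m\<close> the value of
  \<open>lommel_base_coeff\<close> grows by \<open>1 / (\<nu> + m) + 1 / m\<close>. Multiplied by
  \<open>4 m (m + \<nu>)\<close> this is \<open>4 (\<nu> + 2 m)\<close>, which is 4 times the factor
  in \<open>exp_euler\<close>. So the operator sends the digamma series to 4 times the derivative of
  \<open>besselJ_e\<close>, up to the term of index 0.\<close>

lemma lommel_base_series: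
  assumes nn: "\<And>n::nat. \<nu> \<noteq> - of_nat n"
  shows "fps_conv_radius (lommel_base_fps \<nu>) = \<infinity>"
    and "exp (\<nu> * z) * (\<Sum>m. (-1)^m * exp (2 * of_nat m * (z - ln2c))
              * (2 * ln2c + Digamma (\<nu> + of_nat m + 1) + Digamma (of_nat m + 1))
              / (fact m * Gamma (\<nu> + of_nat m + 1)))
         = exp (\<nu> * ln2c) * exp_series \<nu> (lommel_base_fps \<nu>) z"
    and "exp_series \<nu> (bessel_fps \<nu> \<nu> (lommel_base_fps \<nu>)) z
         = 4 * exp_series \<nu> (exp_euler \<nu> (besselJ_fps \<nu>)) z - 4 * \<nu> * besselJ_coeff \<nu> 0 * exp (\<nu> * z)"
proof -
  obtain C1 where C1: "C1 \<ge> 0" "\<And>m. cmod (Digamma (\<nu> + of_nat m + 1)) \<le> C1 * 2 ^ m"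
    using Digamma_exp_bound[of \<nu>] nonpos_int_add_neq_0[OF nn] by blast
  obtain C2 where C2: "C2 \<ge> 0" "\<And>m. cmod (Digamma (complex_of_nat m + 1)) \<le> C2 * 2 ^ m"
    using Digamma_exp_bound[of 0] of_nat_plus_one_neq_0 by auto
  have A: "cmod (lommel_base_coeff \<nu> m) \<le> (cmod (2 * ln2c) + C1 + C2) * 2 ^ m" for m
  proof -
    have "cmod (lommel_base_coeff \<nu> m) \<le> cmod (2 * ln2c) * 1 + cmod (Digamma (\<nu> + of_nat m + 1)) + cmod (Digamma (complex_of_nat m + 1))"
      unfolding lommel_base_coeff_def
      using norm_triangle_ineq[of "2 * ln2c + Digamma (\<nu> + of_nat m + 1)" "Digamma (complex_of_nat m + 1)"]
        norm_triangle_ineq[of "2 * ln2c" "Digamma (\<nu> + of_nat m + 1)"] by linarith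
    also have "\<dots> \<le> cmod (2 * ln2c) * 2 ^ m + C1 * 2 ^ m + C2 * 2 ^ m"
      by (intro add_mono C1 C2 mult_left_mono) auto
    finally show ?thesis by (simp add: algebra_simps)
  qed
  show conv: "fps_conv_radius (lommel_base_fps \<nu>) = \<infinity>"
    unfolding lommel_base_fps_def using C1 C2
    by (intro fps_conv_radius_besselJ_mult[OF A]) auto
  let ?t = "\<lambda>m. (-1)^m * exp (2 * of_nat m * (z - ln2c))
              * (2 * ln2c + Digamma (\<nu> + of_nat m + 1) + Digamma (of_nat m + 1))
              / (fact m * Gamma (\<nu> + of_nat m + 1))"
  have t: "exp (\<nu> * ln2c) * (fps_nth (lommel_base_fps \<nu>) m * exp ((\<nu> + 2 * of_nat m) * z)) = exp (\<nu> * z) * ?t m" for m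
  proof -
    have e: "exp (\<nu> * ln2c) * (exp (-(\<nu> + 2 * of_nat m) * ln2c) * exp ((\<nu> + 2 * of_nat m) * z))
        = exp (\<nu> * z) * exp (2 * of_nat m * (z - ln2c))"
      by (simp only: exp_add[symmetric]) (simp add: algebra_simps)
    have "exp (\<nu> * ln2c) * (fps_nth (lommel_base_fps \<nu>) m * exp ((\<nu> + 2 * of_nat m) * z))
       = (exp (\<nu> * ln2c) * (exp (-(\<nu> + 2 * of_nat m) * ln2c) * exp ((\<nu> + 2 * of_nat m) * z)))
          * ((-1)^m * rGamma (\<nu> + of_nat m + 1) / fact m * lommel_base_coeff \<nu> m)"
      unfolding lommel_base_fps_def besselJ_coeff_def fps_nth_Abs_fps by (simp only: mult_ac times_divide_eq_right times_divide_eq_left)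
    then show ?thesis unfolding e by (simp add: lommel_base_coeff_def rGamma_inverse_Gamma divide_inverse mult_ac)
  qed
  have "(\<lambda>m. exp (\<nu> * ln2c) * (fps_nth (lommel_base_fps \<nu>) m * exp ((\<nu> + 2 * of_nat m) * z))) sums
      (exp (\<nu> * ln2c) * exp_series \<nu> (lommel_base_fps \<nu>) z)"
    by (intro sums_mult exp_series_sums conv)
  then have s: "(\<lambda>m. exp (\<nu> * z) * ?t m) sums (exp (\<nu> * ln2c) * exp_series \<nu> (lommel_base_fps \<nu>) z)"
    unfolding t .
  then have "summable ?t" using summable_mult_D[of "exp (\<nu> * z)" ?t] by (simp add: sums_iff)
  then show "exp (\<nu> * z) * suminf ?t = exp (\<nu> * ln2c) * exp_series \<nu> (lommel_base_fps \<nu>) z"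
    using s suminf_mult[of ?t "exp (\<nu> * z)"] by (simp add: sums_iff)
  let ?c = "\<nu> * besselJ_coeff \<nu> 0"
  let ?E = "exp_euler \<nu> (besselJ_fps \<nu>)"
  have eq: "bessel_fps \<nu> \<nu> (lommel_base_fps \<nu>) = fps_const 4 * ?E - fps_const (4 * ?c)"
  proof (rule fps_ext)
    fix m
    show "fps_nth (bessel_fps \<nu> \<nu> (lommel_base_fps \<nu>)) m = fps_nth (fps_const 4 * ?E - fps_const (4 * ?c)) m"
    proof (cases m)
      case 0
      then show ?thesis by (simp add: bessel_fps_def exp_euler_def fps_nth_besselJ)
    next
      case (Suc k)
      let ?b = "besselJ_coeff \<nu> m" and ?N = "of_nat m :: complex"
      have N: "?N \<noteq> 0" "?N + \<nu> \<noteq> 0"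
        using nonpos_int_add_neq_0[OF nn, of k] by (auto simp: Suc add_ac simp del: of_nat_Suc) (simp add: add_ac)
      have Jk: "besselJ_coeff \<nu> k = - (4 * ?N * (?N + \<nu>) * ?b)"
        using besselJ_coeff_rec[of m \<nu>] by (simp add: Suc eq_neg_iff_add_eq_0 add_ac del: of_nat_Suc)
      have "lommel_base_coeff \<nu> m = lommel_base_coeff \<nu> k + 1 / (?N + \<nu>) + 1 / ?N"
        unfolding lommel_base_coeff_def
        using Digamma_plus1[of "\<nu> + of_nat k + 1"] Digamma_plus1[of "of_nat k + 1 :: complex"] N
        by (simp add: Suc add_ac)
      then have Ak: "lommel_base_coeff \<nu> k = lommel_base_coeff \<nu> m - 1 / (?N + \<nu>) - 1 / ?N" by simp
      have "fps_nth (bessel_fps \<nu> \<nu> (lommel_base_fps \<nu>)) m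
          = ((\<nu> + 2 * ?N)^2 - \<nu>^2) * (?b * lommel_base_coeff \<nu> m) + besselJ_coeff \<nu> k * lommel_base_coeff \<nu> k"
        by (simp add: bessel_fps_def lommel_base_fps_def Suc)
      also have "\<dots> = 4 * ?N * (?N + \<nu>) * ?b * (1 / (?N + \<nu>) + 1 / ?N)"
        unfolding Jk Ak by (simp add: power2_eq_square algebra_simps)
      also have "\<dots> = 4 * ((\<nu> + 2 * ?N) * ?b)" using N by (simp add: divide_simps)
      finally show ?thesis by (simp add: exp_euler_def fps_nth_besselJ Suc del: of_nat_Suc)
    qed
  qed
  have "fps_conv_radius ?E = \<infinity>" by (simp add: has_field_derivative_exp_series(1))
  moreover from this have "fps_conv_radius (fps_const 4 * ?E) = \<infinity>" by (simp add: fps_conv_radius_cmult_left)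
  ultimately show "exp_series \<nu> (bessel_fps \<nu> \<nu> (lommel_base_fps \<nu>)) z
         = 4 * exp_series \<nu> ?E z - 4 * \<nu> * besselJ_coeff \<nu> 0 * exp (\<nu> * z)"
    unfolding eq exp_series_def by (simp add: eval_fps_diff eval_fps_mult right_diff_distrib)
qed

lemma lommel_base_generic:
  assumes nn: "\<And>n::nat. \<nu> \<noteq> - of_nat n"
  shows "lommel_base \<nu> z = Gamma \<nu> * (exp ((\<nu> - 1) * ln2c) * (z * besselJ_e \<nu> z)
      - exp ((\<nu> - 2) * ln2c) * pi * besselY_e \<nu> z
      - exp (\<nu> * ln2c) / 4 * exp_series \<nu> (lommel_base_fps \<nu>) z)"
  using nn[of 0] nn lommel_base_series(2)[OF nn, of z]
  by (simp add: lommel_base_def mult_ac)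

text \<open>The derivative of \<open>besselJ_e\<close> produced by the logarithmic term cancels
  against the one from the digamma series. What remains is the index 0 term of the latter, and the
  gamma factors normalize it to \<open>exp (\<nu> * z)\<close>.\<close>

lemma solves_lommel_base_generic:
  assumes nn: "\<And>n::nat. \<nu> \<noteq> - of_nat n"
  shows "solves \<nu> (lommel_base \<nu>) (\<lambda>z. exp (\<nu> * z))"
proof -
  let ?E = "exp_euler \<nu> (besselJ_fps \<nu>)"
  have "solves \<nu> (\<lambda>z. Gamma \<nu> * (exp ((\<nu> - 1) * ln2c) * (z * besselJ_e \<nu> z)
      - exp ((\<nu> - 2) * ln2c) * pi * besselY_e \<nu> z
      - exp (\<nu> * ln2c) / 4 * exp_series \<nu> (lommel_base_fps \<nu>) z))
     (\<lambda>z. Gamma \<nu> * (exp ((\<nu> - 1) * ln2c) * (2 * exp_series \<nu> ?E z + z * 0)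
      - exp ((\<nu> - 2) * ln2c) * pi * 0
      - exp (\<nu> * ln2c) / 4 * exp_series \<nu> (bessel_fps \<nu> \<nu> (lommel_base_fps \<nu>)) z))"
    by (intro solves_cmult solves_diff solves_mult_id[OF solves_besselJ] besselJ_e_has_field_derivative
        solves_besselY solves_exp_series lommel_base_series(1)[OF nn])
  then show ?thesis
  proof (rule solves_cong)
    fix z
    have 1: "exp ((\<nu> - 1) * ln2c) * 2 = exp (\<nu> * ln2c)"
      by (simp add: exp_ln2c[symmetric] exp_add[symmetric] algebra_simps del: exp_ln2c)
    have 2: "exp (\<nu> * ln2c) * besselJ_coeff \<nu> 0 = rGamma (\<nu> + 1)"
      by (simp add: besselJ_coeff_def mult.assoc[symmetric] exp_add[symmetric])
    have "\<nu> \<notin> \<int>\<^sub>\<le>\<^sub>0" using nn by (auto elim!: nonpos_Ints_cases')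
    then have 3: "Gamma \<nu> * (\<nu> * rGamma (\<nu> + 1)) = 1"
      using rGamma_plus1[of \<nu>] by (simp add: rGamma_inverse_Gamma Gamma_eq_zero_iff)
    have "Gamma \<nu> * (exp ((\<nu> - 1) * ln2c) * (2 * exp_series \<nu> ?E z + z * 0)
      - exp ((\<nu> - 2) * ln2c) * pi * 0
      - exp (\<nu> * ln2c) / 4 * exp_series \<nu> (bessel_fps \<nu> \<nu> (lommel_base_fps \<nu>)) z)
      = Gamma \<nu> * ((exp ((\<nu> - 1) * ln2c) * 2) * exp_series \<nu> ?E z - exp (\<nu> * ln2c) * exp_series \<nu> ?E z
         + \<nu> * (exp (\<nu> * ln2c) * besselJ_coeff \<nu> 0) * exp (\<nu> * z))"
      unfolding lommel_base_series(3)[OF nn] by (simp add: algebra_simps)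
    also have "\<dots> = (Gamma \<nu> * (\<nu> * rGamma (\<nu> + 1))) * exp (\<nu> * z)"
      unfolding 1 2 by (simp add: algebra_simps)
    finally show "Gamma \<nu> * (exp ((\<nu> - 1) * ln2c) * (2 * exp_series \<nu> ?E z + z * 0)
      - exp ((\<nu> - 2) * ln2c) * pi * 0
      - exp (\<nu> * ln2c) / 4 * exp_series \<nu> (bessel_fps \<nu> \<nu> (lommel_base_fps \<nu>)) z) = exp (\<nu> * z)"
      unfolding 3 by simp
  qed (simp add: lommel_base_generic[OF nn])
qed

text \<open>Expanding the square sorts the series by powers of \<open>z\<close>, that is, of the
  logarithm, so that \<open>solves_mult_id\<close> can be applied to each piece.\<close>

lemma lommel_S0_eq:
  fixes z :: complex
  defines "A \<equiv> \<lambda>m. ln2c + Digamma (of_nat m + 1)"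
  defines "B \<equiv> \<lambda>m. A m ^ 2 - Polygamma 1 (of_nat m + 1) / 2 + of_real pi ^ 2 / 4"
  shows "fps_conv_radius (Abs_fps (\<lambda>m. besselJ_coeff 0 m * A m)) = \<infinity>"
    and "fps_conv_radius (Abs_fps (\<lambda>m. besselJ_coeff 0 m * B m)) = \<infinity>"
    and "lommel_S0 z = 1/2 * (z * (z * besselJ_e 0 z)
      - 2 * (z * exp_series 0 (Abs_fps (\<lambda>m. besselJ_coeff 0 m * A m)) z)
      + exp_series 0 (Abs_fps (\<lambda>m. besselJ_coeff 0 m * B m)) z)"
proof -
  obtain C1 where C1: "C1 \<ge> 0" "\<And>m. cmod (Digamma (complex_of_nat m + 1)) \<le> C1 * 2 ^ m"
    using Digamma_exp_bound[of 0] of_nat_plus_one_neq_0 by auto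
  obtain C2 where C2: "C2 \<ge> 0" "\<And>m. cmod (Polygamma 1 (complex_of_nat m + 1)) \<le> C2 * 2 ^ m"
    using trigamma_exp_bound by blast
  have A: "cmod (A m) \<le> (cmod ln2c + C1) * 2 ^ m" for m
  proof -
    have "cmod (A m) \<le> cmod ln2c * 1 + cmod (Digamma (complex_of_nat m + 1))"
      unfolding A_def using norm_triangle_ineq by simp
    also have "\<dots> \<le> cmod ln2c * 2 ^ m + C1 * 2 ^ m"
      by (intro add_mono C1 mult_left_mono) auto
    finally show ?thesis by (simp add: algebra_simps)
  qed
  \<comment> \<open>The base 4 arises from squaring the bound for \<open>A m\<close>.\<close>
  have B: "cmod (B m) \<le> ((cmod ln2c + C1)^2 + C2 + pi ^ 2) * 4 ^ m" for m
  proof -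
    have "cmod (B m) \<le> cmod (A m ^ 2) + cmod (Polygamma 1 (complex_of_nat m + 1) / 2) + cmod (complex_of_real pi ^ 2 / 4)"
      unfolding B_def
      using norm_triangle_ineq[of "A m ^ 2 - Polygamma 1 (of_nat m + 1) / 2" "of_real pi ^ 2 / 4"]
        norm_triangle_ineq4[of "A m ^ 2" "Polygamma 1 (of_nat m + 1) / 2"] by linarith
    moreover have "cmod (A m ^ 2) \<le> (cmod ln2c + C1)^2 * 4 ^ m"
    proof -
      have "cmod (A m ^ 2) \<le> ((cmod ln2c + C1) * 2 ^ m)^2"
        unfolding norm_power by (intro power_mono A) auto
      also have "(2 ^ m)^2 = (4::real) ^ m" by (simp add: power_mult[symmetric] mult.commute power2_eq_square power_mult_distrib[symmetric])
      then have "((cmod ln2c + C1) * 2 ^ m)^2 = (cmod ln2c + C1)^2 * 4 ^ m" by (simp add: power_mult_distrib)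
      finally show ?thesis .
    qed
    moreover have "cmod (Polygamma 1 (complex_of_nat m + 1) / 2) \<le> C2 * 4 ^ m"
    proof -
      have "cmod (Polygamma 1 (complex_of_nat m + 1) / 2) \<le> cmod (Polygamma 1 (complex_of_nat m + 1))"
        by (simp add: norm_divide)
      also have "\<dots> \<le> C2 * 2 ^ m" by (rule C2)
      also have "\<dots> \<le> C2 * 4 ^ m" using C2(1) by (intro mult_left_mono power_mono) auto
      finally show ?thesis .
    qed
    moreover have "cmod (complex_of_real pi ^ 2 / 4) \<le> pi ^ 2 * 4 ^ m"
    proof -
      have "cmod (complex_of_real pi ^ 2 / 4) = pi ^ 2 / 4" by (simp add: norm_divide norm_power)
      also have "\<dots> \<le> pi ^ 2 * 1" by simp
      also have "\<dots> \<le> pi ^ 2 * 4 ^ m" by (intro mult_left_mono) auto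
      finally show ?thesis .
    qed
    ultimately show ?thesis by (simp add: algebra_simps)
  qed
  show cA: "fps_conv_radius (Abs_fps (\<lambda>m. besselJ_coeff 0 m * A m)) = \<infinity>"
    by (rule fps_conv_radius_besselJ_mult[OF A]) (use C1 in auto)
  show cB: "fps_conv_radius (Abs_fps (\<lambda>m. besselJ_coeff 0 m * B m)) = \<infinity>"
    by (rule fps_conv_radius_besselJ_mult[OF B]) (use C1 C2 in auto)
  let ?e = "\<lambda>m. exp ((0 + 2 * of_nat m) * z)"
  have "(\<lambda>m. z * (z * (fps_nth (besselJ_fps 0) m * ?e m))
      - 2 * (z * (fps_nth (Abs_fps (\<lambda>m. besselJ_coeff 0 m * A m)) m * ?e m))
      + fps_nth (Abs_fps (\<lambda>m. besselJ_coeff 0 m * B m)) m * ?e m) sums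
     (z * (z * besselJ_e 0 z)
      - 2 * (z * exp_series 0 (Abs_fps (\<lambda>m. besselJ_coeff 0 m * A m)) z)
      + exp_series 0 (Abs_fps (\<lambda>m. besselJ_coeff 0 m * B m)) z)"
    unfolding besselJ_e_eq by (intro sums_add sums_diff sums_mult exp_series_sums cA cB) simp
  moreover have "z * (z * (fps_nth (besselJ_fps 0) m * ?e m))
      - 2 * (z * (fps_nth (Abs_fps (\<lambda>m. besselJ_coeff 0 m * A m)) m * ?e m))
      + fps_nth (Abs_fps (\<lambda>m. besselJ_coeff 0 m * B m)) m * ?e m
     = (-1)^m * exp (2 * of_nat m * (z - ln2c)) / (fact m)^2
       * ((z - ln2c - Digamma (of_nat m + 1))^2 - Polygamma 1 (of_nat m + 1) / 2 + of_real pi ^ 2 / 4)" for m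
  proof -
    have g: "rGamma (of_nat m + 1) = (1 / fact m :: complex)"
      using Gamma_fact[of m, where 'a = complex] by (simp add: rGamma_inverse_Gamma inverse_eq_divide add.commute)
    have "exp (- (0 + 2 * of_nat m) * ln2c) * ?e m = exp (2 * of_nat m * (z - ln2c))"
      by (simp only: exp_add[symmetric]) (simp add: algebra_simps)
    then have je: "besselJ_coeff 0 m * ?e m = (-1)^m * exp (2 * of_nat m * (z - ln2c)) / (fact m)^2"
      unfolding besselJ_coeff_def using g by (simp add: power2_eq_square)
    have sq: "(z - ln2c - Digamma (of_nat m + 1))^2 - Polygamma 1 (of_nat m + 1) / 2 + of_real pi ^ 2 / 4
      = z * z - 2 * z * A m + B m"
      by (simp add: A_def B_def power2_eq_square algebra_simps)
    have k: "z * (z * (j * e)) - 2 * (z * (j * A m * e)) + j * B m * e = j * e * (z * z - 2 * z * A m + B m)" for j e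
      by (simp add: algebra_simps)
    show ?thesis unfolding fps_nth_besselJ fps_nth_Abs_fps unfolding k unfolding je sq ..
  qed
  ultimately show "lommel_S0 z = 1/2 * (z * (z * besselJ_e 0 z)
      - 2 * (z * exp_series 0 (Abs_fps (\<lambda>m. besselJ_coeff 0 m * A m)) z)
      + exp_series 0 (Abs_fps (\<lambda>m. besselJ_coeff 0 m * B m)) z)"
    unfolding lommel_S0_def by (simp add: sums_iff)
qed

text \<open>Write \<open>J'\<close> and \<open>FA'\<close> for derivatives in \<open>z\<close>. The
  operator sends the \<open>A\<close> series to \<open>2 J'\<close> and the \<open>B\<close> series
  to \<open>4 FA' - 2 J + 2\<close>, by the recurrences of the digamma and trigamma functions.
  Everything but the 2 cancels against what \<open>solves_mult_id\<close> yields for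
  \<open>z^2 J\<close> and \<open>z FA\<close>; half of that 2 is the right-hand side.\<close>

lemma solves_lommel_S0: "solves 0 lommel_S0 (\<lambda>z. 1)"
proof -
  define A :: "nat \<Rightarrow> complex" where "A = (\<lambda>m. ln2c + Digamma (of_nat m + 1))"
  define B where "B = (\<lambda>m. A m ^ 2 - Polygamma 1 (of_nat m + 1) / 2 + of_real pi ^ 2 / 4)"
  define FA where "FA = Abs_fps (\<lambda>m. besselJ_coeff 0 m * A m)"
  define FB where "FB = Abs_fps (\<lambda>m. besselJ_coeff 0 m * B m)"
  have S0: "fps_conv_radius FA = \<infinity>" "fps_conv_radius FB = \<infinity>"
    "lommel_S0 z = 1/2 * (z * (z * besselJ_e 0 z) - 2 * (z * exp_series 0 FA z) + exp_series 0 FB z)" for z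
    unfolding FA_def FB_def A_def B_def by (rule lommel_S0_eq)+
  let ?E = "exp_euler 0 (besselJ_fps 0)" and ?J = "besselJ_e 0"
  let ?J' = "exp_series 0 ?E"
  have conv: "fps_conv_radius ?E = \<infinity>" "fps_conv_radius (exp_euler 0 FA) = \<infinity>"
    using S0(1) by (simp_all add: has_field_derivative_exp_series(1))
  have rel: "besselJ_coeff 0 k = - (4 * of_nat (Suc k) * of_nat (Suc k) * besselJ_coeff 0 (Suc k))" for k
    using besselJ_coeff_rec[of "Suc k" 0] by (simp add: eq_neg_iff_add_eq_0 add_ac del: of_nat_Suc)
  have AS: "A k = A (Suc k) - 1 / of_nat (Suc k)" for k
    using Digamma_plus1[OF of_nat_plus_one_neq_0[of k]] by (simp add: A_def add_ac)
  have BS: "B k = B (Suc k) - 2 * A (Suc k) / of_nat (Suc k) + 1 / (2 * (of_nat (Suc k))^2)" for k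
  proof -
    have "Polygamma 1 (complex_of_nat (Suc k) + 1) = Polygamma 1 (complex_of_nat k + 1) - 1 / (complex_of_nat (Suc k))^2"
      using Polygamma_plus1[OF of_nat_plus_one_neq_0[of k], of 1] by (simp add: numeral_2_eq_2 add.commute)
    then have "B (Suc k) = A (Suc k) ^ 2 - (Polygamma 1 (complex_of_nat k + 1) - 1 / (complex_of_nat (Suc k))^2) / 2 + of_real pi ^ 2 / 4"
      by (simp only: B_def)
    moreover have "complex_of_nat (Suc k) \<noteq> 0" by (rule of_nat_neq_0)
    ultimately show ?thesis unfolding B_def AS[of k]
      by (simp add: power2_eq_square divide_simps del: of_nat_Suc) (simp add: algebra_simps del: of_nat_Suc)
  qed
  have 1: "bessel_fps 0 0 FA = fps_const 2 * ?E"
  proof (rule fps_ext)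
    fix m
    show "fps_nth (bessel_fps 0 0 FA) m = fps_nth (fps_const 2 * ?E) m"
    proof (cases m)
      case (Suc k)
      have "complex_of_nat (Suc k) \<noteq> 0" by (rule of_nat_neq_0)
      then show ?thesis
        by (simp add: Suc bessel_fps_def FA_def exp_euler_def fps_nth_besselJ rel[of k] AS[of k] power2_eq_square del: of_nat_Suc)
           (simp add: algebra_simps del: of_nat_Suc)
    qed (simp add: bessel_fps_def exp_euler_def)
  qed
  have 2: "bessel_fps 0 0 FB = fps_const 4 * exp_euler 0 FA - fps_const 2 * besselJ_fps 0 + fps_const 2"
  proof (rule fps_ext)
    fix m
    show "fps_nth (bessel_fps 0 0 FB) m = fps_nth (fps_const 4 * exp_euler 0 FA - fps_const 2 * besselJ_fps 0 + fps_const 2) m"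
    proof (cases m)
      case 0
      \<comment> \<open>The left side is 0 at index 0, and the constant 2 offsets
        \<open>- 2 * besselJ_coeff 0 0\<close>.\<close>
      have "besselJ_coeff 0 0 = 1" by (simp add: besselJ_coeff_def)
      then show ?thesis by (simp add: 0 bessel_fps_def exp_euler_def fps_nth_besselJ)
    next
      case (Suc k)
      have N: "complex_of_nat (Suc k) \<noteq> 0" by (rule of_nat_neq_0)
      let ?N = "complex_of_nat (Suc k)" and ?c = "besselJ_coeff 0 (Suc k)"
      have "fps_nth (bessel_fps 0 0 FB) m = (2 * ?N)^2 * (?c * B (Suc k)) + besselJ_coeff 0 k * B k"
        by (simp add: Suc bessel_fps_def FB_def del: of_nat_Suc)
      also have "\<dots> = 4 * ?N * ?N * ?c * (2 * A (Suc k) / ?N - 1 / (2 * ?N^2))"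
        unfolding rel[of k] BS[of k] by (simp add: power2_eq_square algebra_simps del: of_nat_Suc)
      also have "\<dots> = 8 * ?N * ?c * A (Suc k) - 2 * ?c"
        using N by (simp add: power2_eq_square right_diff_distrib del: of_nat_Suc)
      finally show ?thesis
        by (simp add: Suc exp_euler_def FA_def fps_nth_besselJ mult_ac del: of_nat_Suc)
    qed
  qed
  have e1: "exp_series 0 (bessel_fps 0 0 FA) z = 2 * ?J' z" for z
    unfolding 1 exp_series_def using conv by (simp add: eval_fps_mult)
  have e2: "exp_series 0 (bessel_fps 0 0 FB) z = 4 * exp_series 0 (exp_euler 0 FA) z - 2 * ?J z + 2" for z
  proof -
    have c: "fps_conv_radius (fps_const 4 * exp_euler 0 FA) = \<infinity>" "fps_conv_radius (fps_const 2 * besselJ_fps 0) = \<infinity>"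
      using conv by (simp_all add: fps_conv_radius_cmult_left)
    then have "fps_conv_radius (fps_const 4 * exp_euler 0 FA - fps_const 2 * besselJ_fps 0) = \<infinity>"
      using fps_conv_radius_diff[of "fps_const 4 * exp_euler 0 FA" "fps_const 2 * besselJ_fps 0"] by simp
    with c conv show ?thesis
      unfolding 2 exp_series_def besselJ_e_eq by (simp add: eval_fps_mult eval_fps_diff eval_fps_add)
  qed
  have dzJ: "((\<lambda>z. z * ?J z) has_field_derivative (?J z + z * ?J' z)) (at z)" for z
    using DERIV_mult[OF DERIV_ident besselJ_e_has_field_derivative[of 0 z]] by (rule DERIV_cong) (simp add: mult.commute)
  have "solves 0 (\<lambda>z. 1/2 * (z * (z * ?J z) - 2 * (z * exp_series 0 FA z) + exp_series 0 FB z))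
     (\<lambda>z. 1/2 * ((2 * (?J z + z * ?J' z) + z * (2 * ?J' z + z * 0))
        - 2 * (2 * exp_series 0 (exp_euler 0 FA) z + z * exp_series 0 (bessel_fps 0 0 FA) z)
        + exp_series 0 (bessel_fps 0 0 FB) z))"
    by (intro solves_cmult solves_add solves_diff solves_exp_series S0(1,2) dzJ
        solves_mult_id[OF solves_mult_id[OF solves_besselJ besselJ_e_has_field_derivative]]
        solves_mult_id[OF solves_exp_series[OF S0(1)]] has_field_derivative_exp_series(2))
  then show ?thesis
    by (rule solves_cong) (simp_all only: S0(3) e1 e2, simp add: algebra_simps)
qed

text \<open>Splitting off the factor \<open>exp (n * z)\<close> turns the operator of order
  \<open>n\<close> into \<open>v'' + 2 n v' + exp (2 * z) * v\<close>. If this equation is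
  differentiated, twice the equation itself is subtracted, and the result is multiplied by
  \<open>exp (-2 * z) / 2\<close>, then \<open>dzeta2 v\<close> is seen to satisfy the equation for
  \<open>n + 1\<close>.\<close>

lemma dzeta2_funpow:
  "(dzeta2 ^^ n) lommel_S0 holomorphic_on UNIV \<and>
   (\<forall>z. deriv (deriv ((dzeta2 ^^ n) lommel_S0)) z + 2 * of_nat n * deriv ((dzeta2 ^^ n) lommel_S0) z
      + exp (2 * z) * (dzeta2 ^^ n) lommel_S0 z = (-1)^n * fact n * exp (- 2 * of_nat n * z))"
proof (induction n)
  case 0
  show ?case using solves_lommel_S0 by (simp add: solves_iff_deriv)
next
  case (Suc n)
  define v where "v = (dzeta2 ^^ n) lommel_S0"
  define R where "R z = (-1)^n * fact n * exp (- 2 * of_nat n * z)" for z :: complex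
  let ?d1 = "deriv v" and ?d2 = "deriv (deriv v)" and ?d3 = "deriv (deriv (deriv v))"
  have hol: "v holomorphic_on UNIV" and eq: "?d2 z + 2 * of_nat n * ?d1 z + exp (2 * z) * v z = R z" for z
    using Suc by (auto simp: v_def R_def)
  have hol1: "?d1 holomorphic_on UNIV" by (rule holomorphic_deriv[OF hol open_UNIV])
  have hol2: "?d2 holomorphic_on UNIV" by (rule holomorphic_deriv[OF hol1 open_UNIV])
  note d0 = holomorphic_derivI[OF hol open_UNIV UNIV_I]
  note d1 = holomorphic_derivI[OF hol1 open_UNIV UNIV_I]
  note d2 = holomorphic_derivI[OF hol2 open_UNIV UNIV_I]
  have eq': "?d3 z + 2 * of_nat n * ?d2 z + exp (2 * z) * ?d1 z + 2 * exp (2 * z) * v z = - 2 * of_nat n * R z" for z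
  proof (rule DERIV_unique)
    have "((\<lambda>z. ?d2 z + 2 * of_nat n * ?d1 z + exp (2 * z) * v z) has_field_derivative
        (?d3 z + 2 * of_nat n * ?d2 z + exp (2 * z) * ?d1 z + 2 * exp (2 * z) * v z)) (at z)"
      by (auto intro!: derivative_eq_intros d0 d1 d2)
    then show "(R has_field_derivative (?d3 z + 2 * of_nat n * ?d2 z + exp (2 * z) * ?d1 z + 2 * exp (2 * z) * v z)) (at z)"
      by (simp add: eq)
    show "(R has_field_derivative - 2 * of_nat n * R z) (at z)"
      unfolding R_def by (auto intro!: derivative_eq_intros)
  qed
  define u where "u = (dzeta2 ^^ Suc n) lommel_S0"
  have u: "u = (\<lambda>z. exp (-2 * z) / 2 * ?d1 z)" by (auto simp: u_def v_def dzeta2_def)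
  define u1 where "u1 = (\<lambda>z. exp (-2 * z) / 2 * (?d2 z - 2 * ?d1 z))"
  define u2 where "u2 = (\<lambda>z. exp (-2 * z) / 2 * (?d3 z - 4 * ?d2 z + 4 * ?d1 z))"
  have du: "(u has_field_derivative u1 z) (at z)" for z
    unfolding u u1_def by (auto intro!: derivative_eq_intros d1 simp: field_simps)
  have du1: "(u1 has_field_derivative u2 z) (at z)" for z
    unfolding u1_def u2_def by (auto intro!: derivative_eq_intros d1 d2 simp: field_simps)
  have "deriv u = u1" using du by (intro ext DERIV_imp_deriv)
  moreover have "deriv u1 = u2" using du1 by (intro ext DERIV_imp_deriv)
  moreover have "u2 z + 2 * of_nat (Suc n) * u1 z + exp (2 * z) * u z = (-1)^Suc n * fact (Suc n) * exp (- 2 * of_nat (Suc n) * z)" for z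
  proof -
    have "u2 z + 2 * of_nat (Suc n) * u1 z + exp (2 * z) * u z
       = exp (-2 * z) / 2 * ((?d3 z + 2 * of_nat n * ?d2 z + exp (2 * z) * ?d1 z + 2 * exp (2 * z) * v z)
           - 2 * (?d2 z + 2 * of_nat n * ?d1 z + exp (2 * z) * v z))"
      unfolding u u1_def u2_def by (simp add: field_simps)
    also have "\<dots> = exp (-2 * z) / 2 * (- 2 * of_nat n * R z - 2 * R z)"
      unfolding eq eq' ..
    also have "\<dots> = - (of_nat (Suc n)) * ((-1)^n * fact n) * (exp (-2 * z) * exp (- 2 * of_nat n * z))"
      by (simp add: R_def algebra_simps)
    also have "exp (-2 * z) * exp (- 2 * of_nat n * z) = exp (- 2 * of_nat (Suc n) * z)"
      by (simp only: exp_add[symmetric]) (simp add: algebra_simps)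
    finally show ?thesis by (simp add: algebra_simps)
  qed
  moreover have "u holomorphic_on UNIV" using du by (auto simp: holomorphic_on_open)
  ultimately show ?case unfolding u_def[symmetric] by simp
qed

text \<open>The prefactor \<open>(-1)^n / fact n\<close> inverts the constant accumulated by the
  \<open>n\<close> differentiations.\<close>

lemma solves_lommel_base_neg:
  assumes "n > 0"
  shows "solves (- of_nat n) (lommel_base (- of_nat n)) (\<lambda>z. exp (- of_nat n * z))"
proof -
  define v where "v = (dzeta2 ^^ n) lommel_S0"
  define K :: complex where "K = (-1)^n / fact n"
  have hol: "v holomorphic_on UNIV" and eq: "deriv (deriv v) z + 2 * of_nat n * deriv v z + exp (2 * z) * v z
      = (-1)^n * fact n * exp (- 2 * of_nat n * z)" for z
    using dzeta2_funpow[of n] by (auto simp: v_def)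
  note d0 = holomorphic_derivI[OF hol open_UNIV UNIV_I]
  note d1 = holomorphic_derivI[OF holomorphic_deriv[OF hol open_UNIV] open_UNIV UNIV_I]
  have "\<lfloor>- real n\<rfloor> = - int n" by (simp add: floor_eq_iff)
  then have "nat (- \<lfloor>Re (- complex_of_nat n)\<rfloor>) = n" by simp
  then have base: "lommel_base (- of_nat n) = (\<lambda>z. K * exp (of_nat n * z) * v z)"
    using assms by (auto simp: lommel_base_def Let_def v_def K_def fun_eq_iff)
  show ?thesis unfolding base
  proof (rule solvesI)
    show "((\<lambda>z. K * exp (of_nat n * z) * v z) has_field_derivative
        K * exp (of_nat n * z) * (deriv v z + of_nat n * v z)) (at z)" for z
      by (auto intro!: derivative_eq_intros d0 simp: algebra_simps)
    show "((\<lambda>z. K * exp (of_nat n * z) * (deriv v z + of_nat n * v z)) has_field_derivative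
        K * exp (of_nat n * z) * (deriv (deriv v) z + 2 * of_nat n * deriv v z + (of_nat n)^2 * v z)) (at z)" for z
      by (auto intro!: derivative_eq_intros d0 d1 simp: algebra_simps power2_eq_square)
    fix z :: complex
    have "K * exp (of_nat n * z) * (deriv (deriv v) z + 2 * of_nat n * deriv v z + (of_nat n)^2 * v z)
        + (exp (2 * z) - (- of_nat n)^2) * (K * exp (of_nat n * z) * v z)
        = K * exp (of_nat n * z) * (deriv (deriv v) z + 2 * of_nat n * deriv v z + exp (2 * z) * v z)"
      by (simp add: algebra_simps)
    also have "\<dots> = (K * ((-1)^n * fact n)) * (exp (of_nat n * z) * exp (- 2 * of_nat n * z))"
      unfolding eq by (simp add: mult_ac)
    also have "exp (of_nat n * z) * exp (- 2 * of_nat n * z) = exp (- of_nat n * z)"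
      by (simp only: exp_add[symmetric]) (simp add: algebra_simps)
    also have "K * ((-1)^n * fact n) = 1" by (simp add: K_def power_mult_distrib[symmetric])
    finally show "K * exp (of_nat n * z) * (deriv (deriv v) z + 2 * of_nat n * deriv v z + (of_nat n)^2 * v z)
        + (exp (2 * z) - (- of_nat n)^2) * (K * exp (of_nat n * z) * v z) = exp (- of_nat n * z)" by simp
  qed
qed

lemma solves_lommel_base: "solves \<nu> (lommel_base \<nu>) (\<lambda>z. exp (\<nu> * z))"
proof (cases "\<exists>n::nat. \<nu> = - of_nat n")
  case False then show ?thesis by (intro solves_lommel_base_generic) auto
next
  case True
  then obtain n :: nat where n: "\<nu> = - of_nat n" by blast
  show ?thesis
  proof (cases "n = 0")
    case True
    have "lommel_base 0 = lommel_S0" by (auto simp: lommel_base_def)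
    then show ?thesis using solves_lommel_S0 n True by simp
  next
    case False then show ?thesis using solves_lommel_base_neg[of n] n by simp
  qed
qed

text \<open>The coefficients satisfy \<open>t m * (a m ^ 2 - \<nu>^2) = - t (m - 1)\<close>, so each
  exponential cancels against the one shifted up from the preceding term. The divisions behind this
  are legitimate because \<open>a m ^ 2 - \<nu>^2 = 4 (m - p) (\<nu> - p + m)\<close> and
  \<open>\<nu>\<close> is none of \<open>1, ..., p\<close>.\<close>

lemma lommel_ii_sum_telescope:
  fixes \<nu> z :: complex and p k :: nat
  defines "a \<equiv> \<lambda>m. \<nu> - 2 * of_nat p + 2 * of_nat m"
  defines "t \<equiv> \<lambda>m. (-1)^m / (2^(2*m+2) * pochhammer (- of_nat p) (m+1) * pochhammer (\<nu> - of_nat p) (m+1))"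
  assumes "\<nu> \<notin> of_nat ` {1..p}" "k < p"
  shows "(\<Sum>m\<le>k. t m * ((a m ^ 2 - \<nu>^2) * exp (a m * z) + exp ((a m + 2) * z)))
     = exp (a 0 * z) + t k * exp (a (Suc k) * z)"
  using assms(4)
proof (induction k)
  case 0
  have "complex_of_nat p \<noteq> 0" "\<nu> \<noteq> of_nat p" using 0 assms(3) by auto
  then have "t 0 * (a 0 ^ 2 - \<nu>^2) = 1"
    by (simp add: t_def a_def power2_eq_square divide_simps) (simp add: algebra_simps)
  moreover have "t 0 * ((a 0 ^ 2 - \<nu>^2) * w + y) = (t 0 * (a 0 ^ 2 - \<nu>^2)) * w + t 0 * y" for w y
    by (simp only: distrib_left mult.assoc)
  ultimately have "t 0 * ((a 0 ^ 2 - \<nu>^2) * w + y) = w + t 0 * y" for w y by simp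
  then show ?case by (simp add: a_def)
next
  case (Suc k)
  let ?m = "Suc k"
  have p: "- of_nat p + of_nat ?m \<noteq> (0::complex)"
  proof -
    have "complex_of_nat ?m \<noteq> of_nat p" using Suc.prems unfolding of_nat_eq_iff by simp
    then show ?thesis by (simp add: add_eq_0_iff del: of_nat_Suc)
  qed
  have n: "\<nu> - of_nat p + of_nat ?m \<noteq> 0"
  proof
    assume "\<nu> - of_nat p + of_nat ?m = 0"
    then have "\<nu> = of_nat (p - ?m)" using Suc.prems by (simp add: of_nat_diff algebra_simps)
    moreover have "p - ?m \<in> {1..p}" using Suc.prems by auto
    ultimately show False using assms(3) by blast
  qed
  have tS: "t ?m = - t k / (4 * (- of_nat p + of_nat ?m) * (\<nu> - of_nat p + of_nat ?m))"
    unfolding t_def by (simp add: pochhammer_Suc[of _ "Suc k"] field_simps del: of_nat_Suc)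
  have as: "a ?m ^ 2 - \<nu>^2 = 4 * (- of_nat p + of_nat ?m) * (\<nu> - of_nat p + of_nat ?m)"
    unfolding a_def by (simp add: power2_eq_square algebra_simps)
  have "u / (4 * P * Q) * (4 * P * Q) = u" if "P \<noteq> 0" "Q \<noteq> 0" for u P Q :: complex
    using that by simp
  from this[OF p n, of "- t k"] have "t ?m * (a ?m ^ 2 - \<nu>^2) = - t k" unfolding tS as .
  moreover have "t ?m * ((a ?m ^ 2 - \<nu>^2) * w + y) = (t ?m * (a ?m ^ 2 - \<nu>^2)) * w + t ?m * y" for w y
    by (simp only: distrib_left mult.assoc)
  ultimately have step: "t ?m * ((a ?m ^ 2 - \<nu>^2) * w + y) = - t k * w + t ?m * y" for w y by simp
  have "a (Suc ?m) = a ?m + 2" by (simp add: a_def)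
  then show ?case using Suc by (simp add: step del: of_nat_Suc)
qed

text \<open>For \<open>p > 0\<close> the finite sum leaves the remainder
  \<open>t (p - 1) * exp (\<nu> * z)\<close>; the factor \<open>c\<close> of the base function
  equals \<open>- t (p - 1)\<close> and removes it.\<close>

lemma solves_lommel_ii:
  assumes "\<nu> \<notin> of_nat ` {1..p}"
  shows "solves \<nu> (lommel_ii \<nu> p) (\<lambda>z. exp ((\<nu> - 2 * of_nat p) * z))"
proof -
  define a where "a = (\<lambda>m. \<nu> - 2 * of_nat p + 2 * of_nat m)"
  define t where "t = (\<lambda>m. (-1)^m / (2^(2*m+2) * pochhammer (- of_nat p) (m+1) * pochhammer (\<nu> - of_nat p) (m+1)))"
  define c where "c = (-1)^p / (2^(2*p) * fact p * pochhammer (1 - \<nu>) p)"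
  have ii: "lommel_ii \<nu> p = (\<lambda>z. (\<Sum>m<p. t m * exp (a m * z)) + c * lommel_base \<nu> z)"
    by (auto simp: lommel_ii_def t_def a_def c_def)
  have "solves \<nu> (lommel_ii \<nu> p)
    (\<lambda>z. (\<Sum>m<p. t m * ((a m ^ 2 - \<nu>^2) * exp (a m * z) + exp ((a m + 2) * z))) + c * exp (\<nu> * z))"
    unfolding ii by (intro solves_add solves_sum solves_cmult solves_exp solves_lommel_base) auto
  then show ?thesis
  proof (rule solves_cong)
    fix z
    show "(\<Sum>m<p. t m * ((a m ^ 2 - \<nu>^2) * exp (a m * z) + exp ((a m + 2) * z))) + c * exp (\<nu> * z)
        = exp ((\<nu> - 2 * of_nat p) * z)"
    proof (cases p)
      case 0 then show ?thesis by (simp add: c_def)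
    next
      case (Suc k)
      \<comment> \<open>Both Pochhammer symbols are reflected so that \<open>t k\<close> can be
        compared with \<open>c\<close>.\<close>
      have "pochhammer (- of_nat p) p = (-1)^p * (fact p :: complex)"
        by (simp add: pochhammer_same)
      moreover have "pochhammer (\<nu> - of_nat p) p = (-1)^p * pochhammer (1 - \<nu>) p"
        using pochhammer_minus[of "of_nat p - \<nu>" p] by (simp add: algebra_simps)
      moreover have "t k = (-1)^k / (2^(2*p) * pochhammer (- of_nat p) p * pochhammer (\<nu> - of_nat p) p)"
        by (simp add: t_def Suc)
      ultimately have "t k = (-1)^k / (2^(2*p) * ((-1)^p * fact p) * ((-1)^p * pochhammer (1 - \<nu>) p))"
        by (simp only:)
      also have "2^(2*p) * ((-1)^p * fact p) * ((-1)^p * pochhammer (1 - \<nu>) p)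
          = ((-1)^p * (-1)^p) * (2^(2*p) * fact p * pochhammer (1 - \<nu>) p)" by (simp only: mult_ac)
      also have "(-1)^p * (-1)^p = (1::complex)" by (simp add: power_mult_distrib[symmetric])
      also have "(-1)^k = - ((-1)^p :: complex)" by (simp add: Suc)
      finally have "t k = - c" by (simp add: c_def)
      moreover have "(\<Sum>m<p. t m * ((a m ^ 2 - \<nu>^2) * exp (a m * z) + exp ((a m + 2) * z)))
          = exp (a 0 * z) + t k * exp (a (Suc k) * z)"
        using lommel_ii_sum_telescope[OF assms, of k z] unfolding t_def a_def Suc lessThan_Suc_atMost by simp
      moreover have "a (Suc k) = \<nu>" "a 0 = \<nu> - 2 * of_nat p" by (simp_all add: a_def Suc)
      ultimately show ?thesis by simp
    qed
  qed simp
qed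

text \<open>If (ii) fails although \<open>\<mu> - \<nu> = - (2 q + 1)\<close>, then
  \<open>\<nu>\<close> is an integer \<open>n\<close> between 1 and \<open>q\<close>, and passing to
  \<open>- \<nu>\<close> gives the admissible index \<open>q - n\<close>. Hence the last branch of
  \<open>lommelS_e\<close> always has a well-defined \<open>p\<close>.\<close>

lemma lommelS_e_cases:
  obtains (generic) "\<not> odd_neg_int (\<mu> + \<nu>)" "\<not> odd_neg_int (\<mu> - \<nu>)" "lommelS_e \<mu> \<nu> = lommel_gen \<mu> \<nu>"
  | (ii) p where "\<mu> = \<nu> - 2 * of_nat p - 1" "\<nu> \<notin> of_nat ` {1..p}" "lommelS_e \<mu> \<nu> = lommel_ii \<nu> p"
  | (iii) p where "\<mu> = - \<nu> - 2 * of_nat p - 1" "- \<nu> \<notin> of_nat ` {1..p}" "lommelS_e \<mu> \<nu> = lommel_ii (-\<nu>) p"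
proof (cases "\<not> odd_neg_int (\<mu> + \<nu>) \<and> \<not> odd_neg_int (\<mu> - \<nu>)")
  case True
  then show ?thesis by (intro generic) (auto simp: lommelS_e_def)
next
  case odd: False
  show ?thesis
  proof (cases "case_ii \<mu> \<nu>")
    case True
    then obtain p :: nat where p: "\<mu> = \<nu> - 2 * of_nat p - 1" "\<nu> \<notin> of_nat ` {1..p}"
      by (auto simp: case_ii_def)
    have "(THE p::nat. \<mu> = \<nu> - 2 * of_nat p - 1) = p" using p(1) by (intro the_equality) auto
    then show ?thesis using True odd by (intro ii[OF p]) (auto simp: lommelS_e_def)
  next
    case False
    have "\<exists>p::nat. \<mu> = - \<nu> - 2 * of_nat p - 1 \<and> - \<nu> \<notin> of_nat ` {1..p}"
    proof (cases "odd_neg_int (\<mu> - \<nu>)")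
      case True
      then obtain q :: nat where q: "\<mu> - \<nu> = - (2 * of_nat q + 1)" by (auto simp: odd_neg_int_def)
      then have mq: "\<mu> = \<nu> - 2 * of_nat q - 1" by (simp add: algebra_simps)
      then obtain n :: nat where n: "\<nu> = of_nat n" "1 \<le> n" "n \<le> q" using False by (auto simp: case_ii_def)
      have "- \<nu> \<notin> of_nat ` {1..q - n}"
      proof
        assume "- \<nu> \<in> of_nat ` {1..q - n}"
        then obtain j :: nat where "- complex_of_nat n = of_nat j" "j \<ge> 1" by (auto simp: n)
        then have "complex_of_nat (n + j) = 0" by (simp add: neg_eq_iff_add_eq_0)
        then show False using n by (simp only: of_nat_eq_0_iff)
      qed
      moreover have "\<mu> = - \<nu> - 2 * of_nat (q - n) - 1" using mq n by (simp add: of_nat_diff)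
      ultimately show ?thesis by blast
    next
      case noodd: False
      then obtain q :: nat where q: "\<mu> + \<nu> = - (2 * of_nat q + 1)" using odd by (auto simp: odd_neg_int_def)
      have "\<mu> = (\<mu> + \<nu>) - \<nu>" by simp
      then have mq: "\<mu> = - \<nu> - 2 * of_nat q - 1" unfolding q by simp
      have "- \<nu> \<notin> of_nat ` {1..q}"
      proof
        assume "- \<nu> \<in> of_nat ` {1..q}"
        then obtain n :: nat where n: "- \<nu> = of_nat n" "n \<le> q" by auto
        then have "\<nu> = - of_nat n" by (metis minus_minus)
        then have "\<mu> - \<nu> = - (2 * of_nat (q - n) + 1)" using mq n(2) by (simp add: of_nat_diff)
        then show False using noodd by (auto simp: odd_neg_int_def)
      qed
      then show ?thesis using mq by blast
    qed
    then obtain p :: nat where p: "\<mu> = - \<nu> - 2 * of_nat p - 1" "- \<nu> \<notin> of_nat ` {1..p}" by blast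
    have "(THE p::nat. \<mu> = - \<nu> - 2 * of_nat p - 1) = p" using p(1) by (intro the_equality) auto
    then show ?thesis using False odd by (intro iii[OF p]) (auto simp: lommelS_e_def)
  qed
qed

lemma solves_lommelS: "solves \<nu> (lommelS_e \<mu> \<nu>) (\<lambda>z. exp ((\<mu> + 1) * z))"
proof (cases rule: lommelS_e_cases[of \<mu> \<nu>])
  case generic then show ?thesis using solves_lommel_gen by simp
next
  case (ii p) then show ?thesis using solves_lommel_ii[of \<nu> p] by simp
next
  case (iii p)
  then show ?thesis using solves_lommel_ii[of "-\<nu>" p] by (simp add: solves_minus_order)
qed

section \<open>Growth and quasi-periodicity\<close>

text \<open>The rate \<open>1/4\<close> is an arbitrary value below \<open>1\<close>; nonzero Bessel functions reach the rate \<open>1\<close>.\<close>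

definition small_growth :: "(complex \<Rightarrow> complex) \<Rightarrow> bool" where
  "small_growth f \<longleftrightarrow> (\<exists>C\<ge>0. \<forall>z. cmod (f z) \<le> exp (C * exp (cmod z / 4)))"

text \<open>Since \<open>exp (cmod z / 4) \<ge> 1\<close>, constant factors can be moved into the
  exponent.\<close>

lemma small_growth_lincomb:
  assumes "small_growth f" "small_growth g"
  shows "small_growth (\<lambda>z. a * f z + b * g z)"
proof -
  obtain C where C: "C \<ge> 0" "\<And>z. cmod (f z) \<le> exp (C * exp (cmod z / 4))"
    using assms(1) by (auto simp: small_growth_def)
  obtain D where D: "D \<ge> 0" "\<And>z. cmod (g z) \<le> exp (D * exp (cmod z / 4))"
    using assms(2) by (auto simp: small_growth_def)
  define M where "M = C + D"
  define s where "s = cmod a + cmod b"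
  have "cmod (a * f z + b * g z) \<le> exp ((s + M) * exp (cmod z / 4))" for z
  proof -
    define e where "e = exp (cmod z / 4)"
    have e: "e \<ge> 1" by (simp add: e_def)
    have "cmod (f z) \<le> exp (M * e)" "cmod (g z) \<le> exp (M * e)"
      using C(2)[of z] D(2)[of z] C(1) D(1) e
      by (auto simp: M_def e_def[symmetric] distrib_right intro: order_trans)
    then have "cmod a * cmod (f z) + cmod b * cmod (g z) \<le> cmod a * exp (M * e) + cmod b * exp (M * e)"
      by (intro add_mono mult_left_mono) auto
    moreover have "cmod (a * f z + b * g z) \<le> cmod a * cmod (f z) + cmod b * cmod (g z)"
      using norm_triangle_ineq[of "a * f z" "b * g z"] by (simp add: norm_mult)
    moreover have "s \<le> exp (s * e)"
    proof -
      have "s * 1 \<le> s * e" using e by (intro mult_left_mono) (auto simp: s_def)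
      then show ?thesis using exp_ge_add_one_self[of "s * e"] by linarith
    qed
    then have "s * exp (M * e) \<le> exp (s * e) * exp (M * e)" by (intro mult_right_mono) auto
    ultimately show ?thesis by (simp add: e_def[symmetric] s_def distrib_right exp_add)
  qed
  moreover have "s + M \<ge> 0" using C(1) D(1) by (simp add: s_def M_def)
  ultimately show ?thesis unfolding small_growth_def by blast
qed

lemma small_growth_shift:
  assumes "small_growth f"
  shows "small_growth (\<lambda>z. f (z + c))"
proof -
  obtain C where C: "C \<ge> 0" "\<And>z. cmod (f z) \<le> exp (C * exp (cmod z / 4))"
    using assms by (auto simp: small_growth_def)
  have "cmod (f (z + c)) \<le> exp ((C * exp (cmod c / 4)) * exp (cmod z / 4))" for z
  proof -
    have "exp (cmod (z + c) / 4) \<le> exp (cmod c / 4 + cmod z / 4)"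
      using norm_triangle_ineq[of z c] by simp
    then have "C * exp (cmod (z + c) / 4) \<le> C * (exp (cmod c / 4) * exp (cmod z / 4))"
      using C(1) by (intro mult_left_mono) (auto simp: exp_add)
    then show ?thesis using C(2)[of "z + c"] by (simp add: mult.assoc) (use order_trans exp_le_cancel_iff in blast)
  qed
  then show ?thesis unfolding small_growth_def using C(1) by (intro exI[of _ "C * exp (cmod c / 4)"]) auto
qed

lemma small_growth_exp: "small_growth (\<lambda>z. exp (a * z))"
proof -
  have "cmod (exp (a * z)) \<le> exp (4 * cmod a * exp (cmod z / 4))" for z
  proof -
    have "cmod z \<le> 4 * exp (cmod z / 4)" using exp_ge_add_one_self[of "cmod z / 4"] by linarith
    then have "cmod a * cmod z \<le> cmod a * (4 * exp (cmod z / 4))" by (intro mult_left_mono) auto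
    then show ?thesis using norm_exp[of "a * z"]
      by (simp add: norm_mult mult_ac)
  qed
  then show ?thesis unfolding small_growth_def by (intro exI[of _ "4 * cmod a"]) auto
qed

lemma small_growth_exp_sum:
  assumes "finite A"
  shows "small_growth (\<lambda>z. \<Sum>i\<in>A. b i * exp (a i * z))"
  using assms
proof (induction A rule: finite_induct)
  case empty
  show ?case by (auto simp: small_growth_def intro!: exI[of _ 0])
next
  case (insert i A)
  then show ?case using small_growth_lincomb[OF small_growth_exp[of "a i"] insert.IH, of "b i" 1] by simp
qed

text \<open>Gronwall along horizontal lines to the left, where the coefficient
  \<open>exp (2 * z) - \<nu>^2\<close> is bounded. The strip contains all values
  \<open>Ln w / 2\<close>, which is where the bound will be used.\<close>

lemma solves_backward_growth:
  assumes "solves \<nu> f (\<lambda>z. c * exp (\<beta> * z))"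
  shows "\<exists>K\<ge>0. \<forall>z. Re z \<le> 0 \<longrightarrow> \<bar>Im z\<bar> \<le> pi \<longrightarrow> cmod (f z) \<le> K * exp (- K * Re z)"
proof -
  obtain f1 f2 where df: "\<And>z. (f has_field_derivative f1 z) (at z)"
    and df1: "\<And>z. (f1 has_field_derivative f2 z) (at z)"
    and f2: "\<And>z. f2 z = c * exp (\<beta> * z) - (exp (2 * z) - \<nu>^2) * f z"
    using assms by (rule solvesE) blast
  define b where "b = cmod \<beta>"
  \<comment> \<open>\<open>N * exp (- b * x)\<close> bounds the inhomogeneity on the strip, and
    \<open>k\<close> collects the constants of all terms in the estimate of
    \<open>- H'\<close>.\<close>
  define N where "N = cmod c * exp (b * pi)"
  define k where "k = 2 + N + (cmod \<nu>)^2 + 2 * b"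
  have pos: "b \<ge> 0" "N \<ge> 0" "k \<ge> 0" by (auto simp: b_def N_def k_def)
  \<comment> \<open>The last summand absorbs the inhomogeneity, so that \<open>H\<close> satisfies a
    homogeneous differential inequality.\<close>
  define H where "H = (\<lambda>x y. (cmod (f (Complex x y)))^2 + (cmod (f1 (Complex x y)))^2 + exp (- 2 * b * x))"
  have mono: "H x y * exp (k * x) \<le> H 0 y" if x: "x \<le> 0" and y: "\<bar>y\<bar> \<le> pi" for x y
  proof -
    have d: "((\<lambda>t. g (Complex t y)) has_vector_derivative g' (Complex t y)) (at t)"
      if g: "\<And>z. (g has_field_derivative g' z) (at z)" for g g' t
    proof -
      have "((\<lambda>t. Complex t y) has_vector_derivative 1) (at t)"
        unfolding Complex_eq by (auto intro!: derivative_eq_intros)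
      then show ?thesis
        using field_vector_diff_chain_at[of "\<lambda>t. Complex t y" 1 t g "g' (Complex t y)"] g by (simp add: o_def)
    qed
    define H' where "H' = (\<lambda>t. 2 * (Re (f (Complex t y)) * Re (f1 (Complex t y)) + Im (f (Complex t y)) * Im (f1 (Complex t y)))
      + 2 * (Re (f1 (Complex t y)) * Re (f2 (Complex t y)) + Im (f1 (Complex t y)) * Im (f2 (Complex t y)))
      - 2 * b * exp (- 2 * b * t))"
    have dH: "((\<lambda>t. H t y) has_real_derivative H' t) (at t)" for t
      unfolding H_def H'_def cmod_power2
      by (auto intro!: derivative_eq_intros d[OF df] d[OF df1] simp: algebra_simps)
    \<comment> \<open>Equivalently, \<open>H t y * exp (k * t)\<close> has nonnegative derivative in
      \<open>t\<close>.\<close>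
    have lower: "H' t + k * H t y \<ge> 0" if t: "t \<le> 0" for t
    proof -
      define z where "z = Complex t y"
      define E where "E = exp (- b * t)"
      have E2: "exp (- 2 * b * t) = E^2" by (simp add: E_def exp_double[symmetric] mult_ac)
      have ip: "\<bar>Re u * Re v + Im u * Im v\<bar> \<le> cmod u * cmod v" for u v
      proof -
        have "Re u * Re v + Im u * Im v = Re (u * cnj v)" by simp
        then show ?thesis using abs_Re_le_cmod[of "u * cnj v"] by (simp add: norm_mult)
      qed
      have "Re (\<beta> * z) \<le> - b * t + b * pi"
      proof -
        have "Re \<beta> * t \<le> b * (- t)"
          using mult_right_mono[of "- Re \<beta>" b "- t"] abs_Re_le_cmod[of \<beta>] t by (simp add: b_def)
        moreover have "- (Im \<beta> * y) \<le> \<bar>Im \<beta>\<bar> * \<bar>y\<bar>" by (simp add: abs_mult[symmetric] abs_le_D2 abs_ge_minus_self)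
        moreover have "\<bar>Im \<beta>\<bar> * \<bar>y\<bar> \<le> b * pi" using y abs_Im_le_cmod[of \<beta>] by (intro mult_mono) (auto simp: b_def)
        ultimately show ?thesis by (simp add: z_def)
      qed
      then have e: "cmod (exp (\<beta> * z)) \<le> exp (- b * t) * exp (b * pi)" by (simp add: exp_add[symmetric])
      have "cmod (c * exp (\<beta> * z)) \<le> N * E"
        unfolding norm_mult N_def E_def using mult_left_mono[OF e norm_ge_zero[of c]] by (simp only: mult_ac)
      moreover have "cmod (exp (2 * z) - \<nu>^2) \<le> 1 + (cmod \<nu>)^2"
      proof -
        have "cmod (exp (2 * z)) \<le> 1" using t by (simp add: z_def)
        then show ?thesis using norm_triangle_ineq4[of "exp (2 * z)" "\<nu>^2"] norm_power[of \<nu> 2] by linarith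
      qed
      then have "cmod ((exp (2 * z) - \<nu>^2) * f z) \<le> (1 + (cmod \<nu>)^2) * cmod (f z)"
        unfolding norm_mult by (rule mult_right_mono) simp
      ultimately have "cmod (f2 z) \<le> N * E + (1 + (cmod \<nu>)^2) * cmod (f z)"
        unfolding f2 using norm_triangle_ineq4[of "c * exp (\<beta> * z)" "(exp (2 * z) - \<nu>^2) * f z"] by linarith
      then have "2 * (cmod (f1 z) * cmod (f2 z)) \<le> 2 * (cmod (f1 z) * (N * E + (1 + (cmod \<nu>)^2) * cmod (f z)))"
        by (intro mult_left_mono) auto
      also have "\<dots> = N * (2 * cmod (f1 z) * E) + (1 + (cmod \<nu>)^2) * (2 * cmod (f z) * cmod (f1 z))"
        by (simp add: algebra_simps)
      also have "\<dots> \<le> N * ((cmod (f1 z))^2 + E^2) + (1 + (cmod \<nu>)^2) * ((cmod (f z))^2 + (cmod (f1 z))^2)"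
        using pos by (intro add_mono mult_left_mono sum_squares_bound) auto
      finally have 1: "2 * (cmod (f1 z) * cmod (f2 z)) \<le> \<dots>" .
      have 2: "2 * cmod (f z) * cmod (f1 z) \<le> (cmod (f z))^2 + (cmod (f1 z))^2" by (rule sum_squares_bound)
      have "- H' t \<le> 2 * (cmod (f z) * cmod (f1 z)) + 2 * (cmod (f1 z) * cmod (f2 z)) + 2 * b * E^2"
      proof -
        have "- (2 * p + 2 * q - r) \<le> 2 * P + 2 * Q + r" if "\<bar>p\<bar> \<le> P" "\<bar>q\<bar> \<le> Q" for p q r P Q :: real
          using that by linarith
        from this[OF ip[of "f z" "f1 z"] ip[of "f1 z" "f2 z"]] show ?thesis
          unfolding H'_def z_def[symmetric] E2 .
      qed
      also have "\<dots> \<le> (cmod (f z))^2 + (cmod (f1 z))^2 + (N * ((cmod (f1 z))^2 + E^2)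
          + (1 + (cmod \<nu>)^2) * ((cmod (f z))^2 + (cmod (f1 z))^2)) + 2 * b * E^2"
        using 1 2 by linarith
      also have "\<dots> \<le> k * ((cmod (f z))^2 + (cmod (f1 z))^2 + E^2)"
      proof -
        have "k * ((cmod (f z))^2 + (cmod (f1 z))^2 + E^2) - ((cmod (f z))^2 + (cmod (f1 z))^2 + (N * ((cmod (f1 z))^2 + E^2)
          + (1 + (cmod \<nu>)^2) * ((cmod (f z))^2 + (cmod (f1 z))^2)) + 2 * b * E^2)
          = N * (cmod (f z))^2 + 2 * b * ((cmod (f z))^2 + (cmod (f1 z))^2) + (2 + (cmod \<nu>)^2) * E^2"
          by (simp add: k_def algebra_simps)
        moreover have "\<dots> \<ge> 0" using pos by simp
        ultimately show ?thesis by linarith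
      qed
      finally show ?thesis unfolding H_def z_def[symmetric] E2 by linarith
    qed
    have "H x y * exp (k * x) \<le> H 0 y * exp (k * 0)"
    proof (rule DERIV_nonneg_imp_nondecreasing[OF x])
      fix t :: real assume "x \<le> t" "t \<le> 0"
      have "((\<lambda>t. H t y * exp (k * t)) has_real_derivative (H' t + k * H t y) * exp (k * t)) (at t)"
        by (auto intro!: derivative_eq_intros dH simp: algebra_simps)
      moreover have "(H' t + k * H t y) * exp (k * t) \<ge> 0" using lower[OF \<open>t \<le> 0\<close>] by simp
      ultimately show "\<exists>d. ((\<lambda>t. H t y * exp (k * t)) has_real_derivative d) (at t) \<and> 0 \<le> d" by blast
    qed
    then show ?thesis by simp
  qed
  have cont: "continuous_on UNIV f" "continuous_on UNIV f1"
    using df df1 by (auto intro!: continuous_at_imp_continuous_on DERIV_isCont)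
  have "continuous_on {-pi..pi} (\<lambda>y. H 0 y)"
    unfolding H_def Complex_eq
    by (intro continuous_intros continuous_on_compose2[OF cont(1)] continuous_on_compose2[OF cont(2)]) auto
  then have "bounded ((\<lambda>y. H 0 y) ` {-pi..pi})" by (intro compact_imp_bounded compact_continuous_image) auto
  then obtain M where "\<forall>y\<in>{-pi..pi}. \<bar>H 0 y\<bar> \<le> M" by (auto simp: bounded_iff)
  then have M: "\<bar>H 0 y\<bar> \<le> M" if "y \<in> {-pi..pi}" for y using that by blast
  have M0: "M \<ge> 0" using M[of 0] by (auto intro: order_trans[OF abs_ge_zero])
  \<comment> \<open>One constant large enough to serve both as factor and as rate.\<close>
  define K where "K = 1 + M + k"
  have "cmod (f z) \<le> K * exp (- K * Re z)" if z: "Re z \<le> 0" "\<bar>Im z\<bar> \<le> pi" for z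
  proof -
    have "H (Re z) (Im z) * exp (k * Re z) \<le> M"
      using mono[OF z] M[of "Im z"] z(2) by (auto simp: abs_le_iff)
    then have "H (Re z) (Im z) \<le> M * exp (- k * Re z)" by (simp add: exp_minus field_simps)
    then have "(cmod (f z))^2 \<le> M * exp (- k * Re z)"
      unfolding H_def complex_surj using zero_le_power2[of "cmod (f1 z)"] exp_gt_zero[of "- 2 * b * Re z"] by linarith
    moreover have "cmod (f z) \<le> 1 + (cmod (f z))^2"
      using sum_squares_bound[of "cmod (f z)" 1] norm_ge_zero[of "f z"] unfolding mult_1_right one_power2 by linarith
    moreover have "1 \<le> exp (- k * Re z)" using z(1) pos by (simp add: mult_nonneg_nonpos)
    ultimately have "cmod (f z) \<le> (1 + M) * exp (- k * Re z)"
      unfolding distrib_right mult_1_left by linarith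
    also have "\<dots> \<le> K * exp (- K * Re z)"
    proof (rule mult_mono)
      show "exp (- k * Re z) \<le> exp (- K * Re z)"
        using mult_right_mono[of k K "- Re z"] z(1) M0 by (simp add: K_def algebra_simps)
    qed (use pos M0 in \<open>auto simp: K_def\<close>)
    finally show ?thesis .
  qed
  then show ?thesis using M0 pos by (intro exI[of _ K]) (auto simp: K_def)
qed

text \<open>A function of period \<open>\<i> * pi\<close> factors through
  \<open>w = exp (2 * z)\<close> on the punctured plane. The bound makes the singularity at
  \<open>w = 0\<close> removable, and the extension is entire.\<close>

lemma periodic_eq_exp_series:
  assumes h: "h holomorphic_on UNIV" and per: "\<And>z. h (z + \<i> * pi) = h z"
    and bd: "\<And>z. Re z \<le> 0 \<Longrightarrow> \<bar>Im z\<bar> \<le> pi \<Longrightarrow> cmod (h z) \<le> B"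
  obtains F where "fps_conv_radius F = \<infinity>" "h = exp_series 0 F"
proof -
  have per_nat: "h (z + of_nat n * (\<i> * pi)) = h z" for n z
  proof (induction n)
    case (Suc n)
    then show ?case using per[of "z + of_nat n * (\<i> * pi)"] by (simp add: algebra_simps)
  qed simp
  have per_int: "h (z + of_int k * (\<i> * pi)) = h z" for k z
  proof (cases "k \<ge> 0")
    case True then show ?thesis using per_nat[of z "nat k"] by simp
  next
    case False
    then have "of_int k = - complex_of_nat (nat (-k))" by simp
    then show ?thesis using per_nat[of "z + of_int k * (\<i> * pi)" "nat (-k)"] by (simp add: algebra_simps)
  qed
  have exp_eq: "h u = h v" if "exp (2 * u) = exp (2 * v)" for u v
  proof -
    obtain n :: int where "2 * u = 2 * v + of_int (2 * n) * complex_of_real pi * \<i>"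
      using \<open>exp (2 * u) = exp (2 * v)\<close> unfolding exp_eq by auto
    then have "2 * u = 2 * (v + of_int n * (\<i> * pi))" by (simp add: algebra_simps)
    then have "u = v + of_int n * (\<i> * pi)" by (simp only: mult_cancel_left) simp
    then show ?thesis by (simp add: per_int)
  qed
  define H where "H = (\<lambda>w. h (Ln w / 2))"
  have H: "H (exp (2 * z)) = h z" for z unfolding H_def by (rule exp_eq) simp
  \<comment> \<open>\<open>Ln\<close> jumps across the negative real axis; on the reflected slit
    plane the logarithm \<open>Ln (- w) + \<i> * pi\<close> is used instead, and by periodicity
    \<open>h\<close> does not see the difference.\<close>
  have "H holomorphic_on ((- \<real>\<^sub>\<le>\<^sub>0) \<union> (uminus ` (- \<real>\<^sub>\<le>\<^sub>0)))"
  proof (rule holomorphic_on_Un)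
    show "H holomorphic_on (- \<real>\<^sub>\<le>\<^sub>0)" unfolding H_def
      by (rule holomorphic_on_compose_gen[OF _ h, unfolded o_def]) (auto intro!: holomorphic_intros)
    have "(\<lambda>w. h ((Ln (- w) + \<i> * pi) / 2)) holomorphic_on (uminus ` (- \<real>\<^sub>\<le>\<^sub>0))"
      by (rule holomorphic_on_compose_gen[OF _ h, unfolded o_def]) (auto intro!: holomorphic_intros)
    moreover have "h ((Ln (- w) + \<i> * pi) / 2) = H w" if "w \<in> uminus ` (- \<real>\<^sub>\<le>\<^sub>0)" for w
    proof -
      have "w \<noteq> 0" using that by auto
      moreover have "2 * (x / 2) = x" for x :: complex by simp
      ultimately have "exp (2 * ((Ln (- w) + \<i> * pi) / 2)) = w" by (simp only: exp_add) simp
      then show ?thesis using H[of "(Ln (- w) + \<i> * pi) / 2"] by simp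
    qed
    ultimately show "H holomorphic_on (uminus ` (- \<real>\<^sub>\<le>\<^sub>0))" by (rule holomorphic_transform)
    show "open (- (\<real>\<^sub>\<le>\<^sub>0 :: complex set))" by (simp add: closed_nonpos_Reals_complex open_Compl)
    then show "open (uminus ` (- (\<real>\<^sub>\<le>\<^sub>0 :: complex set)))" by (rule open_negations)
  qed
  moreover have "UNIV - {0} \<subseteq> (- \<real>\<^sub>\<le>\<^sub>0) \<union> (uminus ` (- (\<real>\<^sub>\<le>\<^sub>0 :: complex set)))"
  proof
    fix w :: complex assume w: "w \<in> UNIV - {0}"
    show "w \<in> (- \<real>\<^sub>\<le>\<^sub>0) \<union> (uminus ` (- (\<real>\<^sub>\<le>\<^sub>0 :: complex set)))"
    proof (cases "w \<in> \<real>\<^sub>\<le>\<^sub>0")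
      case True
      then have "- w \<in> - \<real>\<^sub>\<le>\<^sub>0" using w by (auto simp: complex_nonpos_Reals_iff complex_eq_iff)
      then show ?thesis by (intro UnI2 image_eqI[of _ _ "- w"]) simp_all
    qed simp
  qed
  ultimately have "H holomorphic_on UNIV - {0}" by (rule holomorphic_on_subset)
  moreover have "\<forall>\<^sub>F w in at 0. cmod (H w) \<le> B"
    unfolding eventually_at
  proof (intro exI[of _ 1] conjI ballI impI)
    fix w :: complex assume "w \<noteq> 0 \<and> dist w 0 < 1"
    then have w: "w \<noteq> 0" "cmod w < 1" by auto
    show "cmod (H w) \<le> B" unfolding H_def
    proof (rule bd)
      show "Re (Ln w / 2) \<le> 0" using w by simp
      show "\<bar>Im (Ln w / 2)\<bar> \<le> pi" using mpi_less_Im_Ln[OF w(1)] Im_Ln_le_pi[OF w(1)] by simp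
    qed
  qed simp
  ultimately obtain P where P: "P holomorphic_on UNIV" "\<And>w. w \<noteq> 0 \<Longrightarrow> P w = H w"
    using holomorphic_on_extend_bounded[of H UNIV 0] by auto
  define F where "F = fps_expansion P 0"
  have PF: "P has_fps_expansion F"
    unfolding F_def by (rule has_fps_expansion_fps_expansion[of UNIV]) (use P in auto)
  have "fps_conv_radius F \<ge> \<infinity>"
    by (rule holomorphic_on_imp_fps_conv_radius_ge[OF PF]) (use P in simp)
  then have 1: "fps_conv_radius F = \<infinity>" by simp
  have "eval_fps F w = P w" for w
    by (rule has_fps_expansion_imp_eval_fps_eq[OF PF, of _ "cmod w + 1"]) (use P in \<open>auto intro: holomorphic_on_subset\<close>)
  then have "h = exp_series 0 F" using P(2) H by (auto simp: exp_series_def fun_eq_iff)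
  with 1 show ?thesis by (rule that)
qed

lemma quasi_periodic_solution_exp_series:
  assumes sol: "solves \<nu> f (\<lambda>z. c * exp (\<beta> * z))"
    and per: "\<And>z. f (z + \<i> * pi) = exp (\<beta> * (\<i> * pi)) * f z"
  obtains N F where "N \<ge> 1" "fps_conv_radius F = \<infinity>" "f = exp_series (\<beta> - 2 * of_nat N) F"
proof -
  obtain K where K: "K \<ge> 0" "\<And>z. Re z \<le> 0 \<Longrightarrow> \<bar>Im z\<bar> \<le> pi \<Longrightarrow> cmod (f z) \<le> K * exp (- K * Re z)"
    using solves_backward_growth[OF sol] by blast
  \<comment> \<open>Lowering the exponent by an even number keeps the translation factor, and
    lowering it far enough makes \<open>h\<close> bounded to the left. The \<open>+ 1\<close>
    guarantees \<open>N \<ge> 1\<close>.\<close>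
  define N where "N = nat \<lceil>K + cmod \<beta>\<rceil> + 1"
  define \<alpha> where "\<alpha> = \<beta> - 2 * of_nat N"
  define h where "h = (\<lambda>z. exp (- \<alpha> * z) * f z)"
  have N: "real N \<ge> K + cmod \<beta>" unfolding N_def by linarith
  have "h holomorphic_on UNIV"
    unfolding h_def by (intro holomorphic_intros solves_holomorphic[OF sol])
  moreover have "h (z + \<i> * pi) = h z" for z
  proof -
    have e: "exp (2 * of_nat N * (\<i> * pi)) = 1"
      using exp_integer_2pi[of "of_nat N"] by (simp add: mult_ac)
    have "h (z + \<i> * pi) = exp (- \<alpha> * z) * (exp (- \<alpha> * (\<i> * pi)) * exp (\<beta> * (\<i> * pi))) * f z"
      unfolding h_def per distrib_left exp_add by (simp only: mult_ac)
    also have "exp (- \<alpha> * (\<i> * pi)) * exp (\<beta> * (\<i> * pi)) = exp (2 * of_nat N * (\<i> * pi))"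
      by (simp only: exp_add[symmetric]) (simp add: \<alpha>_def algebra_simps)
    finally show ?thesis unfolding e h_def by simp
  qed
  moreover have "cmod (h z) \<le> K * exp (cmod \<beta> * pi)" if z: "Re z \<le> 0" "\<bar>Im z\<bar> \<le> pi" for z
  proof -
    have "- (Re \<beta> * Re z) \<le> cmod \<beta> * (- Re z)"
      using mult_right_mono[of "Re \<beta>" "cmod \<beta>" "- Re z"] complex_Re_le_cmod[of \<beta>] z by simp
    moreover have "Im \<beta> * Im z \<le> \<bar>Im \<beta>\<bar> * \<bar>Im z\<bar>" by (simp add: abs_mult[symmetric])
    moreover have "\<bar>Im \<beta>\<bar> * \<bar>Im z\<bar> \<le> cmod \<beta> * pi"
      using z abs_Im_le_cmod[of \<beta>] by (intro mult_mono) auto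
    moreover have "Re (- \<alpha> * z) = 2 * real N * Re z - Re \<beta> * Re z + Im \<beta> * Im z"
      by (simp add: \<alpha>_def algebra_simps)
    ultimately have "Re (- \<alpha> * z) \<le> 2 * real N * Re z + cmod \<beta> * (- Re z) + cmod \<beta> * pi" by linarith
    moreover have "(K + cmod \<beta>) * (- Re z) \<le> 2 * real N * (- Re z)"
      using z N K by (intro mult_right_mono) auto
    ultimately have "Re (- \<alpha> * z) \<le> cmod \<beta> * pi + K * Re z" by (simp add: algebra_simps)
    then have "cmod (exp (- \<alpha> * z)) \<le> exp (cmod \<beta> * pi) * exp (K * Re z)"
      by (simp add: exp_add[symmetric] del: times_complex.sel)
    then have "cmod (h z) \<le> (exp (cmod \<beta> * pi) * exp (K * Re z)) * (K * exp (- K * Re z))"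
      unfolding h_def norm_mult using K(2)[OF z] by (intro mult_mono) auto
    also have "\<dots> = K * exp (cmod \<beta> * pi)" by (simp add: exp_minus)
    finally show ?thesis .
  qed
  ultimately obtain F where F: "fps_conv_radius F = \<infinity>" "h = exp_series 0 F"
    by (rule periodic_eq_exp_series)
  have "f z = exp (\<alpha> * z) * h z" for z
    unfolding h_def mult.assoc[symmetric] exp_add[symmetric] by simp
  then have "f = exp_series \<alpha> F" using F(2) by (simp add: exp_series_def fun_eq_iff)
  with F(1) show ?thesis by (intro that[of N F]) (auto simp: N_def \<alpha>_def)
qed

text \<open>Cauchy's estimate for \<open>eval_fps F\<close> on the circle of radius
  \<open>j^4\<close>. With \<open>w = exp (2 * z)\<close> on that circle,
  \<open>cmod z \<le> 2 ln j + 2\<close> and hence \<open>exp (cmod z / 4) \<le> 2 j\<close>, so the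
  maximum is only \<open>D ^ j\<close>.\<close>

lemma small_growth_exp_series_coeff:
  assumes F: "fps_conv_radius F = \<infinity>" and gr: "small_growth (exp_series \<alpha> F)"
  shows "\<exists>D>0. \<forall>j\<ge>1. cmod (fps_nth F j) \<le> D ^ j / real j ^ (4 * j)"
proof -
  obtain C where C: "C \<ge> 0" "\<And>z. cmod (exp_series \<alpha> F z) \<le> exp (C * exp (cmod z / 4))"
    using gr by (auto simp: small_growth_def)
  \<comment> \<open>The growth bound contributes \<open>2 * C\<close>, the factor
    \<open>exp (- \<alpha> * z)\<close> contributes \<open>4 * cmod \<alpha>\<close>.\<close>
  define D where "D = exp (2 * C + 4 * cmod \<alpha>)"
  have "cmod (fps_nth F j) \<le> D ^ j / real j ^ (4 * j)" if j: "j \<ge> 1" for j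
  proof -
    \<comment> \<open>A power of \<open>j\<close> above 2 beats the lower bound of size
      \<open>1 / (j!)^2\<close> from the recurrence; powers up to 8 are compatible with the rate
      1/4.\<close>
    define R where "R = real j ^ 4"
    have R: "R \<ge> 1" using j by (simp add: R_def)
    have hol: "eval_fps F holomorphic_on UNIV" by (intro holomorphic_intros) (simp add: F)
    have lnj: "ln (real j) \<ge> 0" "ln (real j) \<le> real j - 1" using j ln_le_minus_one[of "real j"] by auto
    have "cmod ((deriv ^^ j) (eval_fps F) 0) \<le> fact j * (D ^ j) / R ^ j"
    proof (rule Cauchy_inequality)
      show "eval_fps F holomorphic_on ball 0 R" using hol by (rule holomorphic_on_subset) simp
      show "continuous_on (cball 0 R) (eval_fps F)"
        using hol by (intro holomorphic_on_imp_continuous_on) (rule holomorphic_on_subset, auto)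
      show "0 < R" using R by simp
      fix w assume "cmod (0 - w) = R"
      then have w: "cmod w = R" "w \<noteq> 0" using R by auto
      define z where "z = Ln w / 2"
      have ez: "exp (2 * z) = w" using w by (simp add: z_def)
      have "Re z = 2 * ln (real j)"
        using w j by (simp add: z_def R_def ln_realpow)
      moreover have "\<bar>Im z\<bar> \<le> 2"
        using mpi_less_Im_Ln[OF w(2)] Im_Ln_le_pi[OF w(2)] pi_less_4 by (simp add: z_def abs_le_iff)
      ultimately have nz: "cmod z \<le> 2 * ln (real j) + 2"
        using cmod_le[of z] lnj by simp
      have "exp (cmod z / 4) \<le> exp (ln (real j) / 2 + 1 / 2)" using nz by simp
      also have "\<dots> \<le> exp (ln (real j) + ln 2)"
        using lnj ln2_ge_two_thirds by simp
      also have "\<dots> = 2 * real j" using j by (simp add: exp_add)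
      finally have 1: "C * exp (cmod z / 4) \<le> C * (2 * real j)" using C(1) by (intro mult_left_mono)
      have "cmod z \<le> 4 * real j" using nz lnj by linarith
      then have 2: "cmod (- \<alpha> * z) \<le> cmod \<alpha> * (4 * real j)"
        by (simp add: norm_mult mult_left_mono)
      have eq: "eval_fps F w = exp (- \<alpha> * z) * exp_series \<alpha> F z"
        unfolding exp_series_def ez mult.assoc[symmetric] exp_add[symmetric] by simp
      have "cmod (eval_fps F w) = cmod (exp (- \<alpha> * z)) * cmod (exp_series \<alpha> F z)"
        unfolding eq by (rule norm_mult)
      also have "\<dots> \<le> exp (cmod (- \<alpha> * z)) * exp (C * exp (cmod z / 4))"
        by (intro mult_mono norm_exp C(2)) auto
      also have "\<dots> \<le> exp (real j * (2 * C + 4 * cmod \<alpha>))"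
        using 1 2 by (simp add: exp_add[symmetric] algebra_simps)
      also have "\<dots> = D ^ j" by (simp add: D_def exp_of_nat_mult)
      finally show "cmod (eval_fps F w) \<le> D ^ j" .
    qed
    moreover have "fps_nth F j = (deriv ^^ j) (eval_fps F) 0 / fact j"
      by (rule fps_nth_conv_deriv) (simp add: F)
    ultimately have "cmod (fps_nth F j) * fact j \<le> fact j * (D ^ j / R ^ j)"
      by (simp add: norm_divide)
    then have "cmod (fps_nth F j) \<le> D ^ j / R ^ j"
      using fact_gt_zero[of j, where 'a = real] by (simp only: mult.commute[of _ "fact j"] mult_le_cancel_left_pos)
    then show ?thesis by (simp add: R_def power_mult)
  qed
  then show ?thesis by (intro exI[of _ D]) (auto simp: D_def)
qed

text \<open>The recurrence forces nonzero coefficients to decay no faster than \<open>1 / (j!)\<^sup>2\<close>, whereas small growth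
  forces decay like \<open>1 / j\<^sup>4\<^sup>j\<close>.\<close>

lemma recurrence_coeff_zero:
  fixes a :: "nat \<Rightarrow> complex"
  assumes rec: "\<And>j. j > N \<Longrightarrow> ((\<alpha> + 2 * of_nat j)^2 - \<nu>^2) * a j + a (j - 1) = 0"
    and D: "D > 0" "\<And>j. j \<ge> 1 \<Longrightarrow> cmod (a j) \<le> D ^ j / real j ^ (4 * j)"
    and M: "M \<ge> N"
  shows "a M = 0"
proof -
  \<comment> \<open>Chosen so that the factor \<open>(\<alpha> + 2 j)^2 - \<nu>^2\<close> has
    modulus at most \<open>L * j^2\<close> for \<open>j \<ge> 1\<close>.\<close>
  define L where "L = (cmod \<alpha> + 2)^2 + (cmod \<nu>)^2"
  have "1 \<le> (cmod \<alpha> + 2)^2" using norm_ge_zero[of \<alpha>] by (intro one_le_power) linarith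
  then have L: "L \<ge> 1" unfolding L_def using zero_le_power2[of "cmod \<nu>"] by linarith
  have step: "cmod (a j) \<le> L * real (Suc j)^2 * cmod (a (Suc j))" if "j \<ge> N" for j
  proof -
    have "a j = - (((\<alpha> + 2 * of_nat (Suc j))^2 - \<nu>^2) * a (Suc j))"
      using rec[of "Suc j"] that by (simp add: eq_neg_iff_add_eq_0 add.commute del: of_nat_Suc)
    then have "cmod (a j) = cmod ((\<alpha> + 2 * of_nat (Suc j))^2 - \<nu>^2) * cmod (a (Suc j))"
      by (simp only: norm_minus_cancel norm_mult)
    moreover have "cmod ((\<alpha> + 2 * of_nat (Suc j))^2 - \<nu>^2) \<le> L * real (Suc j)^2"
    proof -
      have n: "real (Suc j) \<ge> 1" by simp
      have "cmod (\<alpha> + 2 * of_nat (Suc j)) \<le> cmod \<alpha> * 1 + 2 * real (Suc j)"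
        using norm_triangle_ineq[of \<alpha> "2 * of_nat (Suc j)"] by (simp add: norm_mult del: of_nat_Suc)
      also have "\<dots> \<le> cmod \<alpha> * real (Suc j) + 2 * real (Suc j)"
        using n by (intro add_mono mult_left_mono) auto
      finally have "cmod (\<alpha> + 2 * of_nat (Suc j)) \<le> (cmod \<alpha> + 2) * real (Suc j)" by (simp add: algebra_simps)
      then have "cmod ((\<alpha> + 2 * of_nat (Suc j))^2) \<le> ((cmod \<alpha> + 2) * real (Suc j))^2"
        unfolding norm_power by (rule power_mono) simp
      moreover have "cmod (\<nu>^2) * 1 \<le> (cmod \<nu>)^2 * real (Suc j)^2"
        unfolding norm_power using n by (intro mult_left_mono one_le_power) auto
      moreover have L: "L * real (Suc j)^2 = ((cmod \<alpha> + 2) * real (Suc j))^2 + (cmod \<nu>)^2 * real (Suc j)^2"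
        unfolding L_def by (simp only: power_mult_distrib distrib_right[of _ _ "real (Suc j)^2"])
      ultimately show ?thesis
        using norm_triangle_ineq4[of "(\<alpha> + 2 * of_nat (Suc j))^2" "\<nu>^2"]
        unfolding mult_1_right L by linarith
    qed
    ultimately show ?thesis by (simp add: mult_right_mono)
  qed
  have lower: "cmod (a M) \<le> L ^ n * (fact n)^2 * cmod (a n)" if "n \<ge> M" for n
    using that
  proof (induction n rule: nat_induct_at_least)
    case base
    have "1 \<le> L ^ M * (fact M)^2" using L by (simp add: mult_ge1_I one_le_power fact_ge_1)
    then show ?case using mult_right_mono[of 1 "L ^ M * (fact M)^2" "cmod (a M)"] by simp
  next
    case (Suc n)
    have "L ^ n * (fact n)^2 * cmod (a n) \<le> L ^ n * (fact n)^2 * (L * real (Suc n)^2 * cmod (a (Suc n)))"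
      using L step[of n] Suc.hyps M by (intro mult_left_mono) auto
    also have "\<dots> = L ^ Suc n * (fact (Suc n))^2 * cmod (a (Suc n))"
      by (simp add: power_mult_distrib mult_ac del: of_nat_Suc)
    finally show ?case using Suc.IH by linarith
  qed
  have "\<forall>\<^sub>F n in sequentially. cmod (a M) \<le> (1/2) ^ n"
  proof (rule eventually_sequentiallyI)
    \<comment> \<open>From here on \<open>L * D / n^2 \<le> 1/2\<close>, so the lower and upper
      bounds for \<open>a n\<close> together squeeze \<open>a M\<close> below
      \<open>(1/2)^n\<close>.\<close>
    fix n assume n: "n \<ge> max (max M 1) (nat \<lceil>2 * L * D\<rceil>)"
    then have n1: "n \<ge> M" "n \<ge> 1" "real n \<ge> 2 * L * D" by (auto simp: nat_le_iff ceiling_le_iff)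
    have "(fact n :: real) \<le> real n ^ n" using fact_le_power[of n, where 'a = real] by simp
    then have "(fact n :: real)^2 \<le> (real n ^ n)^2" by (intro power_mono) auto
    then have "L ^ n * (fact n)^2 * cmod (a n) \<le> L ^ n * (real n ^ n)^2 * (D ^ n / real n ^ (4 * n))"
      using L D n1 by (intro mult_mono D(2)) auto
    also have "\<dots> = (L * D / real n ^ 2) ^ n"
    proof -
      define q where "q = (real n ^ n)^2"
      have q: "q \<noteq> 0" using n1 by (simp add: q_def)
      have "real n ^ (4 * n) = q * q"
        by (simp add: q_def power_mult[symmetric] power_add[symmetric] mult.commute)
      moreover have "(real n ^ 2) ^ n = q" by (simp add: q_def power_mult[symmetric] mult.commute)
      ultimately show ?thesis unfolding q_def[symmetric] using q by (simp add: power_mult_distrib power_divide)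
    qed
    also have "\<dots> \<le> (1/2) ^ n"
    proof (rule power_mono)
      have "real n * 1 \<le> real n * real n" using n1(2) by (intro mult_left_mono) auto
      then have "2 * (L * D) \<le> real n * real n" using n1(3) by linarith
      then show "L * D / real n ^ 2 \<le> 1/2" using n1 by (simp add: divide_simps power2_eq_square)
      show "0 \<le> L * D / real n ^ 2" using L D by simp
    qed
    finally show "cmod (a M) \<le> (1/2) ^ n" using lower[OF n1(1)] by linarith
  qed
  moreover have "(\<lambda>n. (1/2) ^ n :: real) \<longlonglongrightarrow> 0" by (rule LIMSEQ_power_zero) simp
  ultimately have "cmod (a M) \<le> 0" by (intro tendsto_lowerbound) auto
  then show ?thesis by simp
qed

text \<open>All coefficients from index \<open>N\<close> on vanish, and the inhomogeneity sits at
  index \<open>N\<close>. Reading the recurrence downwards gives \<open>a (N - 1) = c\<close> and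
  then, up to sign, the multiples \<open>c * lommel_c \<mu> \<nu> k\<close>. At index 0, where no
  coefficient precedes, the recurrence becomes the condition
  \<open>c * lommel_c \<mu> \<nu> N = 0\<close>.\<close>

lemma quasi_periodic_small_growth_solution:
  assumes sol: "solves \<nu> f (\<lambda>z. c * exp ((\<mu> + 1) * z))"
    and per: "\<And>z. f (z + \<i> * pi) = exp ((\<mu> + 1) * (\<i> * pi)) * f z"
    and gr: "small_growth f"
  obtains N where "N \<ge> 1" "c * lommel_c \<mu> \<nu> N = 0"
    "\<And>z. f z = c * (exp ((\<mu> - 1) * z) * (\<Sum>k<N. (-1)^k * lommel_c \<mu> \<nu> k * exp (- 2 * of_nat k * z)))"
proof -
  obtain N F where N: "N \<ge> 1" and F: "fps_conv_radius F = \<infinity>" and f: "f = exp_series (\<mu> + 1 - 2 * of_nat N) F"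
    using quasi_periodic_solution_exp_series[OF sol per] .
  define \<alpha> where "\<alpha> = \<mu> + 1 - 2 * of_nat N"
  note f = f[folded \<alpha>_def]
  define a where "a = fps_nth F"
  have "solves \<nu> f (exp_series \<alpha> (bessel_fps \<alpha> \<nu> F))" unfolding f by (rule solves_exp_series[OF F])
  then have "exp_series \<alpha> (bessel_fps \<alpha> \<nu> F) z = c * exp ((\<mu> + 1) * z)" for z
    using sol unfolding solves_iff_deriv by metis
  \<comment> \<open>Relative to \<open>exp (\<alpha> * z)\<close> the inhomogeneity is the monomial
    of degree \<open>N\<close> in \<open>exp (2 * z)\<close>.\<close>
  moreover have "exp_series \<alpha> (fps_const c * fps_X ^ N) z = c * exp ((\<mu> + 1) * z)" for z
  proof -
    have "exp (\<alpha> * z) * exp (2 * z) ^ N = exp ((\<mu> + 1) * z)"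
      by (simp add: exp_of_nat_mult[symmetric] exp_add[symmetric] \<alpha>_def algebra_simps)
    then show ?thesis by (simp add: exp_series_def eval_fps_mult)
  qed
  moreover have "fps_conv_radius (fps_const c * fps_X ^ N) = \<infinity>"
    using fps_conv_radius_mult[of "fps_const c" "fps_X ^ N"] by simp
  ultimately have B: "bessel_fps \<alpha> \<nu> F = fps_const c * fps_X ^ N"
    by (intro exp_series_eqD[of _ _ \<alpha>] fps_conv_radius_bessel_fps(1)[OF F]) auto
  have rec: "((\<alpha> + 2 * of_nat j)^2 - \<nu>^2) * a j + (if j = 0 then 0 else a (j - 1)) = (if j = N then c else 0)" for j
    using arg_cong[OF B, of "\<lambda>F. fps_nth F j"] unfolding bessel_fps_def a_def
    by (simp only: fps_nth_Abs_fps fps_mult_left_const_nth fps_X_power_nth if_distrib[of "(*) c"] mult_1_right mult_zero_right)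
  obtain D where D: "D > 0" "\<And>j. j \<ge> 1 \<Longrightarrow> cmod (a j) \<le> D ^ j / real j ^ (4 * j)"
    using small_growth_exp_series_coeff[OF F, of \<alpha>] gr unfolding f a_def by blast
  have zero: "a j = 0" if "j \<ge> N" for j
  proof (rule recurrence_coeff_zero[OF _ D that])
    fix j assume "N < j"
    then show "((\<alpha> + 2 * of_nat j)^2 - \<nu>^2) * a j + a (j - 1) = 0" using rec[of j] by simp
  qed
  have coeff: "a (N - 1 - k) = c * ((-1)^k * lommel_c \<mu> \<nu> k)" if "k < N" for k
    using that
  proof (induction k)
    case 0
    show ?case using rec[of N] zero[of N] N by (simp add: lommel_c_def)
  next
    case (Suc k)
    define j where "j = N - Suc k"
    have j: "j > 0" "j < N" "j = N - 1 - k" "N - 1 - Suc k = j - 1" using Suc.prems by (auto simp: j_def)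
    have al: "\<alpha> + 2 * of_nat j = \<mu> - 2 * of_nat (Suc k) + 1"
      using Suc.prems by (simp add: \<alpha>_def j_def of_nat_diff algebra_simps)
    have "((\<alpha> + 2 * of_nat j)^2 - \<nu>^2) * a j + a (j - 1) = 0"
      using rec[of j] j(1,2) by simp
    then have "a (j - 1) = - (((\<mu> - 2 * of_nat (Suc k) + 1)^2 - \<nu>^2) * a j)"
      unfolding al by (simp only: eq_neg_iff_add_eq_0 add.commute)
    also have "a j = c * ((-1)^k * lommel_c \<mu> \<nu> k)" using Suc j by simp
    finally show ?case unfolding j(4) by (simp add: lommel_c_def mult_ac del: of_nat_Suc)
  qed
  have "((\<alpha> + 2 * of_nat 0)^2 - \<nu>^2) * a 0 = 0" using rec[of 0] N by simp
  moreover have "\<alpha> + 2 * of_nat 0 = \<mu> - 2 * of_nat N + 1" by (simp add: \<alpha>_def)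
  moreover have "a 0 = c * ((-1)^(N - 1) * lommel_c \<mu> \<nu> (N - 1))" using coeff[of "N - 1"] N by simp
  ultimately have "(-1)^(N - 1) * (c * (lommel_c \<mu> \<nu> (N - 1) * ((\<mu> - 2 * of_nat N + 1)^2 - \<nu>^2))) = 0"
    by (simp only: mult_ac)
  moreover have "lommel_c \<mu> \<nu> N = lommel_c \<mu> \<nu> (N - 1) * ((\<mu> - 2 * of_nat N + 1)^2 - \<nu>^2)"
    using N by (cases N) (simp_all add: lommel_c_def)
  ultimately have 1: "c * lommel_c \<mu> \<nu> N = 0" by simp
  have "f z = c * (exp ((\<mu> - 1) * z) * (\<Sum>k<N. (-1)^k * lommel_c \<mu> \<nu> k * exp (- 2 * of_nat k * z)))" for z
  proof -
    have "(\<lambda>m. a m * exp ((\<alpha> + 2 * of_nat m) * z)) sums f z"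
      unfolding a_def f by (rule exp_series_sums[OF F])
    moreover have "(\<lambda>m. a m * exp ((\<alpha> + 2 * of_nat m) * z)) sums (\<Sum>m<N. a m * exp ((\<alpha> + 2 * of_nat m) * z))"
      by (rule sums_finite) (auto simp: zero)
    ultimately have "f z = (\<Sum>m<N. a m * exp ((\<alpha> + 2 * of_nat m) * z))" by (rule sums_unique2)
    also have "\<dots> = (\<Sum>k<N. a (N - Suc k) * exp ((\<alpha> + 2 * of_nat (N - Suc k)) * z))"
      by (rule sum.nat_diff_reindex[symmetric])
    also have "\<dots> = (\<Sum>k<N. c * (exp ((\<mu> - 1) * z) * ((-1)^k * lommel_c \<mu> \<nu> k * exp (- 2 * of_nat k * z))))"
    proof (rule sum.cong)
      fix k assume "k \<in> {..<N}"
      then have k: "k < N" by simp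
      have "\<alpha> + 2 * of_nat (N - Suc k) = (\<mu> - 1) + - 2 * of_nat k"
        using k by (simp add: \<alpha>_def of_nat_diff algebra_simps)
      then have "exp ((\<alpha> + 2 * of_nat (N - Suc k)) * z) = exp ((\<mu> - 1) * z) * exp (- 2 * of_nat k * z)"
        by (simp only: distrib_right exp_add)
      moreover have "a (N - Suc k) = c * ((-1)^k * lommel_c \<mu> \<nu> k)" using coeff[OF k] by simp
      ultimately show "a (N - Suc k) * exp ((\<alpha> + 2 * of_nat (N - Suc k)) * z)
          = c * (exp ((\<mu> - 1) * z) * ((-1)^k * lommel_c \<mu> \<nu> k * exp (- 2 * of_nat k * z)))"
        by (simp only: mult_ac)
    qed simp
    finally show ?thesis by (simp only: sum_distrib_left[symmetric])
  qed
  with N 1 show ?thesis by (rule that)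
qed

text \<open>The case \<open>c = 0\<close>, with \<open>\<beta> - 1\<close> in the role of
  \<open>\<mu>\<close>: the resulting finite series carries the factor \<open>c\<close>.\<close>

lemma eigenfunction_small_growth_zero:
  assumes "solves \<nu> f (\<lambda>_. 0)" "\<And>z. f (z + \<i> * pi) = exp (\<beta> * (\<i> * pi)) * f z" "small_growth f"
  shows "f z = 0"
  using quasi_periodic_small_growth_solution[of \<nu> f 0 "\<beta> - 1"] assms by auto

text \<open>Subtracting \<open>exp (-\<nu> * (\<i> * pi)) * f\<close> from the translate removes the
  \<open>besselY_e\<close> part and leaves \<open>\<kappa> * besselJ_e \<nu>\<close>, an
  eigenfunction of small growth and hence 0. So \<open>f\<close> is itself an eigenfunction. The
  argument is the same whether or not the two eigenvalues coincide.\<close>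

lemma homogeneous_small_growth_zero:
  assumes sol: "solves \<nu> f (\<lambda>_. 0)" and gr: "small_growth f"
  shows "f z = 0"
proof -
  obtain A B where f: "\<And>z. f z = A * besselJ_e \<nu> z + B * besselY_e \<nu> z"
    using homogeneous_solution[OF sol] by blast
  define \<kappa> where "\<kappa> = A * (exp (\<nu> * (\<i> * pi)) - exp (-\<nu> * (\<i> * pi)))
      + B * (2 * \<i> * cos (\<nu> * complex_of_real pi))"
  have k: "f (z + \<i> * pi) + (- exp (-\<nu> * (\<i> * pi))) * f z = \<kappa> * besselJ_e \<nu> z" for z
    unfolding f besselJ_e_shift besselY_e_shift \<kappa>_def by (simp add: algebra_simps)
  have "small_growth (\<lambda>z. \<kappa> * besselJ_e \<nu> z)"
    using small_growth_lincomb[OF small_growth_shift[OF gr, of "\<i> * pi"] gr, of 1 "- exp (-\<nu> * (\<i> * pi))"]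
    unfolding mult_1_left k .
  moreover have "solves \<nu> (\<lambda>z. \<kappa> * besselJ_e \<nu> z) (\<lambda>_. 0)"
    using solves_cmult[OF solves_besselJ] by simp
  ultimately have "\<kappa> * besselJ_e \<nu> z = 0" for z
    by (intro eigenfunction_small_growth_zero[where \<beta> = \<nu>]) (simp_all add: besselJ_e_shift)
  then have "f (z + \<i> * pi) + (- exp (-\<nu> * (\<i> * pi))) * f z = 0" for z
    unfolding k .
  then have "f (z + \<i> * pi) = exp (-\<nu> * (\<i> * pi)) * f z" for z
    by (simp add: add_eq_0_iff)
  then show ?thesis by (rule eigenfunction_small_growth_zero[OF sol _ gr])
qed

lemma inhomogeneous_small_growth:
  assumes sol: "solves \<nu> f (\<lambda>z. c * exp ((\<mu> + 1) * z))" and gr: "small_growth f"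
  obtains N where "N \<ge> 1" "c * lommel_c \<mu> \<nu> N = 0"
    "\<And>z. f z = c * (exp ((\<mu> - 1) * z) * (\<Sum>k<N. (-1)^k * lommel_c \<mu> \<nu> k * exp (- 2 * of_nat k * z)))"
proof (rule quasi_periodic_small_growth_solution[OF sol _ gr])
  define e where "e = exp ((\<mu> + 1) * (\<i> * pi))"
  have "exp (2 * (\<i> * complex_of_real pi)) = 1" using exp_two_pi_i by (simp add: mult_ac)
  then have "solves \<nu> (\<lambda>z. f (z + \<i> * pi) + (-e) * f z)
     (\<lambda>z. c * exp ((\<mu> + 1) * (z + \<i> * pi)) + (-e) * (c * exp ((\<mu> + 1) * z)))"
    by (intro solves_add solves_cmult solves_translate[OF sol] sol)
  then have "solves \<nu> (\<lambda>z. f (z + \<i> * pi) + (-e) * f z) (\<lambda>_. 0)"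
    by (rule solves_cong) (simp_all add: e_def distrib_left exp_add)
  moreover have "small_growth (\<lambda>z. f (z + \<i> * pi) + (-e) * f z)"
    using small_growth_lincomb[OF small_growth_shift[OF gr, of "\<i> * pi"] gr, of 1 "-e"] by simp
  ultimately have "f (z + \<i> * pi) + (-e) * f z = 0" for z by (rule homogeneous_small_growth_zero)
  then show "f (z + \<i> * pi) = exp ((\<mu> + 1) * (\<i> * pi)) * f z" for z
    by (simp add: e_def add_eq_0_iff)
qed (use that in blast)

text \<open>The product \<open>lommel_c\<close> vanishes through one of its factors, and the factor
  of index \<open>p + 1\<close> is 0 exactly if \<open>\<mu> + \<nu>\<close> or
  \<open>\<mu> - \<nu>\<close> equals \<open>2 p + 1\<close>. All later products contain that
  factor, which cuts the sum at \<open>p\<close>.\<close>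

lemma small_growth_solution:
  assumes sol: "solves \<nu> f (\<lambda>z. c * exp ((\<mu> + 1) * z))" and gr: "small_growth f" and c: "c \<noteq> 0"
  obtains p :: nat where "\<mu> + \<nu> = 2 * of_nat p + 1 \<or> \<mu> - \<nu> = 2 * of_nat p + 1"
    "\<And>z. f z = c * (exp ((\<mu> - 1) * z) * (\<Sum>k\<le>p. (-1)^k * lommel_c \<mu> \<nu> k * exp (- 2 * of_nat k * z)))"
proof -
  obtain N where N: "N \<ge> 1" "c * lommel_c \<mu> \<nu> N = 0"
    and f: "\<And>z. f z = c * (exp ((\<mu> - 1) * z) * (\<Sum>k<N. (-1)^k * lommel_c \<mu> \<nu> k * exp (- 2 * of_nat k * z)))"
    using inhomogeneous_small_growth[OF sol gr] by blast
  obtain m where m: "m \<in> {1..N}" "(\<mu> - 2 * of_nat m + 1)^2 - \<nu>^2 = 0"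
    using N c by (auto simp: lommel_c_def)
  then obtain p where p: "m = Suc p" by (cases m) auto
  have "(\<mu> + \<nu> - (2 * of_nat p + 1)) * (\<mu> - \<nu> - (2 * of_nat p + 1)) = 0"
    using m(2) by (simp add: p power2_eq_square algebra_simps)
  then have 1: "\<mu> + \<nu> = 2 * of_nat p + 1 \<or> \<mu> - \<nu> = 2 * of_nat p + 1" by simp
  have "lommel_c \<mu> \<nu> k = 0" if "k \<ge> m" for k
    using that m by (auto simp: lommel_c_def intro!: prod_zero[of "{1..k}"] bexI[of _ m])
  then have "(\<Sum>k<N. (-1)^k * lommel_c \<mu> \<nu> k * exp (- 2 * of_nat k * z))
      = (\<Sum>k\<le>p. (-1)^k * lommel_c \<mu> \<nu> k * exp (- 2 * of_nat k * z))" for z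
    using m(1) by (intro sum.mono_neutral_right) (auto simp: p)
  with f 1 show ?thesis by (intro that) auto
qed

section \<open>Terminating Lommel functions\<close>

lemma sin_cos_half_shift:
  "sin (of_nat p * complex_of_real pi + w + complex_of_real pi / 2) = (-1)^p * cos w"
  "cos (of_nat p * complex_of_real pi + w + complex_of_real pi / 2) = - ((-1)^p * sin w)"
proof -
  have "sin (complex_of_real pi / 2) = 1" "cos (complex_of_real pi / 2) = 0"
    using sin_of_real[of "pi / 2", where ?'a = complex] cos_of_real[of "pi / 2", where ?'a = complex] by auto
  moreover have "sin (of_nat p * complex_of_real pi) = 0" by (simp add: sin_complex_pi_eq_0_iff)
  ultimately show
    "sin (of_nat p * complex_of_real pi + w + complex_of_real pi / 2) = (-1)^p * cos w"
    "cos (of_nat p * complex_of_real pi + w + complex_of_real pi / 2) = - ((-1)^p * sin w)"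
    by (simp_all add: sin_add cos_add cos_nat_pi)
qed

text \<open>The quotient in \<open>besselY_gen\<close> with its denominator cleared, a form that
  survives at integer order.\<close>

lemma besselY_sin:
  "besselJ_e \<nu> z * cos (\<nu> * complex_of_real pi) - besselY_e \<nu> z * sin (\<nu> * complex_of_real pi) = besselJ_e (-\<nu>) z"
proof (cases "\<nu> \<in> \<int>")
  case True
  then have "sin (\<nu> * complex_of_real pi) = 0" by (simp add: sin_complex_pi_eq_0_iff)
  then show ?thesis using besselJ_e_neg_int[OF True, of z] by (simp add: mult.commute)
next
  case False
  then have "sin (\<nu> * complex_of_real pi) \<noteq> 0" by (simp add: sin_complex_pi_eq_0_iff)
  then show ?thesis using False by (simp add: besselY_e_def besselY_gen_def)
qed

text \<open>Here \<open>\<nu>'\<close> is either sign of the order, which unites the two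
  alternatives of the terminating condition. The trigonometric factors then reduce the Bessel
  combination to \<open>besselJ_e (-\<nu>')\<close>.\<close>

lemma lommel_gen_terminating_eq:
  assumes "\<mu> + \<nu>' = 2 * of_nat p + 1" "\<nu>' = \<nu> \<or> \<nu>' = - \<nu>"
  shows "lommel_gen \<mu> \<nu> z = lommel_small_s \<mu> \<nu> z
     + exp ((\<mu> - 1) * ln2c) * Gamma ((\<mu> - \<nu>' + 1) / 2) * Gamma ((\<mu> + \<nu>' + 1) / 2) * (-1)^p * besselJ_e (-\<nu>') z"
  using assms(2)
proof
  assume n: "\<nu>' = \<nu>"
  have mu: "\<mu> = 2 * of_nat p + 1 - \<nu>" using assms(1) n by (simp add: algebra_simps)
  have "(\<mu> - \<nu>) * pi / 2 = of_nat p * complex_of_real pi + (- (\<nu> * complex_of_real pi)) + complex_of_real pi / 2"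
    unfolding mu by (simp add: field_simps)
  then have sc: "sin ((\<mu> - \<nu>) * pi / 2) = (-1)^p * cos (\<nu> * complex_of_real pi)"
      "cos ((\<mu> - \<nu>) * pi / 2) = (-1)^p * sin (\<nu> * complex_of_real pi)"
    by (simp_all only: sin_cos_half_shift) simp_all
  have "besselJ_e \<nu> z * sin ((\<mu> - \<nu>) * pi / 2) - besselY_e \<nu> z * cos ((\<mu> - \<nu>) * pi / 2) = (-1)^p * besselJ_e (-\<nu>) z"
    unfolding sc besselY_sin[symmetric] by (simp add: algebra_simps)
  then show ?thesis unfolding lommel_gen_def n by (simp only: mult.assoc)
next
  assume n: "\<nu>' = - \<nu>"
  have mu: "\<mu> = 2 * of_nat p + 1 + \<nu>" using assms(1) n by (simp add: algebra_simps)
  have "(\<mu> - \<nu>) * pi / 2 = of_nat p * complex_of_real pi + 0 + complex_of_real pi / 2"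
    unfolding mu by (simp add: field_simps)
  then have sc: "sin ((\<mu> - \<nu>) * pi / 2) = (-1)^p" "cos ((\<mu> - \<nu>) * pi / 2) = 0"
    by (simp_all only: sin_cos_half_shift) simp_all
  show ?thesis unfolding lommel_gen_def n sc by (simp add: mult_ac)
qed

lemma exp_series_finite_small_growth:
  assumes "fps_conv_radius F = \<infinity>" "\<And>m. m > p \<Longrightarrow> fps_nth F m = 0"
  shows "small_growth (exp_series \<alpha> F)"
proof -
  have "exp_series \<alpha> F z = (\<Sum>m\<le>p. fps_nth F m * exp ((\<alpha> + 2 * of_nat m) * z))" for z
    using sums_unique2[OF exp_series_sums[OF assms(1)] sums_finite[of "{..p}"]] assms(2) by auto
  then have "exp_series \<alpha> F = (\<lambda>z. \<Sum>m\<le>p. fps_nth F m * exp ((\<alpha> + 2 * of_nat m) * z))" by blast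
  then show ?thesis using small_growth_exp_sum[of "{..p}" "fps_nth F" "\<lambda>m. \<alpha> + 2 * of_nat m"] by simp
qed

text \<open>Since \<open>\<mu> + 1 = - \<nu>' + 2 (p + 1)\<close>, both summands merge into one
  series \<open>U\<close> over the exponents \<open>- \<nu>' + 2 m\<close>. The gamma factors make
  its coefficient at \<open>p\<close> equal to 1, which accounts for the whole inhomogeneity at
  index \<open>p + 1\<close>. So the coefficient at \<open>p + 1\<close> vanishes, and with it all
  later ones.\<close>

lemma lommel_gen_terminating_small_growth:
  assumes odd: "\<not> odd_neg_int (\<mu> + \<nu>)" "\<not> odd_neg_int (\<mu> - \<nu>)"
    and mu: "\<mu> + \<nu>' = 2 * of_nat p + 1" and n: "\<nu>' = \<nu> \<or> \<nu>' = - \<nu>"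
  shows "small_growth (lommel_gen \<mu> \<nu>)"
proof -
  define K where "K = exp ((\<mu> - 1) * ln2c) * Gamma ((\<mu> - \<nu>' + 1) / 2) * Gamma ((\<mu> + \<nu>' + 1) / 2) * (-1)^p"
  define U where "U = lommel_small_fps \<mu> \<nu> * fps_X ^ Suc p + fps_const K * besselJ_fps (-\<nu>')"
  have mu': "\<mu> = 2 * of_nat p + 1 - \<nu>'" using mu by (simp add: algebra_simps)
  have sq: "\<nu>'^2 = \<nu>^2" using n by auto
  have c1: "fps_conv_radius (lommel_small_fps \<mu> \<nu> * fps_X ^ Suc p) = \<infinity>"
    using fps_conv_radius_mult[of "lommel_small_fps \<mu> \<nu>" "fps_X ^ Suc p"] lommel_small(1)[OF odd] by (simp del: power_Suc)
  have c2: "fps_conv_radius (fps_const K * besselJ_fps (-\<nu>')) = \<infinity>"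
    using fps_conv_radius_mult[of "fps_const K" "besselJ_fps (-\<nu>')"] by simp
  have conv: "fps_conv_radius U = \<infinity>"
    unfolding U_def using fps_conv_radius_add[of "lommel_small_fps \<mu> \<nu> * fps_X ^ Suc p" "fps_const K * besselJ_fps (-\<nu>')"] c1 c2
    by simp
  have e: "exp ((\<mu> + 1) * z) = exp (- \<nu>' * z) * exp (2 * z) ^ Suc p" for z
    unfolding exp_of_nat_mult[symmetric] exp_add[symmetric] mu' by (simp add: algebra_simps)
  have gen: "lommel_gen \<mu> \<nu> = exp_series (-\<nu>') U"
  proof
    fix z
    have "exp_series (-\<nu>') U z = exp_series (\<mu> + 1) (lommel_small_fps \<mu> \<nu>) z + K * besselJ_e (-\<nu>') z"
      unfolding exp_series_def besselJ_e_eq U_def e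
      using c1 c2 lommel_small(1)[OF odd]
      by (simp add: eval_fps_add eval_fps_mult del: power_Suc) (simp add: algebra_simps)
    then show "lommel_gen \<mu> \<nu> z = exp_series (-\<nu>') U z"
      unfolding lommel_gen_terminating_eq[OF mu n] lommel_small(2)[OF odd] K_def by simp
  qed
  have "exp_series (-\<nu>') (bessel_fps (-\<nu>') \<nu> U) z = exp_series (-\<nu>') (fps_X ^ Suc p) z" for z
  proof -
    have "exp_series (-\<nu>') (bessel_fps (-\<nu>') \<nu> U) z = exp ((\<mu> + 1) * z)"
      using solves_exp_series[OF conv, of \<nu> "-\<nu>'"] solves_lommel_gen[OF odd]
      unfolding gen solves_iff_deriv by metis
    then show ?thesis unfolding e exp_series_def by (simp del: power_Suc)
  qed
  then have B: "bessel_fps (-\<nu>') \<nu> U = fps_X ^ Suc p"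
    by (intro exp_series_eqD[of _ _ "-\<nu>'"] fps_conv_radius_bessel_fps(1)[OF conv]) (auto simp del: power_Suc)
  have rec: "4 * of_nat m * (of_nat m - \<nu>') * fps_nth U m + fps_nth U (m - 1) = (if m = Suc p then 1 else 0)" if "m > 0" for m
  proof -
    have "(- \<nu>' + 2 * of_nat m)^2 - \<nu>^2 = 4 * of_nat m * (of_nat m - \<nu>')"
      unfolding sq[symmetric] by (simp add: power2_eq_square algebra_simps)
    then show ?thesis
      using arg_cong[OF B, of "\<lambda>F. fps_nth F m"] that unfolding bessel_fps_def by (simp only: fps_nth_Abs_fps fps_X_power_nth) simp
  qed
  \<comment> \<open>A zero would make \<open>\<mu> - \<nu>'\<close> an odd negative integer.\<close>
  have nz: "of_nat m - \<nu>' \<noteq> 0" if "m > p" for m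
  proof
    assume "of_nat m - \<nu>' = 0"
    then have "\<mu> - \<nu>' = - (2 * of_nat (m - Suc p) + 1)" using that by (simp add: mu' of_nat_diff)
    then have "odd_neg_int (\<mu> - \<nu>')" by (auto simp: odd_neg_int_def)
    then show False using odd n by auto
  qed
  have Up: "fps_nth U p = 1"
  proof -
    have g1: "Gamma ((\<mu> + \<nu>' + 1) / 2) = fact p"
    proof -
      have e: "(\<mu> + \<nu>' + 1) / 2 = 1 + of_nat p" unfolding mu by simp
      show ?thesis unfolding e by (rule Gamma_fact)
    qed
    have a: "(\<mu> - \<nu>' + 1) / 2 = - \<nu>' + of_nat p + 1" unfolding mu' by (simp add: field_simps)
    have "- \<nu>' + of_nat p + 1 \<notin> \<int>\<^sub>\<le>\<^sub>0"
    proof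
      assume "- \<nu>' + of_nat p + 1 \<in> \<int>\<^sub>\<le>\<^sub>0"
      then obtain j :: nat where "- \<nu>' + of_nat p + 1 = - of_nat j" by (auto elim: nonpos_Ints_cases')
      then have "of_nat (j + p + 1) - \<nu>' = 0" by (simp add: algebra_simps add_eq_0_iff)
      then show False using nz[of "j + p + 1"] by simp
    qed
    then have g2: "Gamma (- \<nu>' + of_nat p + 1) * rGamma (- \<nu>' + of_nat p + 1) = 1"
      by (simp add: rGamma_inverse_Gamma Gamma_eq_zero_iff)
    have ee: "exp ((\<mu> - 1) * ln2c) * exp (-(- \<nu>' + 2 * of_nat p) * ln2c) = 1"
      unfolding exp_add[symmetric] mu' by (simp add: algebra_simps)
    \<comment> \<open>The power series of \<open>lommel_small_s\<close> starts at index
      \<open>p + 1\<close>, so only the Bessel part contributes.\<close>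
    have "fps_nth U p = K * besselJ_coeff (-\<nu>') p"
      by (simp add: U_def fps_nth_besselJ fps_X_power_mult_right_nth del: power_Suc)
    also have "\<dots> = (exp ((\<mu> - 1) * ln2c) * exp (-(- \<nu>' + 2 * of_nat p) * ln2c))
        * (Gamma (- \<nu>' + of_nat p + 1) * rGamma (- \<nu>' + of_nat p + 1)) * ((-1)^p * (-1)^p)"
      unfolding K_def g1 a besselJ_coeff_def by simp
    also have "\<dots> = 1" unfolding ee g2 by (simp add: power_mult_distrib[symmetric])
    finally show ?thesis .
  qed
  have "fps_nth U m = 0" if "m > p" for m
    using that
  proof (induction m)
    case (Suc m)
    \<comment> \<open>The preceding coefficient equals the right-hand side of the recurrence: at
      \<open>m = p\<close> by the normalization, beyond it by induction.\<close>
    have "fps_nth U m = (if Suc m = Suc p then 1 else 0)"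
      using Suc Up by (cases "m = p") auto
    then have "4 * of_nat (Suc m) * (of_nat (Suc m) - \<nu>') * fps_nth U (Suc m) = 0"
      using rec[of "Suc m"] by simp
    then show ?case using nz[OF Suc.prems] by (simp del: of_nat_Suc)
  qed simp
  then show ?thesis unfolding gen by (rule exp_series_finite_small_growth[OF conv])
qed

lemma besselJ_order_coeff:
  assumes "\<nu> + of_nat m + 1 \<notin> \<int>\<^sub>\<le>\<^sub>0"
  shows "fps_nth (besselJ_order_fps \<nu>) m = - besselJ_coeff \<nu> m * (ln2c + Digamma (\<nu> + of_nat m + 1))"
proof -
  have g: "((\<lambda>\<nu>. rGamma (\<nu> + of_nat m + 1)) has_field_derivative
      - rGamma (\<nu> + of_nat m + 1) * Digamma (\<nu> + of_nat m + 1)) (at \<nu>)"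
  proof -
    have "((\<lambda>\<nu>. \<nu> + of_nat m + 1) has_field_derivative 1) (at \<nu>)"
      by (auto intro!: derivative_eq_intros)
    from DERIV_chain2[where f = rGamma and g = "\<lambda>\<nu>. \<nu> + of_nat m + 1" and x = \<nu>,
        OF has_field_derivative_rGamma_no_nonpos_int[OF assms] this]
    show ?thesis by simp
  qed
  have "((\<lambda>\<nu>. (-1)^m * exp (-(\<nu> + 2 * of_nat m) * ln2c)) has_field_derivative
      - ((-1)^m * exp (-(\<nu> + 2 * of_nat m) * ln2c) * ln2c)) (at \<nu>)"
    by (auto intro!: derivative_eq_intros)
  from DERIV_cdivide[OF DERIV_mult[OF this g], of "fact m"]
  have "((\<lambda>\<nu>. besselJ_coeff \<nu> m) has_field_derivative
      - besselJ_coeff \<nu> m * (ln2c + Digamma (\<nu> + of_nat m + 1))) (at \<nu>)"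
    unfolding besselJ_coeff_def by (rule DERIV_cong) (simp add: field_simps)
  then show ?thesis by (rule DERIV_unique[OF besselJ_coeff_has_derivative])
qed

text \<open>The surviving sum is, up to a factor, the finite part of the Bessel function of the
  second kind: at order \<open>- n\<close> the coefficients of index below \<open>n\<close> vanish,
  and their derivatives in the order remain. All infinite series in \<open>lommel_base\<close>
  cancel.\<close>

lemma lommel_base_pos_int:
  assumes "n > 0"
  shows "lommel_base (of_nat n) z = - (Gamma (of_nat n) * exp ((of_nat n - 2) * ln2c) * (-1)^n)
     * (\<Sum>m<n. fps_nth (besselJ_order_fps (- of_nat n)) m * exp ((- of_nat n + 2 * of_nat m) * z))"
proof -
  define \<nu> :: complex where "\<nu> = of_nat n"
  define e where "e = exp ((\<nu> - 2) * ln2c)"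
  have nn: "\<nu> \<noteq> - of_nat k" for k :: nat
  proof
    assume "\<nu> = - of_nat k"
    then have "complex_of_nat (n + k) = 0" by (simp add: \<nu>_def)
    then show False using assms by (simp only: of_nat_eq_0_iff)
  qed
  have int: "\<nu> \<in> \<int>" by (simp add: \<nu>_def)
  have cs: "cos (\<nu> * complex_of_real pi) = (-1)^n" by (simp add: \<nu>_def cos_nat_pi)
  have "(-1)^n * (-1)^n = (1::complex)" by (simp add: power_mult_distrib[symmetric])
  then have J: "(-1)^n * besselJ_e (-\<nu>) z = besselJ_e \<nu> z"
    unfolding \<nu>_def besselJ_e_neg_nat mult.assoc[symmetric] by simp
  let ?Q = "besselJ_order_fps" and ?B = "lommel_base_fps \<nu>"
  have "of_real pi * besselY_e \<nu> z = besselJ_order_deriv \<nu> z + (-1)^n * besselJ_order_deriv (-\<nu>) z"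
    unfolding besselY_e_int[OF int] cs by simp
  also have "\<dots> = z * besselJ_e \<nu> z + exp_series \<nu> (?Q \<nu>) z + (z * ((-1)^n * besselJ_e (-\<nu>) z) + (-1)^n * exp_series (-\<nu>) (?Q (-\<nu>)) z)"
    unfolding besselJ_order_deriv_def by (simp add: algebra_simps)
  finally have Y: "of_real pi * besselY_e \<nu> z = 2 * (z * besselJ_e \<nu> z) + exp_series \<nu> (?Q \<nu>) z + (-1)^n * exp_series (-\<nu>) (?Q (-\<nu>)) z"
    unfolding J by simp
  have e1: "exp ((\<nu> - 1) * ln2c) = 2 * e"
  proof -
    have "(\<nu> - 1) * ln2c = ln2c + (\<nu> - 2) * ln2c" by (simp add: algebra_simps)
    then show ?thesis by (simp only: exp_add exp_ln2c e_def)
  qed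
  have e2: "exp (\<nu> * ln2c) = 4 * e"
  proof -
    have "\<nu> * ln2c = ln2c + ln2c + (\<nu> - 2) * ln2c" by (simp add: algebra_simps)
    then show ?thesis by (simp only: exp_add exp_ln2c e_def) simp
  qed
  have base: "lommel_base \<nu> z = - (Gamma \<nu> * e) * (exp_series \<nu> (?Q \<nu>) z + exp_series \<nu> ?B z + (-1)^n * exp_series (-\<nu>) (?Q (-\<nu>)) z)"
    unfolding lommel_base_generic[OF nn] e1 e2 e_def[symmetric] mult.assoc[of e "of_real pi"] Y by (simp add: algebra_simps)
  \<comment> \<open>The logarithmic parts of \<open>J\<close> and \<open>Y\<close> have cancelled; it remains to cancel the digamma terms against the tail of the
      last series, whose index is shifted by \<open>n\<close>.\<close>
  let ?s = "\<Sum>m<n. fps_nth (?Q (-\<nu>)) m * exp ((-\<nu> + 2 * of_nat m) * z)"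
  define t where "t = (\<lambda>m. fps_nth (?Q (-\<nu>)) m * exp ((-\<nu> + 2 * of_nat m) * z))"
  have S1: "(\<lambda>m. fps_nth (?Q \<nu>) m * exp ((\<nu> + 2 * of_nat m) * z) + fps_nth ?B m * exp ((\<nu> + 2 * of_nat m) * z))
      sums (exp_series \<nu> (?Q \<nu>) z + exp_series \<nu> ?B z)"
    by (intro sums_add exp_series_sums lommel_base_series(1)[OF nn]) simp
  have "t sums exp_series (-\<nu>) (?Q (-\<nu>)) z" unfolding t_def by (intro exp_series_sums) simp
  then have "(\<lambda>m. t (m + n)) sums (exp_series (-\<nu>) (?Q (-\<nu>)) z - ?s)"
    using sums_iff_shift[of t n] by (simp add: t_def)
  then have S2: "(\<lambda>m. (-1)^n * t (m + n)) sums ((-1)^n * (exp_series (-\<nu>) (?Q (-\<nu>)) z - ?s))"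
    by (rule sums_mult)
  have "fps_nth (?Q \<nu>) m * exp ((\<nu> + 2 * of_nat m) * z) + fps_nth ?B m * exp ((\<nu> + 2 * of_nat m) * z) + (-1)^n * t (m + n) = 0" for m
  proof -
    have np: "complex_of_nat k + 1 \<notin> \<int>\<^sub>\<le>\<^sub>0" for k
      using of_nat_in_nonpos_Ints_iff[of "Suc k", where 'a = complex] by (simp add: add.commute)
    have 1: "fps_nth (?Q \<nu>) m = - besselJ_coeff \<nu> m * (ln2c + Digamma (\<nu> + of_nat m + 1))"
      by (rule besselJ_order_coeff) (use np[of "n + m"] in \<open>simp add: \<nu>_def\<close>)
    have a: "-\<nu> + of_nat (m + n) + 1 = of_nat m + 1" "-\<nu> + 2 * of_nat (m + n) = \<nu> + 2 * of_nat m"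
      by (simp_all add: \<nu>_def)
    have 2: "fps_nth (?Q (-\<nu>)) (m + n) = - ((-1)^n * besselJ_coeff \<nu> m) * (ln2c + Digamma (of_nat m + 1))"
      using besselJ_order_coeff[of "-\<nu>" "m + n"] np[of m] unfolding a by (simp add: \<nu>_def besselJ_coeff_neg_nat)
    have 3: "fps_nth ?B m = besselJ_coeff \<nu> m * (2 * ln2c + Digamma (\<nu> + of_nat m + 1) + Digamma (of_nat m + 1))"
      by (simp add: lommel_base_fps_def lommel_base_coeff_def)
    have "(-1)^n * t (m + n) = - ((-1)^n * (-1)^n) * besselJ_coeff \<nu> m * (ln2c + Digamma (of_nat m + 1)) * exp ((\<nu> + 2 * of_nat m) * z)"
      unfolding t_def 2 a by (simp only: mult_ac mult_minus_left mult_minus_right)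
    also have "(-1)^n * (-1)^n = (1::complex)" by (simp add: power_mult_distrib[symmetric])
    finally have 4: "(-1)^n * t (m + n) = - 1 * besselJ_coeff \<nu> m * (ln2c + Digamma (of_nat m + 1)) * exp ((\<nu> + 2 * of_nat m) * z)" .
    show ?thesis unfolding 1 3 4 by (simp add: algebra_simps)
  qed
  then have "exp_series \<nu> (?Q \<nu>) z + exp_series \<nu> ?B z + (-1)^n * (exp_series (-\<nu>) (?Q (-\<nu>)) z - ?s) = 0"
    using sums_unique2[OF sums_add[OF S1 S2] ] sums_zero by auto
  then have "exp_series \<nu> (?Q \<nu>) z + exp_series \<nu> ?B z + (-1)^n * exp_series (-\<nu>) (?Q (-\<nu>)) z = (-1)^n * ?s"
    by (simp add: algebra_simps)
  then have "lommel_base \<nu> z = - (Gamma \<nu> * e) * ((-1)^n * ?s)" unfolding base by (simp only:)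
  then show ?thesis unfolding e_def \<nu>_def by (simp only: mult_ac mult_minus_left mult_minus_right)
qed

lemma lommel_ii_pos_int_small_growth:
  assumes "n > 0"
  shows "small_growth (lommel_ii (of_nat n) p)"
proof -
  define g where "g = (\<lambda>z. \<Sum>m<n. fps_nth (besselJ_order_fps (- of_nat n)) m * exp ((- of_nat n + 2 * of_nat m) * z))"
  define h where "h = (\<lambda>z. \<Sum>m<p. (-1)^m / (2^(2*m+2) * pochhammer (- of_nat p) (m+1) * pochhammer (of_nat n - of_nat p) (m+1))
      * exp ((of_nat n - 2 * of_nat p + 2 * of_nat m :: complex) * z))"
  have "small_growth g" "small_growth h" unfolding g_def h_def by (intro small_growth_exp_sum finite_lessThan)+
  define c where "c = (-1)^p / (2^(2*p) * fact p * pochhammer (1 - of_nat n) p) * - (Gamma (of_nat n) * exp ((of_nat n - 2) * ln2c) * (-1)^n)"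
  have "lommel_ii (of_nat n) p = (\<lambda>z. 1 * h z + c * g z)"
    unfolding lommel_ii_def lommel_base_pos_int[OF assms] g_def h_def c_def by (auto simp: fun_eq_iff)
  then show ?thesis by (simp only: small_growth_lincomb \<open>small_growth h\<close> \<open>small_growth g\<close>)
qed

text \<open>With \<open>\<mu> = \<nu> - 2 q - 1\<close> the second alternative is impossible, and
  the first gives \<open>\<nu> = p + q + 1\<close>, a positive integer.\<close>

lemma terminating_lommel_ii_small_growth:
  assumes "\<mu> = \<nu> - 2 * of_nat q - 1" "\<mu> + \<nu> = 2 * of_nat p + 1 \<or> \<mu> - \<nu> = 2 * of_nat p + 1"
  shows "small_growth (lommel_ii \<nu> q)"
proof -
  have "\<mu> - \<nu> \<noteq> 2 * of_nat p + 1"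
  proof
    assume "\<mu> - \<nu> = 2 * of_nat p + 1"
    then have "2 * complex_of_nat (p + q + 1) = 0" using assms(1) by (simp add: algebra_simps)
    then have "complex_of_nat (p + q + 1) = 0" by (simp only: mult_eq_0_iff) simp
    then show False by (simp only: of_nat_eq_0_iff)
  qed
  then have "\<mu> + \<nu> = 2 * of_nat p + 1" using assms(2) by blast
  then have "2 * \<nu> = 2 * of_nat (p + q + 1)" unfolding assms(1) by (simp add: algebra_simps)
  then have "\<nu> = of_nat (p + q + 1)" by (simp only: mult_cancel_left) simp
  then show ?thesis using lommel_ii_pos_int_small_growth[of "p + q + 1" q] by simp
qed

lemma lommelS_terminating_small_growth:
  assumes "\<mu> + \<nu> = 2 * of_nat p + 1 \<or> \<mu> - \<nu> = 2 * of_nat p + 1"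
  shows "small_growth (lommelS_e \<mu> \<nu>)"
proof (cases rule: lommelS_e_cases[of \<mu> \<nu>])
  case generic
  then show ?thesis
    using lommel_gen_terminating_small_growth[of \<mu> \<nu> \<nu> p] lommel_gen_terminating_small_growth[of \<mu> \<nu> "-\<nu>" p] assms by auto
next
  case (ii q)
  then show ?thesis using terminating_lommel_ii_small_growth[OF ii(1) assms] by simp
next
  case (iii q)
  then show ?thesis using terminating_lommel_ii_small_growth[OF iii(1), of p] assms by auto
qed

section \<open>Subnormality\<close>

lemma norm_le_max_modulus:
  assumes "continuous_on UNIV f" "cmod z \<le> r"
  shows "cmod (f z) \<le> max_modulus f r"
  unfolding max_modulus_def
proof (rule cSup_upper)
  have "compact ((\<lambda>z. cmod (f z)) ` cball 0 r)"
    using assms(1) by (intro compact_continuous_image continuous_on_norm) (auto intro: continuous_on_subset)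
  then show "bdd_above ((\<lambda>z. cmod (f z)) ` cball 0 r)" by (intro bounded_imp_bdd_above compact_imp_bounded)
qed (use assms in auto)

text \<open>A limsup equal to 0 puts the quotient eventually below the rate 1/4; the constant
  \<open>C\<close> takes care of the disc where this has not yet set in.\<close>

lemma subnormal_imp_small_growth:
  assumes cont: "continuous_on UNIV f" and sub: "subnormal f"
  shows "small_growth f"
proof -
  define M where "M = max_modulus f"
  have "Limsup at_top (\<lambda>r::real. ereal (ln (ln (M r)) / r)) < ereal (1/4)"
    using sub by (simp add: subnormal_def M_def)
  then have "\<forall>\<^sub>F r in at_top. ereal (ln (ln (M r)) / r) < ereal (1/4)" by (rule Limsup_lessD)
  then obtain R0 where R0: "\<And>r. r \<ge> R0 \<Longrightarrow> ln (ln (M r)) / r < 1/4"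
    by (auto simp: eventually_at_top_linorder)
  define R where "R = max R0 1"
  have big: "M r \<le> exp (exp (r / 4))" if "r \<ge> R" for r
  proof -
    have r: "r \<ge> R0" "r > 0" using that by (auto simp: R_def)
    have l: "ln (ln (M r)) \<le> r / 4" using R0[OF r(1)] r(2) by (simp add: field_simps)
    \<comment> \<open>The case distinctions keep the argument independent of the values of
      \<open>ln\<close> at nonpositive arguments.\<close>
    have "ln (M r) \<le> exp (r / 4)"
    proof (cases "ln (M r) > 0")
      case True then show ?thesis using l by (metis exp_le_cancel_iff exp_ln)
    next
      case False then show ?thesis using exp_gt_zero[of "r / 4"] by linarith
    qed
    then show ?thesis
    proof (cases "M r > 0")
      case True then show ?thesis using \<open>ln (M r) \<le> exp (r / 4)\<close> by (metis exp_le_cancel_iff exp_ln)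
    next
      case False then show ?thesis using exp_gt_zero[of "exp (r / 4)"] by linarith
    qed
  qed
  define C where "C = 1 + \<bar>M R\<bar>"
  have "cmod (f z) \<le> exp (C * exp (cmod z / 4))" for z
  proof (cases "cmod z \<ge> R")
    case True
    have "cmod (f z) \<le> exp (1 * exp (cmod z / 4))"
      using norm_le_max_modulus[OF cont order_refl, of z] big[OF True] by (simp add: M_def)
    also have "\<dots> \<le> exp (C * exp (cmod z / 4))" by (simp add: C_def)
    finally show ?thesis .
  next
    case False
    then have "cmod (f z) \<le> M R" using norm_le_max_modulus[OF cont, of z R] by (simp add: M_def)
    also have "\<dots> \<le> exp (C * 1)" using exp_ge_add_one_self[of C] by (simp add: C_def)
    also have "\<dots> \<le> exp (C * exp (cmod z / 4))"
      unfolding exp_le_cancel_iff by (rule mult_left_mono) (auto simp: C_def)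
    finally show ?thesis .
  qed
  then show ?thesis unfolding small_growth_def by (intro exI[of _ C]) (auto simp: C_def)
qed

text \<open>\<open>subnormal\<close> asks for a limsup equal to 0, so a lower bound is required as
  well. A bounded \<open>f\<close> is constant by Liouville's theorem, and then so is the iterated
  logarithm; otherwise \<open>M r\<close> eventually exceeds \<open>exp 1\<close>, and the iterated
  logarithm lies between 0 and \<open>ln (C * (1 + r))\<close>.\<close>

lemma exponential_type_imp_subnormal:
  assumes hol: "f holomorphic_on UNIV" and C: "C > 0" "\<And>z. cmod (f z) \<le> exp (C * (1 + cmod z))"
  shows "subnormal f"
proof -
  have cont: "continuous_on UNIV f" using hol by (rule holomorphic_on_imp_continuous_on)
  define M where "M = max_modulus f"
  have "((\<lambda>r. ln (ln (M r)) / r) \<longlongrightarrow> 0) at_top"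
  proof (cases "bounded (range f)")
    case True
    then obtain c where c: "\<And>z. f z = c" using Liouville_theorem[OF hol] by (auto simp: constant_on_def)
    have "M r = cmod c" if "r \<ge> 0" for r
    proof -
      have "(\<lambda>z. cmod (f z)) ` cball 0 r = {cmod c}" using that by (simp add: c image_constant_conv)
      then show ?thesis by (simp add: M_def max_modulus_def)
    qed
    then have "\<forall>\<^sub>F r in at_top. ln (ln (cmod c)) / r = ln (ln (M r)) / r"
      by (intro eventually_at_top_linorderI[of 0]) simp
    moreover have "((\<lambda>r. ln (ln (cmod c)) / r) \<longlongrightarrow> 0) at_top"
      by (intro tendsto_divide_0[OF tendsto_const] filterlim_at_top_imp_at_infinity filterlim_ident)
    ultimately show ?thesis by (rule Lim_transform_eventually[rotated])
  next
    case False
    then obtain z0 where z0: "cmod (f z0) > exp 1" unfolding bounded_iff by (auto simp: not_le)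
    have lower: "ln (M r) \<ge> 1" if "r \<ge> cmod z0" for r
    proof -
      have "exp 1 < M r" using z0 norm_le_max_modulus[OF cont that] by (simp add: M_def)
      then show ?thesis by (metis exp_gt_zero less_imp_le less_trans ln_exp ln_le_cancel_iff)
    qed
    have upper: "ln (M r) \<le> C * (1 + r)" if "r \<ge> cmod z0" for r
    proof -
      have "r \<ge> 0" using that norm_ge_zero[of z0] by linarith
      have "M r \<le> exp (C * (1 + r))" unfolding M_def max_modulus_def
      proof (rule cSup_least)
        show "(\<lambda>z. cmod (f z)) ` cball 0 r \<noteq> {}" using \<open>r \<ge> 0\<close> by auto
        fix x assume "x \<in> (\<lambda>z. cmod (f z)) ` cball 0 r"
        then obtain z where "x = cmod (f z)" "cmod z \<le> r" by auto
        moreover have "C * (1 + cmod z) \<le> C * (1 + r)" using C(1) \<open>cmod z \<le> r\<close> by simp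
        ultimately show "x \<le> exp (C * (1 + r))" using C(2)[of z] by (metis exp_le_cancel_iff order_trans)
      qed
      moreover have "M r > 0" using z0 norm_le_max_modulus[OF cont that] exp_gt_zero[of "1::real"] unfolding M_def by linarith
      ultimately show ?thesis by (metis exp_gt_zero ln_exp ln_le_cancel_iff)
    qed
    show ?thesis
    proof (rule tendsto_sandwich[OF _ _ tendsto_const])
      show "\<forall>\<^sub>F r in at_top. 0 \<le> ln (ln (M r)) / r"
        using eventually_ge_at_top[of "max 1 (cmod z0)"]
        by eventually_elim (use lower in \<open>auto intro!: divide_nonneg_pos\<close>)
      show "\<forall>\<^sub>F r in at_top. ln (ln (M r)) / r \<le> ln (C * (1 + r)) / r"
        using eventually_ge_at_top[of "max 1 (cmod z0)"]
      proof eventually_elim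
        case (elim r)
        then have r: "r \<ge> cmod z0" "r > 0" by auto
        have "ln (ln (M r)) \<le> ln (C * (1 + r))"
          using lower[OF r(1)] upper[OF r(1)] by (intro ln_mono) auto
        then show ?case using r(2) by (intro divide_right_mono) auto
      qed
      show "((\<lambda>r. ln (C * (1 + r)) / r) \<longlongrightarrow> 0) at_top" using C(1) by real_asymp
    qed
  qed
  then have "((\<lambda>r. ereal (ln (ln (M r)) / r)) \<longlongrightarrow> 0) at_top"
    unfolding zero_ereal_def by (rule tendsto_ereal)
  then show ?thesis unfolding subnormal_def M_def[symmetric]
    by (intro lim_imp_Limsup) auto
qed

lemma exp_sum_subnormal:
  fixes a b :: "nat \<Rightarrow> complex"
  assumes "\<And>z. f z = (\<Sum>k\<le>p. b k * exp (a k * z))"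
  shows "subnormal f"
proof (rule exponential_type_imp_subnormal)
  have f: "f = (\<lambda>z. \<Sum>k\<le>p. b k * exp (a k * z))" using assms by blast
  show "f holomorphic_on UNIV" unfolding f by (intro holomorphic_intros)
  define s where "s = (\<Sum>k\<le>p. cmod (b k))"
  define t where "t = (\<Sum>k\<le>p. cmod (a k))"
  have s0: "s \<ge> 0" "t \<ge> 0" by (auto simp: s_def t_def intro!: sum_nonneg)
  show "1 + s + t > 0" using s0 by simp
  fix z
  have "cmod (f z) \<le> (\<Sum>k\<le>p. cmod (b k) * exp (t * cmod z))"
    unfolding assms
  proof (rule sum_norm_le)
    fix k assume k: "k \<in> {..p}"
    have "cmod (a k) \<le> t" unfolding t_def using k by (intro member_le_sum) auto
    then have "cmod (a k * z) \<le> t * cmod z" by (simp add: norm_mult mult_right_mono)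
    then have "cmod (exp (a k * z)) \<le> exp (t * cmod z)"
      using norm_exp[of "a k * z"] by (meson exp_le_cancel_iff order_trans)
    then show "cmod (b k * exp (a k * z)) \<le> cmod (b k) * exp (t * cmod z)"
      unfolding norm_mult by (rule mult_left_mono) simp
  qed
  also have "\<dots> = s * exp (t * cmod z)" by (simp add: s_def sum_distrib_right)
  also have "\<dots> \<le> exp s * exp (t * cmod z)"
  proof (rule mult_right_mono)
    show "s \<le> exp s" using exp_ge_add_one_self[of s] by linarith
  qed simp
  also have "\<dots> \<le> exp ((1 + s + t) * (1 + cmod z))"
    unfolding exp_add[symmetric] using s0 by (simp add: algebra_simps)
  finally show "cmod (f z) \<le> exp ((1 + s + t) * (1 + cmod z))" .
qed

theorem theorem1p2:
  fixes \<sigma> \<mu> \<nu> :: complex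
  assumes "\<sigma> \<noteq> 0"
  shows "(\<forall>f. (f holomorphic_on UNIV \<and>
               (\<forall>z. deriv (deriv f) z + (exp (2 * z) - \<nu>^2) * f z = \<sigma> * exp ((\<mu> + 1) * z)))
           \<longleftrightarrow> (\<exists>A B. \<forall>z. f z = A * besselJ_e \<nu> z + B * besselY_e \<nu> z + \<sigma> * lommelS_e \<mu> \<nu> z))
       \<and> (\<forall>f A B. (\<forall>z. f z = A * besselJ_e \<nu> z + B * besselY_e \<nu> z + \<sigma> * lommelS_e \<mu> \<nu> z) \<longrightarrow>
           (subnormal f \<longleftrightarrow>
              A = 0 \<and> B = 0 \<and>
              (\<exists>p::nat. (\<mu> + \<nu> = 2 * of_nat p + 1 \<or> \<mu> - \<nu> = 2 * of_nat p + 1) \<and>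
                 (\<forall>z. lommelS_e \<mu> \<nu> z =
                      exp ((\<mu> - 1) * z) * (\<Sum>k\<le>p. (-1)^k * lommel_c \<mu> \<nu> k * exp (- 2 * of_nat k * z))))))"
proof (rule conjI)
  let ?J = "besselJ_e \<nu>" and ?Y = "besselY_e \<nu>" and ?S = "lommelS_e \<mu> \<nu>"
  have sol: "solves \<nu> (\<lambda>z. A * ?J z + B * ?Y z + \<sigma> * ?S z) (\<lambda>z. \<sigma> * exp ((\<mu> + 1) * z))" for A B
    by (rule solves_cong[OF solves_add[OF solves_add[OF solves_cmult[OF solves_besselJ] solves_cmult[OF solves_besselY]] solves_cmult[OF solves_lommelS]]])
       simp_all
  have gen: "solves \<nu> f (\<lambda>z. \<sigma> * exp ((\<mu> + 1) * z)) \<longleftrightarrow> (\<exists>A B. \<forall>z. f z = A * ?J z + B * ?Y z + \<sigma> * ?S z)" for f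
  proof
    assume f: "solves \<nu> f (\<lambda>z. \<sigma> * exp ((\<mu> + 1) * z))"
    have "solves \<nu> (\<lambda>z. f z - \<sigma> * ?S z) (\<lambda>_. 0)"
      by (rule solves_cong[OF solves_diff[OF f solves_cmult[OF solves_lommelS]]]) simp_all
    then obtain A B where "\<And>z. f z - \<sigma> * ?S z = A * ?J z + B * ?Y z" using homogeneous_solution by blast
    then have "f z = A * ?J z + B * ?Y z + \<sigma> * ?S z" for z by (simp add: algebra_simps)
    then show "\<exists>A B. \<forall>z. f z = A * ?J z + B * ?Y z + \<sigma> * ?S z" by blast
  next
    assume "\<exists>A B. \<forall>z. f z = A * ?J z + B * ?Y z + \<sigma> * ?S z"
    then obtain A B where "\<And>z. f z = A * ?J z + B * ?Y z + \<sigma> * ?S z" by blast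
    then have "f = (\<lambda>z. A * ?J z + B * ?Y z + \<sigma> * ?S z)" by blast
    then show "solves \<nu> f (\<lambda>z. \<sigma> * exp ((\<mu> + 1) * z))" using sol[of A B] by simp
  qed
  then show "\<forall>f. (f holomorphic_on UNIV \<and>
               (\<forall>z. deriv (deriv f) z + (exp (2 * z) - \<nu>^2) * f z = \<sigma> * exp ((\<mu> + 1) * z)))
           \<longleftrightarrow> (\<exists>A B. \<forall>z. f z = A * ?J z + B * ?Y z + \<sigma> * ?S z)"
    unfolding solves_iff_deriv by blast
  show "\<forall>f A B. (\<forall>z. f z = A * ?J z + B * ?Y z + \<sigma> * ?S z) \<longrightarrow>
           (subnormal f \<longleftrightarrow>
              A = 0 \<and> B = 0 \<and>
              (\<exists>p::nat. (\<mu> + \<nu> = 2 * of_nat p + 1 \<or> \<mu> - \<nu> = 2 * of_nat p + 1) \<and>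
                 (\<forall>z. ?S z = exp ((\<mu> - 1) * z) * (\<Sum>k\<le>p. (-1)^k * lommel_c \<mu> \<nu> k * exp (- 2 * of_nat k * z)))))"
  proof (intro allI impI iffI)
    fix f A B
    assume f: "\<forall>z. f z = A * ?J z + B * ?Y z + \<sigma> * ?S z" and sub: "subnormal f"
    have fs: "solves \<nu> f (\<lambda>z. \<sigma> * exp ((\<mu> + 1) * z))" using gen f by blast
    have gr: "small_growth f"
      using solves_holomorphic[OF fs] sub by (intro subnormal_imp_small_growth holomorphic_on_imp_continuous_on)
    \<comment> \<open>This \<open>q\<close> gives the Lommel function its small growth; the closed
      form then comes with its own \<open>p\<close>.\<close>
    obtain q :: nat where "\<mu> + \<nu> = 2 * of_nat q + 1 \<or> \<mu> - \<nu> = 2 * of_nat q + 1"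
      using small_growth_solution[OF fs gr assms] by blast
    then have grS: "small_growth ?S" by (rule lommelS_terminating_small_growth)
    have S1: "solves \<nu> ?S (\<lambda>z. 1 * exp ((\<mu> + 1) * z))" using solves_lommelS by simp
    obtain p :: nat where p: "\<mu> + \<nu> = 2 * of_nat p + 1 \<or> \<mu> - \<nu> = 2 * of_nat p + 1"
      "\<And>z. ?S z = exp ((\<mu> - 1) * z) * (\<Sum>k\<le>p. (-1)^k * lommel_c \<mu> \<nu> k * exp (- 2 * of_nat k * z))"
      using small_growth_solution[OF S1 grS one_neq_zero] unfolding mult_1_left by blast
    have d: "f z + (- \<sigma>) * ?S z = A * ?J z + B * ?Y z" for z using f by simp
    have "small_growth (\<lambda>z. A * ?J z + B * ?Y z)"
      using small_growth_lincomb[OF gr grS, of 1 "- \<sigma>"] unfolding mult_1_left d .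
    moreover have "solves \<nu> (\<lambda>z. A * ?J z + B * ?Y z) (\<lambda>_. 0)"
      by (rule solves_cong[OF solves_add[OF solves_cmult[OF solves_besselJ] solves_cmult[OF solves_besselY]]]) simp_all
    ultimately have "A * ?J z + B * ?Y z = 0" for z by (intro homogeneous_small_growth_zero)
    then have "A = 0" "B = 0" by (rule bessel_independent)+
    with p show "A = 0 \<and> B = 0 \<and> (\<exists>p::nat. (\<mu> + \<nu> = 2 * of_nat p + 1 \<or> \<mu> - \<nu> = 2 * of_nat p + 1) \<and>
        (\<forall>z. ?S z = exp ((\<mu> - 1) * z) * (\<Sum>k\<le>p. (-1)^k * lommel_c \<mu> \<nu> k * exp (- 2 * of_nat k * z))))"
      by blast
  next
    fix f A B
    assume f: "\<forall>z. f z = A * ?J z + B * ?Y z + \<sigma> * ?S z"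
      and r: "A = 0 \<and> B = 0 \<and> (\<exists>p::nat. (\<mu> + \<nu> = 2 * of_nat p + 1 \<or> \<mu> - \<nu> = 2 * of_nat p + 1) \<and>
        (\<forall>z. ?S z = exp ((\<mu> - 1) * z) * (\<Sum>k\<le>p. (-1)^k * lommel_c \<mu> \<nu> k * exp (- 2 * of_nat k * z))))"
    then obtain p :: nat where p: "\<And>z. ?S z = exp ((\<mu> - 1) * z) * (\<Sum>k\<le>p. (-1)^k * lommel_c \<mu> \<nu> k * exp (- 2 * of_nat k * z))"
      by blast
    \<comment> \<open>Absorbing the prefactors makes every term a pure exponential, the form that
      \<open>exp_sum_subnormal\<close> expects.\<close>
    have "f z = (\<Sum>k\<le>p. (\<sigma> * ((-1)^k * lommel_c \<mu> \<nu> k)) * exp ((\<mu> - 1 - 2 * of_nat k) * z))" for z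
    proof -
      have e: "exp ((\<mu> - 1 - 2 * of_nat k) * z) = exp ((\<mu> - 1) * z) * exp (- 2 * of_nat k * z)" for k
        unfolding exp_add[symmetric] by (simp add: algebra_simps)
      have "f z = \<sigma> * ?S z" using f r by simp
      then show ?thesis unfolding p e sum_distrib_left by (simp only: mult_ac)
    qed
    then show "subnormal f" by (rule exp_sum_subnormal)
  qed
qed

end
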